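(* Over $\mathbf{HA}$, for each $n \geq 1$: (a) $\neg\neg\forall(\Sigma^0_n\text{-LEM})$ entails $\neg\neg\forall(\Pi^0_n\text{-LEM})$. (b) $\neg\neg\forall(\Pi^0_n\text{-LEM})$ entails $\neg\neg\forall(\Delta^0_n\text{-LEM})$, but $\neg\neg\forall(\Delta^0_n\text{-LEM})$ does not entail $\neg\neg\forall(\Pi^0_n\text{-LEM})$. (c) $\neg\neg\forall(\Sigma^0_n\text{-LEM})$ entails $\neg\neg\forall(\Sigma^0_n\text{-DNE})$, but $\neg\neg\forall(\Sigma^0_n\text{-DNE})$ does not entail $\neg\neg\forall(\Sigma^0_n\text{-LEM})$. (d) $\neg\neg\forall(\Sigma^0_n\text{-DNE})$ entails $\neg\neg\forall(\Delta^0_n\text{-LEM})$, but $\neg\neg\forall(\Delta^0_n\text{-LEM})$ does not entail $\neg\neg\forall(\Sigma^0_n\text{-DNE})$. (e) $\neg\neg\forall(\Sigma^0_n\text{-DNE})$ does not entail $\neg\neg\forall(\Pi^0_n\text{-LEM})$.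
   Context: $\mathbf{HA}$ is intuitionistic first-order (Heyting) arithmetic, with function symbols and defining equations for primitive recursive functions and induction for all formulas of its language. $\neg A$ is $A \to 0=1$. For $n \ge 1$, a $\Sigma^0_n$ formula is an arithmetical formula of the form $\exists x_1 \forall x_2 \exists x_3 \cdots Q x_n\, R$ with $n$ alternating number quantifiers beginning with $\exists$ and $R$ quantifier-free (free number variables as parameters are allowed); $\Pi^0_n$ is the same, beginning with $\forall$. The schemas are: $\Sigma^0_n$-LEM: $A \vee \neg A$ for $A \in \Sigma^0_n$; $\Pi^0_n$-LEM: $A \vee \neg A$ for $A \in \Pi^0_n$; $\Sigma^0_n$-DNE: $\neg\neg A \to A$ for $A \in \Sigma^0_n$; $\Delta^0_n$-LEM: $(A \leftrightarrow B) \to (B \vee \neg B)$ for $A \in \Pi^0_n$, $B \in \Sigma^0_n$. For each of these schemas $P$, $\neg\neg\forall(P)$ denotes the schema whose instances are the double negations of the universal closures of the instances of $P$. A schema $P$ entails a schema $Q$ over $\mathbf{HA}$ if $\mathbf{HA}$ together with all instances of $P$ as axioms proves every instance of $Q$. *)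

theory Defs
  imports Main
begin

section \<open>The language of Heyting arithmetic\<close>

text \<open>
  One function symbol for each primitive recursive description: \<open>Comp n f gs\<close> is the composition
  of \<open>f\<close> with the \<open>n\<close>-ary functions \<open>gs\<close> (the arity is recorded because \<open>gs\<close> may be empty), and
  \<open>Rec f g\<close> is defined by recursion on its first argument.
\<close>

datatype pr =
    Zero
  | Succ
  | Proj nat nat
  | Comp nat pr "pr list"
  | Rec pr pr

primrec arity :: "pr \<Rightarrow> nat" where
  "arity Zero = 0"
| "arity Succ = 1"
| "arity (Proj n i) = n"
| "arity (Comp n f gs) = n"
| "arity (Rec f g) = Suc (arity f)"

fun wf_pr :: "pr \<Rightarrow> bool" where
  "wf_pr Zero \<longleftrightarrow> True"
| "wf_pr Succ \<longleftrightarrow> True"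
| "wf_pr (Proj n i) \<longleftrightarrow> i < n"
| "wf_pr (Comp n f gs) \<longleftrightarrow>
     wf_pr f \<and> arity f = length gs \<and> (\<forall>g\<in>set gs. wf_pr g \<and> arity g = n)"
| "wf_pr (Rec f g) \<longleftrightarrow> wf_pr f \<and> wf_pr g \<and> arity g = arity f + 2"

text \<open>
  Variables are de Bruijn indices; an index not below the number of enclosing quantifiers is a
  free number variable.
\<close>

datatype tm = Var nat | App pr "tm list"

datatype fm =
    Eq tm tm
  | And fm fm
  | Or fm fm
  | Imp fm fm
  | All fm
  | Ex fm

fun wf_tm :: "tm \<Rightarrow> bool" where
  "wf_tm (Var i) \<longleftrightarrow> True"
| "wf_tm (App f ts) \<longleftrightarrow> wf_pr f \<and> length ts = arity f \<and> (\<forall>t\<in>set ts. wf_tm t)"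

primrec wf_fm :: "fm \<Rightarrow> bool" where
  "wf_fm (Eq s t) \<longleftrightarrow> wf_tm s \<and> wf_tm t"
| "wf_fm (And A B) \<longleftrightarrow> wf_fm A \<and> wf_fm B"
| "wf_fm (Or A B) \<longleftrightarrow> wf_fm A \<and> wf_fm B"
| "wf_fm (Imp A B) \<longleftrightarrow> wf_fm A \<and> wf_fm B"
| "wf_fm (All A) \<longleftrightarrow> wf_fm A"
| "wf_fm (Ex A) \<longleftrightarrow> wf_fm A"

abbreviation zero :: tm where
  "zero \<equiv> App Zero []"

abbreviation succ :: "tm \<Rightarrow> tm" where
  "succ t \<equiv> App Succ [t]"

definition Falsum :: fm where
  "Falsum = Eq zero (succ zero)"

definition Neg :: "fm \<Rightarrow> fm" where
  "Neg A = Imp A Falsum"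

definition Iff :: "fm \<Rightarrow> fm \<Rightarrow> fm" where
  "Iff A B = And (Imp A B) (Imp B A)"


subsection \<open>Simultaneous substitution\<close>

primrec subst_tm :: "(nat \<Rightarrow> tm) \<Rightarrow> tm \<Rightarrow> tm" where
  "subst_tm \<sigma> (Var i) = \<sigma> i"
| "subst_tm \<sigma> (App f ts) = App f (map (subst_tm \<sigma>) ts)"

definition up :: "(nat \<Rightarrow> tm) \<Rightarrow> nat \<Rightarrow> tm" where
  "up \<sigma> = case_nat (Var 0) (\<lambda>i. subst_tm (\<lambda>j. Var (Suc j)) (\<sigma> i))"

primrec subst :: "(nat \<Rightarrow> tm) \<Rightarrow> fm \<Rightarrow> fm" where
  "subst \<sigma> (Eq s t) = Eq (subst_tm \<sigma> s) (subst_tm \<sigma> t)"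
| "subst \<sigma> (And A B) = And (subst \<sigma> A) (subst \<sigma> B)"
| "subst \<sigma> (Or A B) = Or (subst \<sigma> A) (subst \<sigma> B)"
| "subst \<sigma> (Imp A B) = Imp (subst \<sigma> A) (subst \<sigma> B)"
| "subst \<sigma> (All A) = All (subst (up \<sigma>) A)"
| "subst \<sigma> (Ex A) = Ex (subst (up \<sigma>) A)"

definition shift :: "fm \<Rightarrow> fm" where
  "shift = subst (\<lambda>i. Var (Suc i))"

text \<open>\<open>inst t A\<close> instantiates the outermost variable of a quantifier body \<open>A\<close> by \<open>t\<close>.\<close>

definition inst :: "tm \<Rightarrow> fm \<Rightarrow> fm" where
  "inst t = subst (case_nat t Var)"


section \<open>Intuitionistic predicate logic with equality\<close>

text \<open>
  Natural deduction from the axioms \<open>T\<close> and the assumptions \<open>\<Gamma>\<close>. The rules \<open>AllI\<close> and \<open>ExE\<close> shift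
  the assumptions but not the axioms, so free variables of axioms are read as
  universally quantified. The side conditions restrict derivations to well-formed formulas.
  Since absurdity is the equation 0 = 1, ex falso quodlibet is a rule about that equation.
\<close>

inductive derives :: "fm set \<Rightarrow> fm list \<Rightarrow> fm \<Rightarrow> bool" for T :: "fm set" where
  Axiom: "A \<in> T \<Longrightarrow> wf_fm A \<Longrightarrow> derives T \<Gamma> A"
| Assm: "A \<in> set \<Gamma> \<Longrightarrow> wf_fm A \<Longrightarrow> derives T \<Gamma> A"
| FalsumE: "derives T \<Gamma> Falsum \<Longrightarrow> wf_fm A \<Longrightarrow> derives T \<Gamma> A"
| AndI: "derives T \<Gamma> A \<Longrightarrow> derives T \<Gamma> B \<Longrightarrow> derives T \<Gamma> (And A B)"
| AndE1: "derives T \<Gamma> (And A B) \<Longrightarrow> derives T \<Gamma> A"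
| AndE2: "derives T \<Gamma> (And A B) \<Longrightarrow> derives T \<Gamma> B"
| OrI1: "derives T \<Gamma> A \<Longrightarrow> wf_fm B \<Longrightarrow> derives T \<Gamma> (Or A B)"
| OrI2: "derives T \<Gamma> B \<Longrightarrow> wf_fm A \<Longrightarrow> derives T \<Gamma> (Or A B)"
| OrE: "derives T \<Gamma> (Or A B) \<Longrightarrow> derives T (A # \<Gamma>) C \<Longrightarrow> derives T (B # \<Gamma>) C \<Longrightarrow> derives T \<Gamma> C"
| ImpI: "derives T (A # \<Gamma>) B \<Longrightarrow> wf_fm A \<Longrightarrow> derives T \<Gamma> (Imp A B)"
| ImpE: "derives T \<Gamma> (Imp A B) \<Longrightarrow> derives T \<Gamma> A \<Longrightarrow> derives T \<Gamma> B"
| AllI: "derives T (map shift \<Gamma>) A \<Longrightarrow> derives T \<Gamma> (All A)"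
| AllE: "derives T \<Gamma> (All A) \<Longrightarrow> wf_tm t \<Longrightarrow> derives T \<Gamma> (inst t A)"
| ExI: "derives T \<Gamma> (inst t A) \<Longrightarrow> wf_tm t \<Longrightarrow> wf_fm A \<Longrightarrow> derives T \<Gamma> (Ex A)"
| ExE: "derives T \<Gamma> (Ex A) \<Longrightarrow> derives T (A # map shift \<Gamma>) (shift B) \<Longrightarrow> wf_fm B \<Longrightarrow> derives T \<Gamma> B"
| EqRefl: "wf_tm t \<Longrightarrow> derives T \<Gamma> (Eq t t)"
| EqSubst: "derives T \<Gamma> (Eq s t) \<Longrightarrow> derives T \<Gamma> (inst s A) \<Longrightarrow> wf_fm A \<Longrightarrow> derives T \<Gamma> (inst t A)"


section \<open>The axioms of HA\<close>

text \<open>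
  In \<open>Induction\<close>, the substitution replaces the outermost variable of \<open>A\<close> by its successor and
  fixes the other variables.
\<close>

inductive_set HA :: "fm set" where
  Succ_not_zero: "wf_tm t \<Longrightarrow> Neg (Eq (succ t) zero) \<in> HA"
| Succ_inject: "wf_tm s \<Longrightarrow> wf_tm t \<Longrightarrow> Imp (Eq (succ s) (succ t)) (Eq s t) \<in> HA"
| Proj_eq: "wf_tm (App (Proj n i) ts) \<Longrightarrow> Eq (App (Proj n i) ts) (ts ! i) \<in> HA"
| Comp_eq: "wf_tm (App (Comp n f gs) ts) \<Longrightarrow>
    Eq (App (Comp n f gs) ts) (App f (map (\<lambda>g. App g ts) gs)) \<in> HA"
| Rec_zero: "wf_tm (App (Rec f g) (zero # ts)) \<Longrightarrow>
    Eq (App (Rec f g) (zero # ts)) (App f ts) \<in> HA"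
| Rec_succ: "wf_tm (App (Rec f g) (succ t # ts)) \<Longrightarrow>
    Eq (App (Rec f g) (succ t # ts)) (App g (t # App (Rec f g) (t # ts) # ts)) \<in> HA"
| Induction: "wf_fm A \<Longrightarrow>
    Imp (inst zero A)
      (Imp (All (Imp A (subst (case_nat (succ (Var 0)) (\<lambda>i. Var (Suc i))) A)))
        (All A)) \<in> HA"


section \<open>Arithmetical hierarchy and schemas\<close>

primrec qfree :: "fm \<Rightarrow> bool" where
  "qfree (Eq s t) \<longleftrightarrow> True"
| "qfree (And A B) \<longleftrightarrow> qfree A \<and> qfree B"
| "qfree (Or A B) \<longleftrightarrow> qfree A \<and> qfree B"
| "qfree (Imp A B) \<longleftrightarrow> qfree A \<and> qfree B"
| "qfree (All A) \<longleftrightarrow> False"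
| "qfree (Ex A) \<longleftrightarrow> False"

fun Sigma_fm :: "nat \<Rightarrow> fm set" and Pi_fm :: "nat \<Rightarrow> fm set" where
  "Sigma_fm 0 = {A. wf_fm A \<and> qfree A}"
| "Sigma_fm (Suc n) = Ex ` Pi_fm n"
| "Pi_fm 0 = {A. wf_fm A \<and> qfree A}"
| "Pi_fm (Suc n) = All ` Sigma_fm n"

text \<open>A schema is identified with the set of its instances.\<close>

definition Sigma_LEM :: "nat \<Rightarrow> fm set" where
  "Sigma_LEM n = {Or A (Neg A) | A. A \<in> Sigma_fm n}"

definition Pi_LEM :: "nat \<Rightarrow> fm set" where
  "Pi_LEM n = {Or A (Neg A) | A. A \<in> Pi_fm n}"

definition Sigma_DNE :: "nat \<Rightarrow> fm set" where
  "Sigma_DNE n = {Imp (Neg (Neg A)) A | A. A \<in> Sigma_fm n}"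

definition Delta_LEM :: "nat \<Rightarrow> fm set" where
  "Delta_LEM n = {Imp (Iff A B) (Or B (Neg B)) | A B. A \<in> Pi_fm n \<and> B \<in> Sigma_fm n}"

text \<open>
  \<open>fv_bound A\<close> is the least \<open>k\<close> such that all free variables of \<open>A\<close> are below \<open>k\<close>; prefixing \<open>A\<close>
  with that many universal quantifiers binds all its free variables.
\<close>

primrec fv_bound_tm :: "tm \<Rightarrow> nat" where
  "fv_bound_tm (Var i) = Suc i"
| "fv_bound_tm (App f ts) = foldr max (map fv_bound_tm ts) 0"

primrec fv_bound :: "fm \<Rightarrow> nat" where
  "fv_bound (Eq s t) = max (fv_bound_tm s) (fv_bound_tm t)"
| "fv_bound (And A B) = max (fv_bound A) (fv_bound B)"
| "fv_bound (Or A B) = max (fv_bound A) (fv_bound B)"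
| "fv_bound (Imp A B) = max (fv_bound A) (fv_bound B)"
| "fv_bound (All A) = fv_bound A - 1"
| "fv_bound (Ex A) = fv_bound A - 1"

definition univ_closure :: "fm \<Rightarrow> fm" where
  "univ_closure A = (All ^^ fv_bound A) A"

definition nn_closure :: "fm set \<Rightarrow> fm set" where
  "nn_closure P = {Neg (Neg (univ_closure A)) | A. A \<in> P}"

definition entails :: "fm set \<Rightarrow> fm set \<Rightarrow> bool" where
  "entails P Q \<longleftrightarrow> (\<forall>A\<in>Q. derives (HA \<union> P) [] A)"

end

theory Submission
  imports Defs "HOL-Library.Nat_Bijection"
begin

text \<open>
  The entailments hold without the double negations and closures: a derivation from a schema uses
  finitely many instances, whose closures can be moved to the left of the sequent, and double
  negation commutes with finite conjunctions of assumptions. For the entailments themselves, every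
  prenex \<open>A\<close> has a dual \<open>dl A\<close>, obtained by exchanging the quantifiers and negating the
  matrix, and \<open>A \<or> dl A\<close> is proved by induction on the number of quantifiers.

  The separations use realizability over the computable functions with an oracle for the
  \<open>(n - 1)\<close>-st jump, which decide all formulas with at most \<open>n - 1\<close> quantifiers. The double
  negations are harmless since \<open>\<not>\<not>A\<close> is realizable if and only if \<open>A\<close> is. Kleene's
  realizability validates \<open>\<Sigma>\<^sub>n\<close>-DNE by unbounded search, while a realizer of \<open>\<Pi>\<^sub>n\<close>-LEM would
  decide the diagonal halting problem. In modified realizability a potential witness is always
  produced and can be checked, so \<open>\<Delta>\<^sub>n\<close>-LEM is realized and \<open>\<Sigma>\<^sub>n\<close>-DNE would decide the diagonal
  halting problem.
\<close>

subsection \<open>Primitive recursive functions\<close>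

text \<open>Level \<open>n - 1\<close> of the oracle is forced from both sides. Formulas with
  \<open>n - 1\<close> quantifiers must be decidable by programs, so that a proposed witness of a
  \<open>Sigma_fm n\<close> formula can be checked, while the diagonal halting problem of the same
  programs is itself definable in \<open>Sigma_fm n\<close> and supplies the undecidable instance.
  Kleene's realizability cannot serve for both separations, since it realizes the very schema that
  the second one refutes; the additional potential world makes a realizer of an implication
  terminate even on potential realizers of a false premise.

  The obstacle on the syntactic side is that the schemas speak of literally prenex formulas with
  exactly \<open>n\<close> quantifiers. Dummy quantifiers raise a formula to level \<open>n\<close>,
  and in the passage from \<open>Sigma_DNE\<close> to \<open>Delta_LEM\<close> a disjunction of two
  formulas of \<open>Sigma_fm n\<close> has to be brought back into that class by a derivation in
  HA. The two witnesses are merged by parity, because the facts about doubling and halving that this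
  takes need a single induction.\<close>

primrec pev :: "pr \<Rightarrow> nat list \<Rightarrow> nat" where
  "pev Zero = (\<lambda>_. 0)"
| "pev Succ = (\<lambda>xs. Suc (hd xs))"
| "pev (Proj n i) = (\<lambda>xs. xs ! i)"
| "pev (Comp n f gs) = (\<lambda>xs. pev f (map (\<lambda>h. h xs) (map pev gs)))"
| "pev (Rec f g) = (\<lambda>xs. rec_nat (pev f (tl xs)) (\<lambda>m r. pev g (m # r # tl xs)) (hd xs))"

text \<open>Only lists of length \<open>n\<close> are compared, because on other lists
  \<open>pev\<close> may meet \<open>hd\<close>, \<open>tl\<close> and \<open>!\<close> outside
  their domains. Speaking of functions on lists allows closure rules that never write down a
  description.\<close>

definition PR :: "nat \<Rightarrow> (nat list \<Rightarrow> nat) \<Rightarrow> bool" where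
  "PR n F \<longleftrightarrow> (\<exists>p. wf_pr p \<and> arity p = n \<and> (\<forall>xs. length xs = n \<longrightarrow> pev p xs = F xs))"

lemma PR_cong: "PR n F \<Longrightarrow> (\<And>xs. length xs = n \<Longrightarrow> F xs = G xs) \<Longrightarrow> PR n G"
  unfolding PR_def by metis

lemma PR_nth: "i < n \<Longrightarrow> PR n (\<lambda>xs. xs ! i)"
  unfolding PR_def by (rule exI[of _ "Proj n i"]) simp

lemma PR_comp:
  assumes "PR k F" "length Gs = k" "\<And>G. G \<in> set Gs \<Longrightarrow> PR n G"
  shows "PR n (\<lambda>xs. F (map (\<lambda>G. G xs) Gs))"
proof -
  obtain p where p: "wf_pr p" "arity p = k" "\<And>xs. length xs = k \<Longrightarrow> pev p xs = F xs"
    using assms(1) unfolding PR_def by auto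
  have "\<forall>G\<in>set Gs. \<exists>q. wf_pr q \<and> arity q = n \<and> (\<forall>xs. length xs = n \<longrightarrow> pev q xs = G xs)"
    using assms(3) unfolding PR_def by auto
  then obtain h where h: "\<And>G. G \<in> set Gs \<Longrightarrow>
      wf_pr (h G) \<and> arity (h G) = n \<and> (\<forall>xs. length xs = n \<longrightarrow> pev (h G) xs = G xs)"
    by metis
  show ?thesis
    unfolding PR_def
  proof (intro exI[of _ "Comp n p (map h Gs)"] conjI allI impI)
    show "wf_pr (Comp n p (map h Gs))" using p h assms(2) by auto
    fix xs :: "nat list" assume "length xs = n"
    then have "map (\<lambda>q. q xs) (map pev (map h Gs)) = map (\<lambda>G. G xs) Gs"
      using h by simp
    then show "pev (Comp n p (map h Gs)) xs = F (map (\<lambda>G. G xs) Gs)"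
      using p(3)[of "map (\<lambda>G. G xs) Gs"] assms(2) by (simp only: pev.simps length_map)
  qed simp
qed

lemma PR_1: "PR (Suc 0) (\<lambda>xs. f (xs ! 0)) \<Longrightarrow> PR n G \<Longrightarrow> PR n (\<lambda>xs. f (G xs))"
  using PR_comp[of "Suc 0" "\<lambda>xs. f (xs ! 0)" "[G]" n] by simp

lemma PR_2:
  "PR 2 (\<lambda>xs. f (xs ! 0) (xs ! 1)) \<Longrightarrow> PR n G \<Longrightarrow> PR n H \<Longrightarrow> PR n (\<lambda>xs. f (G xs) (H xs))"
  using PR_comp[of 2 "\<lambda>xs. f (xs ! 0) (xs ! 1)" "[G, H]" n] by auto

lemma PR_Suc: "PR n G \<Longrightarrow> PR n (\<lambda>xs. Suc (G xs))"
proof (rule PR_1[of Suc])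
  show "PR (Suc 0) (\<lambda>xs. Suc (xs ! 0))"
    unfolding PR_def by (rule exI[of _ Succ]) (auto simp: length_Suc_conv)
qed

lemma PR_const: "PR n (\<lambda>xs. k)"
proof (induction k)
  case 0
  have "PR 0 (\<lambda>_. 0)" unfolding PR_def by (rule exI[of _ Zero]) simp
  from PR_comp[OF this, of "[]" n] show ?case by simp
qed (rule PR_Suc)

lemma PR_rec:
  assumes A: "PR n A" and F: "PR n F" and G: "PR (Suc (Suc n)) G"
  shows "PR n (\<lambda>xs. rec_nat (F xs) (\<lambda>m r. G (m # r # xs)) (A xs))"
proof -
  obtain p where p: "wf_pr p" "arity p = n" "\<And>xs. length xs = n \<Longrightarrow> pev p xs = F xs"
    using F unfolding PR_def by auto
  obtain q where q: "wf_pr q" "arity q = Suc (Suc n)"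
      "\<And>xs. length xs = Suc (Suc n) \<Longrightarrow> pev q xs = G xs"
    using G unfolding PR_def by auto
  have rec: "PR (Suc n) (\<lambda>ys. rec_nat (F (tl ys)) (\<lambda>m r. G (m # r # tl ys)) (hd ys))"
    unfolding PR_def
  proof (intro exI[of _ "Rec p q"] conjI allI impI)
    fix xs :: "nat list" assume "length xs = Suc n"
    then have "length (tl xs) = n" by simp
    then show "pev (Rec p q) xs =
        rec_nat (F (tl xs)) (\<lambda>m r. G (m # r # tl xs)) (hd xs)"
      using p q by simp
  qed (use p q in auto)
  \<comment> \<open>Composition with \<open>A\<close> in front of all projections moves the
    recursion from the head of the list to the value of \<open>A\<close> and keeps the whole list as
    parameters.\<close>
  have "PR n (\<lambda>xs. (\<lambda>ys. rec_nat (F (tl ys)) (\<lambda>m r. G (m # r # tl ys)) (hd ys))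
      (map (\<lambda>G. G xs) (A # map (\<lambda>i xs. xs ! i) [0..<n])))"
    by (rule PR_comp[OF rec]) (auto intro: PR_nth A)
  then show ?thesis
    by (rule PR_cong) (auto simp: comp_def map_nth)
qed

lemma PR_pred: "PR n G \<Longrightarrow> PR n (\<lambda>xs. G xs - 1)"
proof (rule PR_1[of "\<lambda>x. x - 1"])
  have "PR 1 (\<lambda>xs. rec_nat 0 (\<lambda>m r. (m # r # xs) ! 0) (xs ! 0))"
    by (rule PR_rec) (intro PR_nth PR_const; simp)+
  moreover have "rec_nat 0 (\<lambda>m r. m) x = x - 1" for x :: nat by (cases x) auto
  ultimately show "PR (Suc 0) (\<lambda>xs. xs ! 0 - 1)" by simp
qed

lemma PR_add: "PR n F \<Longrightarrow> PR n G \<Longrightarrow> PR n (\<lambda>xs. F xs + G xs)"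
proof (rule PR_2[of "(+)"])
  have "PR 2 (\<lambda>xs. rec_nat (xs ! 1) (\<lambda>m r. Suc ((m # r # xs) ! 1)) (xs ! 0))"
    by (rule PR_rec) (intro PR_nth PR_Suc; simp)+
  moreover have "rec_nat y (\<lambda>m r. Suc r) x = x + y" for x y :: nat by (induction x) auto
  ultimately show "PR 2 (\<lambda>xs. xs ! 0 + xs ! 1)" by simp
qed

lemma PR_diff: "PR n F \<Longrightarrow> PR n G \<Longrightarrow> PR n (\<lambda>xs. F xs - G xs)"
proof (rule PR_2[of "(-)"])
  have "PR 2 (\<lambda>xs. rec_nat (xs ! 0) (\<lambda>m r. (m # r # xs) ! 1 - 1) (xs ! 1))"
    by (rule PR_rec) (intro PR_nth PR_pred; simp)+
  moreover have "rec_nat x (\<lambda>m r. r - 1) y = x - y" for x y :: nat by (induction y) auto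
  ultimately show "PR 2 (\<lambda>xs. xs ! 0 - xs ! 1)" by simp
qed

lemma PR_triangle: "PR n F \<Longrightarrow> PR n (\<lambda>xs. triangle (F xs))"
proof (rule PR_1[of triangle])
  have "PR 1 (\<lambda>xs. rec_nat 0 (\<lambda>m r. (m # r # xs) ! 1 + Suc ((m # r # xs) ! 0)) (xs ! 0))"
    by (rule PR_rec) (intro PR_nth PR_Suc PR_const PR_add; simp)+
  moreover have "rec_nat 0 (\<lambda>m r. r + Suc m) x = triangle x" for x :: nat
    by (induction x) auto
  ultimately show "PR (Suc 0) (\<lambda>xs. triangle (xs ! 0))" by (simp del: triangle_Suc)
qed

lemma PR_iszero: "PR n F \<Longrightarrow> PR n (\<lambda>xs. if F xs = 0 then 1 else 0)"
proof (rule PR_1[of "\<lambda>x. if x = 0 then 1 else 0"])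
  have "PR 1 (\<lambda>xs. rec_nat 1 (\<lambda>m r. (\<lambda>_. 0) (m # r # xs)) (xs ! 0))"
    by (rule PR_rec) (intro PR_nth PR_const; simp)+
  moreover have "rec_nat (Suc 0) (\<lambda>m r. 0) x = (if x = 0 then Suc 0 else 0)" for x :: nat
    by (cases x) auto
  ultimately show "PR (Suc 0) (\<lambda>xs. if xs ! 0 = 0 then 1 else 0)"
    by (simp only: One_nat_def)
qed

section \<open>Cantor pairing and its primitive recursive inverse\<close>

definition pair :: "nat \<Rightarrow> nat \<Rightarrow> nat" where "pair a b = prod_encode (a, b)"
definition p1 :: "nat \<Rightarrow> nat" where "p1 c = fst (prod_decode c)"
definition p2 :: "nat \<Rightarrow> nat" where "p2 c = snd (prod_decode c)"

lemma p1_pair [simp]: "p1 (pair a b) = a" and p2_pair [simp]: "p2 (pair a b) = b"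
  and pair_p [simp]: "pair (p1 c) (p2 c) = c"
  and pair_eq [simp]: "pair a b = pair a' b' \<longleftrightarrow> a = a' \<and> b = b'"
  by (simp_all add: pair_def p1_def p2_def)

lemma pair_cases: obtains a b where "x = pair a b"
  by (metis pair_p)

text \<open>\<open>p1 c + p2 c\<close> is the index of the diagonal through \<open>c\<close>.\<close>

definition diag :: "nat \<Rightarrow> nat" where
  "diag = rec_nat 0 (\<lambda>m r. r + (if Suc m = triangle (Suc r) then 1 else 0))"

lemma diag_bounds: "triangle (diag c) \<le> c \<and> c < triangle (Suc (diag c))"
  by (induction c) (auto simp: diag_def)

lemma triangle_mono: "m \<le> n \<Longrightarrow> triangle m \<le> triangle n"
  by (rule lift_Suc_mono_le[of triangle]) auto

text \<open>By \<open>diag_bounds\<close>, \<open>diag c\<close> is an index \<open>s\<close> with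
  \<open>triangle s \<le> c < triangle (Suc s)\<close>. Monotonicity of \<open>triangle\<close>
  leaves only one such index, and \<open>a + b\<close> is one.\<close>

lemma diag_pair: "diag (pair a b) = a + b"
proof -
  let ?c = "pair a b" and ?s = "diag (pair a b)"
  have c: "?c = triangle (a + b) + a" by (simp add: pair_def prod_encode_def)
  have "\<not> Suc ?s \<le> a + b"
    using diag_bounds[of ?c] triangle_mono[of "Suc ?s" "a + b"] c by linarith
  moreover have "\<not> Suc (a + b) \<le> ?s"
    using diag_bounds[of ?c] triangle_mono[of "Suc (a + b)" ?s] c by auto
  ultimately show ?thesis by simp
qed

lemma p1_eq: "p1 c = c - triangle (diag c)" and p2_eq: "p2 c = diag c - p1 c"
proof -
  obtain a b where c: "c = pair a b" by (rule pair_cases)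
  show "p1 c = c - triangle (diag c)" "p2 c = diag c - p1 c"
    unfolding c diag_pair by (simp_all, simp add: pair_def prod_encode_def)
qed

lemma PR_diag: "PR n F \<Longrightarrow> PR n (\<lambda>xs. diag (F xs))"
proof (rule PR_1[of diag])
  have "PR 1 (\<lambda>xs. rec_nat 0 (\<lambda>m r. (m # r # xs) ! 1 +
      (if (Suc ((m # r # xs) ! 0) - triangle (Suc ((m # r # xs) ! 1))) +
          (triangle (Suc ((m # r # xs) ! 1)) - Suc ((m # r # xs) ! 0)) = 0 then 1 else 0)) (xs ! 0))"
    by (rule PR_rec)
      (intro PR_nth PR_Suc PR_const PR_add PR_diff PR_iszero PR_triangle; simp)+
  \<comment> \<open>Equality is tested by the vanishing of both truncated differences, the form to
    which \<open>PR_iszero\<close> applies.\<close>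
  moreover have "(if (Suc m - t) + (t - Suc m) = 0 then 1 else 0) =
      (if Suc m = t then 1 else (0::nat))" for m t
    by auto
  ultimately show "PR (Suc 0) (\<lambda>xs. diag (xs ! 0))"
    by (simp del: triangle_Suc add_is_0 diff_is_0_eq add: diag_def)
qed

text \<open>From here on only unary functions are considered, tuples being coded by \<open>pair\<close>.\<close>

definition pu :: "(nat \<Rightarrow> nat) \<Rightarrow> bool" where
  "pu f \<longleftrightarrow> PR 1 (\<lambda>xs. f (xs ! 0))"

lemma pu_o: "pu f \<Longrightarrow> pu g \<Longrightarrow> pu (\<lambda>x. f (g x))"
  unfolding pu_def using PR_1[of f] by simp

lemma pu_id: "pu (\<lambda>x. x)"
  unfolding pu_def by (rule PR_nth) simp

lemma pu_const: "pu (\<lambda>x. k)"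
  unfolding pu_def by (rule PR_const)

lemma pu_Suc: "pu f \<Longrightarrow> pu (\<lambda>x. Suc (f x))"
  unfolding pu_def by (rule PR_Suc)

lemma pu_add: "pu f \<Longrightarrow> pu g \<Longrightarrow> pu (\<lambda>x. f x + g x)"
  unfolding pu_def by (rule PR_add)

lemma pu_diff: "pu f \<Longrightarrow> pu g \<Longrightarrow> pu (\<lambda>x. f x - g x)"
  unfolding pu_def by (rule PR_diff)

lemma pair_triangle: "pair a b = triangle (a + b) + a"
  by (simp add: pair_def prod_encode_def)

lemma PR_pair: "PR n F \<Longrightarrow> PR n G \<Longrightarrow> PR n (\<lambda>xs. pair (F xs) (G xs))"
  unfolding pair_triangle by (intro PR_add PR_triangle)

lemma pu_pair: "pu f \<Longrightarrow> pu g \<Longrightarrow> pu (\<lambda>x. pair (f x) (g x))"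
  unfolding pu_def by (rule PR_pair)

lemma pu_p1: "pu f \<Longrightarrow> pu (\<lambda>x. p1 (f x))"
  unfolding pu_def p1_eq by (intro PR_diff PR_triangle PR_diag)

lemma pu_p2: "pu f \<Longrightarrow> pu (\<lambda>x. p2 (f x))"
  unfolding p2_eq by (intro pu_diff pu_p1) (auto simp: pu_def intro: PR_diag)

lemma pu_rec:
  assumes "pu a" "pu f" "pu g"
  shows "pu (\<lambda>x. rec_nat (f x) (\<lambda>m r. g (pair m (pair r x))) (a x))"
proof -
  have "PR 1 (\<lambda>xs. rec_nat (f (xs ! 0))
      (\<lambda>m r. (\<lambda>ys. g (pair (ys ! 0) (pair (ys ! 1) (ys ! 2)))) (m # r # xs)) (a (xs ! 0)))"
    using assms(1,2) unfolding pu_def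
  proof (rule PR_rec)
    show "PR (Suc (Suc 1)) (\<lambda>ys. g (pair (ys ! 0) (pair (ys ! 1) (ys ! 2))))"
      by (rule PR_1[of g], use assms(3) in \<open>simp add: pu_def\<close>, intro PR_pair PR_nth) auto
  qed
  then show ?thesis by (simp add: pu_def)
qed

text \<open>Truth is coded by 0. This turns a decidable predicate into an equation with right-hand
  side \<open>zero\<close>, and it agrees with \<open>cIf\<close>, the search and the jump, all of
  which test for 0.\<close>

definition pd :: "(nat \<Rightarrow> bool) \<Rightarrow> bool" where
  "pd P \<longleftrightarrow> pu (\<lambda>x. if P x then 0 else 1)"

lemma pu_if0: "pu f \<Longrightarrow> pu (\<lambda>x. if f x = 0 then 1 else 0)"
  unfolding pu_def by (rule PR_iszero)

lemma pd_eq0: "pu f \<Longrightarrow> pd (\<lambda>x. f x = 0)"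
proof -
  assume "pu f"
  then have "pu (\<lambda>x. if (if f x = 0 then 1 else 0) = (0::nat) then 1 else 0)"
    by (intro pu_if0)
  moreover have "(\<lambda>x. if (if f x = 0 then 1 else 0) = (0::nat) then 1 else 0) =
      (\<lambda>x. if f x = 0 then 0 else (1::nat))"
    by auto
  ultimately show ?thesis unfolding pd_def by simp
qed

lemma pd_eq: "pu f \<Longrightarrow> pu g \<Longrightarrow> pd (\<lambda>x. f x = g x)"
proof -
  assume "pu f" "pu g"
  then have "pd (\<lambda>x. (f x - g x) + (g x - f x) = 0)"
    by (intro pd_eq0 pu_add pu_diff)
  moreover have "(\<lambda>x. (f x - g x) + (g x - f x) = 0) = (\<lambda>x. f x = g x)"
    by (auto simp: fun_eq_iff)
  ultimately show ?thesis by simp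
qed

lemma pd_iff: "pd P \<longleftrightarrow> (\<exists>f. pu f \<and> (\<forall>x. P x \<longleftrightarrow> f x = 0))"
proof
  assume "pd P"
  then show "\<exists>f. pu f \<and> (\<forall>x. P x \<longleftrightarrow> f x = 0)"
    unfolding pd_def by (intro exI[of _ "\<lambda>x. if P x then 0 else 1"]) auto
next
  assume "\<exists>f. pu f \<and> (\<forall>x. P x \<longleftrightarrow> f x = 0)"
  then obtain f where "pu f" "P = (\<lambda>x. f x = 0)" by (auto simp: fun_eq_iff)
  then show "pd P" by (simp add: pd_eq0)
qed

lemma pd_o: "pd P \<Longrightarrow> pu f \<Longrightarrow> pd (\<lambda>x. P (f x))"
  unfolding pd_def by (rule pu_o[of "\<lambda>x. if P x then 0 else 1"])

lemma pd_not: "pd P \<Longrightarrow> pd (\<lambda>x. \<not> P x)"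
proof -
  assume "pd P"
  then have "pu (\<lambda>x. if (if P x then 0 else 1) = (0::nat) then 1 else 0)"
    unfolding pd_def by (rule pu_if0)
  moreover have "(\<lambda>x. if (if P x then 0 else 1) = (0::nat) then 1 else 0) =
      (\<lambda>x. if \<not> P x then 0 else (1::nat))"
    by auto
  ultimately show ?thesis unfolding pd_def by simp
qed

lemma pd_conj: "pd P \<Longrightarrow> pd Q \<Longrightarrow> pd (\<lambda>x. P x \<and> Q x)"
  unfolding pd_iff by (metis (no_types, lifting) add_is_0 pu_add)

lemma pd_disj: "pd P \<Longrightarrow> pd Q \<Longrightarrow> pd (\<lambda>x. P x \<or> Q x)"
  using pd_not[OF pd_conj[OF pd_not pd_not], of P Q] by simp

text \<open>A bounded universal quantifier becomes the sum of the values
  \<open>f (pair i x)\<close>, which vanishes exactly when every summand does.\<close>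

lemma pd_ball:
  assumes "pd P" "pu b"
  shows "pd (\<lambda>x. \<forall>i<b x. P (pair i x))"
proof -
  obtain f where f: "pu f" "\<And>x. P x \<longleftrightarrow> f x = 0" using assms(1) unfolding pd_iff by auto
  have "pu (\<lambda>x. rec_nat 0 (\<lambda>m r. (\<lambda>u. p1 (p2 u) + f (pair (p1 u) (p2 (p2 u))))
      (pair m (pair r x))) (b x))"
    by (intro pu_rec assms pu_const pu_add pu_p1 pu_p2 pu_id pu_o[OF f(1)] pu_pair)
  then have "pd (\<lambda>x. rec_nat 0 (\<lambda>m r. r + f (pair m x)) (b x) = 0)"
    by (simp add: pd_eq0)
  moreover have "rec_nat 0 (\<lambda>m r. r + f (pair m x)) k = 0 \<longleftrightarrow> (\<forall>i<k. P (pair i x))" for x k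
    by (induction k) (auto simp: f(2) less_Suc_eq)
  ultimately show ?thesis by simp
qed

lemma pd_bex: "pd P \<Longrightarrow> pu b \<Longrightarrow> pd (\<lambda>x. \<exists>i<b x. P (pair i x))"
  using pd_not[OF pd_ball[OF pd_not], of P b] by simp

text \<open>Every number is read as an infinite sequence. Hence no length is stored: a coded
  computation carries its length separately, and the same decoding turns a number into a total
  environment.\<close>

definition nthc :: "nat \<Rightarrow> nat \<Rightarrow> nat" where
  "nthc c i = p1 ((p2 ^^ i) c)"

lemma nthc_pair [simp]: "nthc (pair a c) 0 = a" "nthc (pair a c) (Suc i) = nthc c i"
  by (simp_all add: nthc_def funpow_Suc_right del: funpow.simps)

lemma nthc_0: "nthc c 0 = p1 c" and nthc_Suc: "nthc c (Suc i) = nthc (p2 c) i"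
  by (simp_all add: nthc_def funpow_Suc_right del: funpow.simps(2))

lemma pu_nthc: "pu f \<Longrightarrow> pu g \<Longrightarrow> pu (\<lambda>x. nthc (f x) (g x))"
proof -
  assume "pu f" "pu g"
  then have "pu (\<lambda>x. p1 (rec_nat (f x) (\<lambda>m r. (\<lambda>u. p2 (p1 (p2 u))) (pair m (pair r x))) (g x)))"
    by (intro pu_p1 pu_rec pu_p2 pu_id)
  moreover have "rec_nat a (\<lambda>m. p2) k = (p2 ^^ k) a" for a k
    by (induction k) auto
  ultimately show ?thesis by (simp add: nthc_def)
qed

lemma nthc_list: "\<exists>c. \<forall>i<length xs. nthc c i = xs ! i"
proof (induction xs)
  case (Cons x xs)
  then obtain c where "\<forall>i<length xs. nthc c i = xs ! i" by auto
  then have "\<forall>i<length (x # xs). nthc (pair x c) i = (x # xs) ! i"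
    by (auto simp: less_Suc_eq_0_disj)
  then show ?case ..
qed simp

lemmas pu_intros = pu_id pu_const pu_Suc pu_add pu_diff pu_pair pu_p1 pu_p2 pu_nthc
lemmas pd_intros = pd_conj pd_disj pd_not pd_eq

subsection \<open>Oracle computations\<close>

text \<open>Programs have to be numbers because realizers take and return programs. A code is a tag
  with two operands, which may be subprograms, constants or stored environments; a number whose tag
  exceeds 11 diverges on every input.\<close>

definition code :: "nat \<Rightarrow> nat \<Rightarrow> nat \<Rightarrow> nat" where "code t p q = pair t (pair p q)"

lemma code_eq [simp]: "code t p q = code t' p' q' \<longleftrightarrow> t = t' \<and> p = p' \<and> q = q'"
  by (simp add: code_def)

lemma code_proj [simp]: "p1 (code t p q) = t" "p1 (p2 (code t p q)) = p" "p2 (p2 (code t p q)) = q"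
  by (simp_all add: code_def)

abbreviation "cK k \<equiv> code 0 k 0"
abbreviation "cI \<equiv> code 1 0 0"
abbreviation "cF \<equiv> code 2 0 0"
abbreviation "cS \<equiv> code 3 0 0"
abbreviation "cSuc \<equiv> code 4 0 0"
abbreviation "clo p c \<equiv> code 6 p c"
abbreviation "cC p q \<equiv> code 8 p q"
abbreviation "cP p q \<equiv> code 9 p q"
abbreviation "cA \<equiv> code 10 0 0"
abbreviation "cIf p q \<equiv> code 11 p q"

text \<open>
  A closure passes itself to its body: its environment is a component of its own code, and the
  self-reference yields general recursion.
\<close>

inductive ev :: "(nat \<Rightarrow> nat) \<Rightarrow> nat \<Rightarrow> nat \<Rightarrow> nat \<Rightarrow> bool" for f where
  const: "ev f (code 0 p q) a p"
| ident: "ev f (code 1 p q) a a"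
| first: "ev f (code 2 p q) a (p1 a)"
| second: "ev f (code 3 p q) a (p2 a)"
| suc: "ev f (code 4 p q) a (Suc a)"
| curry: "ev f (code 5 p q) a (clo p a)"
| closure: "ev f p (pair (clo p c) a) b \<Longrightarrow> ev f (clo p c) a b"
| query: "ev f (code 7 p q) a (f a)"
| comp: "ev f p a u \<Longrightarrow> ev f q u b \<Longrightarrow> ev f (cC p q) a b"
| pairing: "ev f p a u \<Longrightarrow> ev f q a v \<Longrightarrow> ev f (cP p q) a (pair u v)"
| app: "ev f (p1 a) (p2 a) b \<Longrightarrow> ev f (code 10 p q) a b"
| case0: "p1 a = 0 \<Longrightarrow> ev f p (p2 a) b \<Longrightarrow> ev f (cIf p q) a b"
| caseS: "p1 a = Suc m \<Longrightarrow> ev f q (pair m (p2 a)) b \<Longrightarrow> ev f (cIf p q) a b"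

lemma ev_det: "ev f e a b \<Longrightarrow> ev f e a b' \<Longrightarrow> b = b'"
proof (induction arbitrary: b' rule: ev.induct)
  case (comp p a u q b)
  from comp.prems show ?case by cases (use comp.IH in auto)
next
  case (pairing p a u q v)
  from pairing.prems show ?case by cases (use pairing.IH in auto)
qed (erule ev.cases; simp)+

lemma ev_const: "ev f (cK k) a k" by (rule ev.const)
lemma ev_ident: "ev f cI a a" by (rule ev.ident)
lemma ev_fst: "ev f p a u \<Longrightarrow> ev f (cC p cF) a (p1 u)"
  by (rule ev.comp) (auto intro: ev.first)
lemma ev_snd: "ev f p a u \<Longrightarrow> ev f (cC p cS) a (p2 u)"
  by (rule ev.comp) (auto intro: ev.second)
lemma ev_suc: "ev f p a u \<Longrightarrow> ev f (cC p cSuc) a (Suc u)"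
  by (rule ev.comp) (auto intro: ev.suc)
lemma ev_app: "ev f p a u \<Longrightarrow> ev f q a v \<Longrightarrow> ev f u v b \<Longrightarrow> ev f (cC (cP p q) cA) a b"
  by (rule ev.comp, rule ev.pairing, assumption+, rule ev.app) simp

section \<open>Total computable functions and specifications of programs\<close>

definition ct :: "(nat \<Rightarrow> nat) \<Rightarrow> (nat \<Rightarrow> nat) \<Rightarrow> bool" where
  "ct f g \<longleftrightarrow> (\<exists>e. \<forall>x. ev f e x (g x))"

lemma ct_const: "ct f (\<lambda>x. k)" unfolding ct_def using ev_const by blast
lemma ct_id: "ct f (\<lambda>x. x)" unfolding ct_def using ev_ident by blast
lemma ct_p1: "ct f g \<Longrightarrow> ct f (\<lambda>x. p1 (g x))" unfolding ct_def using ev_fst by blast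
lemma ct_p2: "ct f g \<Longrightarrow> ct f (\<lambda>x. p2 (g x))" unfolding ct_def using ev_snd by blast
lemma ct_Suc: "ct f g \<Longrightarrow> ct f (\<lambda>x. Suc (g x))" unfolding ct_def using ev_suc by blast
lemma ct_pair: "ct f g \<Longrightarrow> ct f h \<Longrightarrow> ct f (\<lambda>x. pair (g x) (h x))"
  unfolding ct_def using ev.pairing by blast
lemma ct_o: "ct f g \<Longrightarrow> ct f h \<Longrightarrow> ct f (\<lambda>x. g (h x))"
  unfolding ct_def using ev.comp by blast
lemma ct_query: "ct f g \<Longrightarrow> ct f (\<lambda>x. f (g x))"
  unfolding ct_def using ev.comp ev.query by blast

lemmas ct_intros = ct_id ct_const ct_p1 ct_p2 ct_Suc ct_pair

text \<open>
  Here \<open>w\<close> is a parameter on which the specification, but not the program, may depend.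
\<close>

definition trk :: "(nat \<Rightarrow> nat) \<Rightarrow> ('w \<Rightarrow> nat \<Rightarrow> bool) \<Rightarrow> ('w \<Rightarrow> nat \<Rightarrow> nat \<Rightarrow> bool) \<Rightarrow> bool" where
  "trk f P Q \<longleftrightarrow> (\<exists>e. \<forall>w x. P w x \<longrightarrow> (\<exists>b. ev f e x b \<and> Q w x b))"

lemma trk_ct: "ct f g \<Longrightarrow> (\<And>w x. P w x \<Longrightarrow> Q w x (g x)) \<Longrightarrow> trk f P Q"
  unfolding trk_def ct_def by blast

lemma trk_imp:
  "trk f P Q \<Longrightarrow> (\<And>w x. P' w x \<Longrightarrow> P w x) \<Longrightarrow> (\<And>w x b. P' w x \<Longrightarrow> Q w x b \<Longrightarrow> Q' w x b) \<Longrightarrow> trk f P' Q'"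
  unfolding trk_def by meson

lemma trk_pre:
  assumes "trk f P Q" "ct f g" "\<And>w x. P' w x \<Longrightarrow> P w (g x)"
    "\<And>w x b. P' w x \<Longrightarrow> Q w (g x) b \<Longrightarrow> Q' w x b"
  shows "trk f P' Q'"
proof -
  obtain e where e: "\<And>w x. P w x \<Longrightarrow> \<exists>b. ev f e x b \<and> Q w x b"
    using assms(1) unfolding trk_def by blast
  obtain d where d: "\<And>x. ev f d x (g x)" using assms(2) unfolding ct_def by blast
  show ?thesis unfolding trk_def
    using e d assms(3,4) ev.comp by (intro exI[of _ "cC d e"]) meson
qed

text \<open>Sequencing that keeps the original input: the second program receives it paired with the
  intermediate result, so its specification can refer to both.\<close>

lemma trk_bind:
  assumes "trk f P R"
    "trk f (\<lambda>w y. P w (p1 y) \<and> R w (p1 y) (p2 y)) (\<lambda>w y. Q w (p1 y))"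
  shows "trk f P Q"
proof -
  obtain d where d: "\<And>w x. P w x \<Longrightarrow> \<exists>b. ev f d x b \<and> R w x b"
    using assms(1) unfolding trk_def by blast
  obtain e where e: "\<And>w y. P w (p1 y) \<Longrightarrow> R w (p1 y) (p2 y) \<Longrightarrow> \<exists>b. ev f e y b \<and> Q w (p1 y) b"
    using assms(2) unfolding trk_def by blast
  show ?thesis unfolding trk_def
  proof (rule exI[of _ "cC (cP cI d) e"], intro allI impI)
    fix w x assume P: "P w x"
    then obtain u where u: "ev f d x u" "R w x u" using d by blast
    then obtain b where "ev f e (pair x u) b" "Q w x b" using e[of w "pair x u"] P by auto
    then show "\<exists>b. ev f (cC (cP cI d) e) x b \<and> Q w x b"
      using u ev_ident ev.comp ev.pairing by blast
  qed
qed

lemma trk_app: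
  assumes "ct f g" "ct f h" "\<And>w x. P w x \<Longrightarrow> \<exists>b. ev f (g x) (h x) b \<and> Q w x b"
  shows "trk f P Q"
  using assms ev_app unfolding trk_def ct_def by meson

text \<open>The s-m-n theorem. Building the closure succeeds on every \<open>x\<close>; only running
  it depends on \<open>P\<close>.\<close>

lemma trk_curry:
  assumes "trk f P Q"
  obtains g where "ct f g"
    "\<And>w x a. P w (pair x a) \<Longrightarrow> \<exists>b. ev f (g x) a b \<and> Q w (pair x a) b"
proof -
  obtain e where e: "\<And>w x. P w x \<Longrightarrow> \<exists>b. ev f e x b \<and> Q w x b"
    using assms unfolding trk_def by blast
  \<comment> \<open>The body is run on \<open>pair (clo ?e x) a\<close>. The first component is a
    code whose second operand is \<open>x\<close>, so \<open>cF\<close>, \<open>cS\<close>,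
    \<open>cS\<close> in succession recover the stored value.\<close>
  let ?e = "cC (cP (cC (cC cF cS) cS) cS) e"
  have clo: "ev f (clo ?e x) a b" if "ev f e (pair x a) b" for x a b
  proof (rule ev.closure, rule ev.comp[OF ev.pairing that])
    let ?y = "pair (clo ?e x) a"
    have "ev f (cC (cC cF cS) cS) ?y (p2 (p2 (p1 ?y)))"
      by (intro ev_snd ev.first)
    then show "ev f (cC (cC cF cS) cS) ?y x" by simp
    show "ev f cS ?y a" using ev.second[of f 0 0 ?y] by simp
  qed
  show ?thesis
  proof (rule that)
    show "ct f (\<lambda>x. clo ?e x)" unfolding ct_def by (intro exI allI, rule ev.curry)
    fix w x a assume "P w (pair x a)"
    then show "\<exists>b. ev f (clo ?e x) a b \<and> Q w (pair x a) b"
      using e clo by blast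
  qed
qed

lemma trk_if:
  assumes "ct f g" and P1: "trk f (\<lambda>w x. P w x \<and> g x = 0) Q" and P2: "trk f (\<lambda>w x. P w x \<and> g x \<noteq> 0) Q"
  shows "trk f P Q"
proof -
  obtain d where d: "\<And>x. ev f d x (g x)" using assms(1) unfolding ct_def by blast
  obtain e1 where e1: "\<And>w x. P w x \<Longrightarrow> g x = 0 \<Longrightarrow> \<exists>b. ev f e1 x b \<and> Q w x b"
    using P1 unfolding trk_def by blast
  obtain e2 where e2: "\<And>w x. P w x \<Longrightarrow> g x \<noteq> 0 \<Longrightarrow> \<exists>b. ev f e2 x b \<and> Q w x b"
    using P2 unfolding trk_def by blast
  \<comment> \<open>On a nonzero test \<open>cIf\<close> hands its second branch the predecessor
    paired with the input; the prefix \<open>cS\<close> drops the predecessor.\<close>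
  let ?e = "cC (cP d cI) (cIf e1 (cC cS e2))"
  show ?thesis unfolding trk_def
  proof (rule exI[of _ ?e], intro allI impI)
    fix w x assume P: "P w x"
    have ev: "ev f (cP d cI) x (pair (g x) x)" by (intro ev.pairing d ev_ident)
    show "\<exists>b. ev f ?e x b \<and> Q w x b"
    proof (cases "g x")
      case 0
      with e1 P obtain b where "ev f e1 x b" "Q w x b" by blast
      then show ?thesis using 0 ev ev.comp ev.case0[of "pair (g x) x"] by fastforce
    next
      case (Suc m)
      with e2 P obtain b where b: "ev f e2 x b" "Q w x b" by force
      have "ev f (cC cS e2) (pair m x) b"
        by (rule ev.comp[OF _ b(1)]) (use ev.second[of f 0 0 "pair m x"] in simp)
      then have "ev f (cIf e1 (cC cS e2)) (pair (g x) x) b"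
        using ev.caseS[of "pair (g x) x" m] Suc by simp
      then show ?thesis using ev ev.comp b by blast
    qed
  qed
qed

text \<open>The recursion is described rule by rule, not by a total function, because
  \<open>p\<close> and \<open>q\<close> may be partial. This generality serves the induction axiom,
  where the step runs an unknown realizer.\<close>

lemma ev_rec:
  obtains R where "\<And>x b. ev f p x b \<Longrightarrow> ev f R (pair 0 x) b"
    "\<And>n x u b. ev f R (pair n x) u \<Longrightarrow> ev f q (pair n (pair u x)) b \<Longrightarrow> ev f R (pair (Suc n) x) b"
proof -
  \<comment> \<open>The closure is run on \<open>pair R (pair n x)\<close>, and \<open>?pre\<close>
    rearranges this to \<open>pair n (pair x R)\<close>. Thus \<open>cIf\<close> can branch on
    \<open>n\<close> while \<open>x\<close> and the self-reference \<open>R\<close> remain available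
    for the recursive call.\<close>
  let ?pre = "cP (cC cS cF) (cP (cC cS cS) cF)"
  let ?call = "cC (cP (cC cS cS) (cP cF (cC cS cF))) cA"
  let ?q = "cC (cP cF (cP ?call (cC cS cF))) q"
  let ?body = "cC ?pre (cIf (cC cF p) ?q)"
  let ?R = "clo ?body 0"
  have F: "ev f cF (pair a b) a" and S: "ev f cS (pair a b) b" for a b
    using ev.first[of f 0 0 "pair a b"] ev.second[of f 0 0 "pair a b"] by simp_all
  have pre: "ev f ?pre (pair ?R (pair n x)) (pair n (pair x ?R))" for n x
    by (rule F S ev.pairing ev.comp)+
  show ?thesis
  proof (rule that)
    fix x b assume "ev f p x b"
    then have "ev f (cIf (cC cF p) ?q) (pair 0 (pair x ?R)) b"
      by (intro ev.case0) (auto intro: ev.comp F)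
    then show "ev f ?R (pair 0 x) b" by (intro ev.closure) (rule ev.comp[OF pre])
  next
    fix n x u b assume u: "ev f ?R (pair n x) u" and b: "ev f q (pair n (pair u x)) b"
    let ?y = "pair n (pair x ?R)"
    have "ev f ?call ?y u"
      by (rule ev_app[OF _ _ u]) (rule F S ev.pairing ev.comp)+
    moreover have "ev f (cC cS cF) ?y x" by (rule ev.comp[OF S F])
    ultimately have "ev f (cP cF (cP ?call (cC cS cF))) ?y (pair n (pair u x))"
      by (intro ev.pairing F)
    then have "ev f ?q ?y b" by (rule ev.comp[OF _ b])
    then have "ev f (cIf (cC cF p) ?q) (pair (Suc n) (pair x ?R)) b"
      by (intro ev.caseS[of _ n]) auto
    then show "ev f ?R (pair (Suc n) x) b" by (intro ev.closure) (rule ev.comp[OF pre])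
  qed
qed

lemma ev_search:
  obtains s where "\<And>x n. ev f g (pair n x) 0 \<Longrightarrow> (\<And>m. m < n \<Longrightarrow> \<exists>r. ev f g (pair m x) (Suc r))
    \<Longrightarrow> ev f s x n"
proof -
  let ?pre = "cP (cC cS g) cI"
  let ?call = "cC (cP (cC cS cF) (cP (cC (cC cS (cC cS cF)) cSuc) (cC cS (cC cS cS)))) cA"
  let ?body = "cC ?pre (cIf (cC cS cF) ?call)"
  let ?E = "clo ?body 0"
  have F: "ev f cF (pair a b) a" and S: "ev f cS (pair a b) b" for a b
    using ev.first[of f 0 0 "pair a b"] ev.second[of f 0 0 "pair a b"] by simp_all
  have pre: "ev f ?pre (pair ?E (pair n x)) (pair v (pair ?E (pair n x)))"
    if "ev f g (pair n x) v" for n x v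
    using that by (intro ev.pairing ev.comp[OF S] ev_ident)
  have E: "ev f ?E (pair k x) n"
    if 0: "ev f g (pair n x) 0" and S': "\<And>m. m < n \<Longrightarrow> \<exists>r. ev f g (pair m x) (Suc r)"
      and "k \<le> n" for x n k
    using \<open>k \<le> n\<close>
  \<comment> \<open>The induction descends from the zero \<open>n\<close>: a search started at any
    \<open>k \<le> n\<close> ends there, since each earlier test halts with a nonzero value and
    calls the search at \<open>Suc k\<close>.\<close>
  proof (induction k rule: inc_induct)
    case base
    have "ev f (cIf (cC cS cF) ?call) (pair 0 (pair ?E (pair n x))) n"
      by (intro ev.case0) (auto intro: ev.comp S F)
    then show ?case by (intro ev.closure) (rule ev.comp[OF pre[OF 0]])
  next
    case (step k)
    then obtain r where r: "ev f g (pair k x) (Suc r)" using S' by blast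
    let ?y = "pair r (pair ?E (pair k x))"
    have "ev f ?call ?y n"
      by (rule ev_app[OF _ _ step.IH]) (rule F S ev_suc ev.pairing ev.comp)+
    then have "ev f (cIf (cC cS cF) ?call) (pair (Suc r) (pair ?E (pair k x))) n"
      by (intro ev.caseS[of _ r]) auto
    then show ?case by (intro ev.closure) (rule ev.comp[OF pre[OF r]])
  qed
  show ?thesis
  proof (rule that)
    fix x n assume "ev f g (pair n x) 0" "\<And>m. m < n \<Longrightarrow> \<exists>r. ev f g (pair m x) (Suc r)"
    from E[OF this, of 0] show "ev f (cC (cP (cK ?E) (cP (cK 0) cI)) cA) x n"
      by (intro ev_app[OF ev_const ev.pairing[OF ev_const ev_ident]]) auto
  qed
qed

primrec tup :: "nat list \<Rightarrow> nat" where
  "tup [] = 0"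
| "tup (x # xs) = pair x (tup xs)"

lemma nthc_tup: "i < length xs \<Longrightarrow> nthc (tup xs) i = xs ! i"
  by (induction xs arbitrary: i) (auto simp: less_Suc_eq_0_disj)

lemma ct_nthc: "ct f g \<Longrightarrow> ct f (\<lambda>x. nthc (g x) i)"
proof (induction i arbitrary: g)
  case 0
  then show ?case by (simp add: nthc_0 ct_p1)
next
  case (Suc i)
  then show ?case using Suc.IH[OF ct_p2] by (simp add: nthc_Suc)
qed

text \<open>The guard \<open>R\<close> singles out codes of lists of the right length, where alone
  the component programs are known to be correct.\<close>

lemma ev_tup:
  assumes "\<And>g. g \<in> set gs \<Longrightarrow> \<exists>e. \<forall>x. R x \<longrightarrow> ev f e x (h g x)"
  shows "\<exists>e. \<forall>x. R x \<longrightarrow> ev f e x (tup (map (\<lambda>g. h g x) gs))"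
  using assms
proof (induction gs)
  case Nil
  then show ?case using ev_const by auto
next
  case (Cons g gs)
  then obtain e where e: "\<And>x. R x \<Longrightarrow> ev f e x (tup (map (\<lambda>g. h g x) gs))" by auto
  obtain d where d: "\<And>x. R x \<Longrightarrow> ev f d x (h g x)" using Cons.prems[of g] by auto
  show ?case by (intro exI[of _ "cP d e"]) (auto intro: ev.pairing e d)
qed

lemma pev_computable:
  "wf_pr p \<Longrightarrow> \<exists>e. \<forall>xs. length xs = arity p \<longrightarrow> ev f e (tup xs) (pev p xs)"
proof (induction p)
  case Zero
  show ?case using ev_const by (intro exI[of _ "cK 0"]) auto
next
  case Succ
  show ?case
  proof (intro exI allI impI)
    fix xs :: "nat list" assume "length xs = arity Succ"
    then show "ev f (cC cF cSuc) (tup xs) (pev Succ xs)"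
      using ev.first[of f 0 0 "tup xs"] by (cases xs) (auto intro!: ev_suc)
  qed
next
  case (Proj n i)
  obtain e where "\<And>x. ev f e x (nthc x i)" using ct_nthc[OF ct_id] unfolding ct_def by blast
  with Proj show ?case by (intro exI[of _ e]) (auto simp: nthc_tup[symmetric])
next
  case (Comp n p gs)
  then obtain e where e: "\<And>xs. length xs = arity p \<Longrightarrow> ev f e (tup xs) (pev p xs)" by auto
  \<comment> \<open>The specification has to be a function of the number \<open>x\<close>, so the
    argument list is read back from it by \<open>nthc\<close>.\<close>
  have "\<exists>e. \<forall>x. (\<exists>xs. length xs = n \<and> x = tup xs) \<longrightarrow>
      ev f e x (tup (map (\<lambda>g. pev g (map (nthc x) [0..<n])) gs))"
  proof (rule ev_tup)
    fix g assume "g \<in> set gs"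
    then obtain d where d: "\<And>xs. length xs = n \<Longrightarrow> ev f d (tup xs) (pev g xs)"
      using Comp.IH(2)[of g] Comp.prems by auto
    have "map (nthc (tup xs)) [0..<n] = xs" if "length xs = n" for xs
      using that by (intro nth_equalityI) (auto simp: nthc_tup)
    then show "\<exists>e. \<forall>x. (\<exists>xs. length xs = n \<and> x = tup xs) \<longrightarrow>
        ev f e x (pev g (map (nthc x) [0..<n]))"
      using d by (intro exI[of _ d]) auto
  qed
  then obtain d where d: "\<And>xs. length xs = n \<Longrightarrow>
      ev f d (tup xs) (tup (map (\<lambda>g. pev g (map (nthc (tup xs)) [0..<n])) gs))"
    by auto
  show ?case
  proof (intro exI[of _ "cC d e"] allI impI)
    fix xs :: "nat list" assume "length xs = arity (Comp n p gs)"
    then have l: "length xs = n" by simp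
    then have "map (nthc (tup xs)) [0..<n] = xs"
      by (intro nth_equalityI) (auto simp: nthc_tup)
    then show "ev f (cC d e) (tup xs) (pev (Comp n p gs) xs)"
      using d[OF l] e[of "map (\<lambda>g. pev g xs) gs"] Comp.prems
      by (auto intro!: ev.comp simp: comp_def)
  qed
next
  case (Rec p q)
  then obtain e d where e: "\<And>xs. length xs = arity p \<Longrightarrow> ev f e (tup xs) (pev p xs)"
    and d: "\<And>xs. length xs = arity q \<Longrightarrow> ev f d (tup xs) (pev q xs)" by auto
  obtain R where R: "\<And>x b. ev f e x b \<Longrightarrow> ev f R (pair 0 x) b"
    "\<And>n x u b. ev f R (pair n x) u \<Longrightarrow> ev f d (pair n (pair u x)) b \<Longrightarrow> ev f R (pair (Suc n) x) b"
    using ev_rec by blast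
  have "ev f R (pair n (tup ys)) (pev (Rec p q) (n # ys))" if "length ys = arity p" for n ys
  proof (induction n)
    case 0
    then show ?case using e[OF that] R by simp
  next
    case (Suc n)
    then show ?case using R(2)[OF Suc] d[of "n # _ # ys"] that Rec.prems by simp
  qed
  then show ?case by (intro exI[of _ R]) (auto simp: length_Suc_conv)
qed

lemma pu_ct: "pu g \<Longrightarrow> ct f g"
proof -
  assume "pu g"
  then obtain p where p: "wf_pr p" "arity p = 1" "\<And>xs. length xs = 1 \<Longrightarrow> pev p xs = g (xs ! 0)"
    unfolding pu_def PR_def by auto
  obtain e where e: "\<And>xs. length xs = 1 \<Longrightarrow> ev f e (tup xs) (pev p xs)"
    using pev_computable[OF p(1)] p(2) by auto
  then have "ev f (cC (cP cI (cK 0)) e) x (g x)" for x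
    using e[of "[x]"] p(3)[of "[x]"] by (intro ev.comp[OF ev.pairing[OF ev_ident ev_const]]) auto
  then show ?thesis unfolding ct_def by blast
qed

subsection \<open>Two-world realizability\<close>

primrec tval :: "(nat \<Rightarrow> nat) \<Rightarrow> tm \<Rightarrow> nat" where
  "tval \<rho> (Var i) = \<rho> i"
| "tval \<rho> (App p ts) = pev p (map (tval \<rho>) ts)"

text \<open>
  \<open>rl f M A w\<close> are the actual realizers of \<open>A\<close> for \<open>w = True\<close> and the potential ones for
  \<open>w = False\<close>, where every equation holds. With \<open>M\<close>, an implication also has to map potential
  realizers to potential realizers (modified realizability); without \<open>M\<close>, only the world
  \<open>True\<close> matters (Kleene realizability).
\<close>

primrec rl :: "(nat \<Rightarrow> nat) \<Rightarrow> bool \<Rightarrow> fm \<Rightarrow> bool \<Rightarrow> (nat \<Rightarrow> nat) \<Rightarrow> nat \<Rightarrow> bool" where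
  "rl f M (Eq s t) = (\<lambda>w \<rho> x. w \<longrightarrow> tval \<rho> s = tval \<rho> t)"
| "rl f M (And A B) = (\<lambda>w \<rho> x. rl f M A w \<rho> (p1 x) \<and> rl f M B w \<rho> (p2 x))"
| "rl f M (Or A B) =
    (\<lambda>w \<rho> x. (p1 x = 0 \<longrightarrow> rl f M A w \<rho> (p2 x)) \<and> (p1 x \<noteq> 0 \<longrightarrow> rl f M B w \<rho> (p2 x)))"
| "rl f M (Imp A B) = (\<lambda>w \<rho> x. \<forall>v. (v \<longrightarrow> w) \<and> (v \<or> M) \<longrightarrow>
    (\<forall>a. rl f M A v \<rho> a \<longrightarrow> (\<exists>b. ev f x a b \<and> rl f M B v \<rho> b)))"
| "rl f M (All A) = (\<lambda>w \<rho> x. \<forall>n. \<exists>b. ev f x n b \<and> rl f M A w (case_nat n \<rho>) b)"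
| "rl f M (Ex A) = (\<lambda>w \<rho> x. rl f M A w (case_nat (p1 x) \<rho>) (p2 x))"

primrec hyp :: "(nat \<Rightarrow> nat) \<Rightarrow> bool \<Rightarrow> fm list \<Rightarrow> bool \<Rightarrow> (nat \<Rightarrow> nat) \<Rightarrow> nat \<Rightarrow> bool" where
  "hyp f M [] = (\<lambda>w \<rho> h. True)"
| "hyp f M (A # \<Gamma>) = (\<lambda>w \<rho> h. rl f M A w \<rho> (p1 h) \<and> hyp f M \<Gamma> w \<rho> (p2 h))"

section \<open>Substitution and persistence of realizers\<close>

lemma tval_subst: "tval \<rho> (subst_tm \<sigma> t) = tval (\<lambda>i. tval \<rho> (\<sigma> i)) t"
  by (induction t) (simp_all add: comp_def cong: map_cong)

lemma tval_up:
  "(\<lambda>i. tval (case_nat n \<rho>) (up \<sigma> i)) = case_nat n (\<lambda>i. tval \<rho> (\<sigma> i))"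
  by (rule ext) (simp add: up_def tval_subst split: nat.split)

lemma rl_subst: "rl f M (subst \<sigma> A) w \<rho> = rl f M A w (\<lambda>i. tval \<rho> (\<sigma> i))"
  by (induction A arbitrary: \<sigma> w \<rho>) (simp_all add: tval_subst tval_up)

lemma rl_shift: "rl f M (shift A) w (case_nat n \<rho>) = rl f M A w \<rho>"
  by (simp add: shift_def rl_subst)

lemma hyp_shift: "hyp f M (map shift \<Gamma>) w (case_nat n \<rho>) = hyp f M \<Gamma> w \<rho>"
  by (induction \<Gamma>) (simp_all add: rl_shift)

lemma case_nat_inst: "(\<lambda>i. tval \<rho> (case_nat t Var i)) = case_nat (tval \<rho> t) \<rho>"
  by (rule ext) (simp split: nat.split)

lemma rl_inst: "rl f M (inst t A) w \<rho> = rl f M A w (case_nat (tval \<rho> t) \<rho>)"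
  by (simp add: inst_def rl_subst case_nat_inst)

text \<open>The worlds form a Kripke model in which \<open>False\<close> is reached from
  \<open>True\<close> and is exploding. Persistence is built into the clause for implication, which
  ranges over all worlds \<open>v\<close> reachable from \<open>w\<close>.\<close>

lemma rl_mono: "rl f M A w \<rho> x \<Longrightarrow> v \<longrightarrow> w \<Longrightarrow> rl f M A v \<rho> x"
proof (induction A arbitrary: w v \<rho> x)
  case (Imp A B)
  then show ?case unfolding rl.simps by blast
next
  case (All A)
  then show ?case unfolding rl.simps by blast
next
  case (And A B)
  from And.prems And.IH[OF _ And.prems(2)] show ?case unfolding rl.simps by blast
next
  case (Or A B)
  from Or.prems Or.IH[OF _ Or.prems(2)] show ?case unfolding rl.simps by blast
next
  case (Ex A)
  from Ex.prems Ex.IH[OF _ Ex.prems(2)] show ?case unfolding rl.simps by blast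
qed auto

lemma hyp_mono: "hyp f M \<Gamma> w \<rho> h \<Longrightarrow> v \<longrightarrow> w \<Longrightarrow> hyp f M \<Gamma> v \<rho> h"
  by (induction \<Gamma> arbitrary: h) (auto intro: rl_mono)

lemma hyp_nth: "hyp f M \<Gamma> w \<rho> h \<Longrightarrow> i < length \<Gamma> \<Longrightarrow> rl f M (\<Gamma> ! i) w \<rho> (nthc h i)"
  by (induction \<Gamma> arbitrary: h i) (auto simp: nthc_0 nthc_Suc less_Suc_eq_0_disj)

text \<open>Values of terms enter only through equations, and all of these hold in the world
  \<open>False\<close>. Hence replacing equals is sound there although the equation carries no
  information.\<close>

lemma rl_False_env: "rl f M A False \<rho> = rl f M A False \<rho>'"
proof (induction A arbitrary: \<rho> \<rho>')
  case (All A)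
  then show ?case by (simp only: rl.simps) metis
next
  case (Ex A)
  then show ?case by (simp only: rl.simps) metis
next
  case (Imp A B)
  have "rl f M A False \<rho> = rl f M A False \<rho>'" "rl f M B False \<rho> = rl f M B False \<rho>'"
    by (rule Imp.IH)+
  then show ?case unfolding rl.simps by (intro ext iff_allI) (metis (full_types))
qed (simp only: rl.simps, metis)+

text \<open>In the world \<open>False\<close> no equation can fail, so a realizer can be built along
  the formula, uniformly in the environment. It is the output of ex falso.\<close>

lemma rl_default: "\<exists>d. \<forall>\<rho>. rl f M A False \<rho> d"
proof (induction A)
  case (And A B)
  then obtain a b where "\<forall>\<rho>. rl f M A False \<rho> a" "\<forall>\<rho>. rl f M B False \<rho> b" by auto
  then show ?case by (intro exI[of _ "pair a b"]) simp
next
  case (Or A B)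
  then obtain a where "\<forall>\<rho>. rl f M A False \<rho> a" by auto
  then show ?case by (intro exI[of _ "pair 0 a"]) simp
next
  case (Imp A B)
  then obtain b where "\<forall>\<rho>. rl f M B False \<rho> b" by auto
  then show ?case by (intro exI[of _ "cK b"]) (auto intro: ev_const)
next
  case (All A)
  then obtain b where "\<forall>\<rho>. rl f M A False \<rho> b" by auto
  then show ?case by (intro exI[of _ "cK b"]) (auto intro: ev_const)
next
  case (Ex A)
  then obtain b where "\<forall>\<rho>. rl f M A False \<rho> b" by auto
  then show ?case by (intro exI[of _ "pair 0 b"]) simp
qed auto

section \<open>Soundness of the calculus and of HA\<close>

abbreviation env :: "nat \<Rightarrow> nat \<Rightarrow> nat" where "env \<equiv> nthc"

lemma env_pair [simp]: "env (pair n c) = case_nat n (env c)"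
  by (rule ext) (simp split: nat.split)

lemma ct_tval: "wf_tm t \<Longrightarrow> ct f (\<lambda>c. tval (env c) t)"
proof (induction t)
  case (Var i)
  show ?case by (simp add: ct_nthc ct_id)
next
  case (App p ts)
  have "\<exists>e. \<forall>x. True \<longrightarrow> ev f e x (tup (map (\<lambda>t. tval (env x) t) ts))"
    by (rule ev_tup) (use App in \<open>auto simp: ct_def\<close>)
  then obtain d where d: "\<And>x. ev f d x (tup (map (tval (env x)) ts))" by auto
  obtain e where e: "\<And>xs. length xs = arity p \<Longrightarrow> ev f e (tup xs) (pev p xs)"
    using pev_computable[of p f] App.prems by auto
  have "ev f (cC d e) x (tval (env x) (App p ts))" for x
    using ev.comp[OF d e] App.prems by simp
  then show ?case unfolding ct_def by blast
qed

lemma trk_pair: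
  assumes "trk f P Q" "trk f P Q'"
  shows "trk f P (\<lambda>w x b. Q w x (p1 b) \<and> Q' w x (p2 b))"
proof -
  obtain d where d: "\<And>w x. P w x \<Longrightarrow> \<exists>b. ev f d x b \<and> Q w x b"
    using assms(1) unfolding trk_def by blast
  obtain e where e: "\<And>w x. P w x \<Longrightarrow> \<exists>b. ev f e x b \<and> Q' w x b"
    using assms(2) unfolding trk_def by blast
  show ?thesis unfolding trk_def
  proof (rule exI[of _ "cP d e"], intro allI impI)
    fix w x assume "P w x"
    then obtain u v where "ev f d x u" "Q w x u" "ev f e x v" "Q' w x v" using d e by meson
    then show "\<exists>b. ev f (cP d e) x b \<and> Q w x (p1 b) \<and> Q' w x (p2 b)"
      by (intro exI[of _ "pair u v"]) (auto intro: ev.pairing)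
  qed
qed

lemma trk_app2:
  assumes "trk f P Q" "trk f P Q'"
    "\<And>w x u v. P w x \<Longrightarrow> Q w x u \<Longrightarrow> Q' w x v \<Longrightarrow> \<exists>b. ev f u v b \<and> R w x b"
  shows "trk f P R"
proof (rule trk_bind[OF trk_pair[OF assms(1,2)]], rule trk_app)
  show "ct f (\<lambda>y. p1 (p2 y))" "ct f (\<lambda>y. p2 (p2 y))" by (intro ct_intros)+
qed (use assms(3) in blast)

text \<open>One program must serve both worlds, which is why the world is the parameter that
  \<open>trk\<close> hides from the program. The input pairs a coded environment with realizers of
  the assumptions. The guard \<open>w \<or> M\<close> removes the potential world from Kleene
  realizability.\<close>

definition sound :: "(nat \<Rightarrow> nat) \<Rightarrow> bool \<Rightarrow> fm list \<Rightarrow> fm \<Rightarrow> bool" where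
  "sound f M \<Gamma> A \<longleftrightarrow> trk f (\<lambda>w x. (w \<or> M) \<and> hyp f M \<Gamma> w (env (p1 x)) (p2 x))
    (\<lambda>w x. rl f M A w (env (p1 x)))"

lemma sound_ImpI:
  assumes "sound f M (A # \<Gamma>) B"
  shows "sound f M \<Gamma> (Imp A B)"
proof -
  let ?h = "\<lambda>y. pair (p1 (p1 y)) (pair (p2 y) (p2 (p1 y)))"
  have "trk f (\<lambda>w y. (w \<or> M) \<and> hyp f M \<Gamma> w (env (p1 (p1 y))) (p2 (p1 y)) \<and>
      rl f M A w (env (p1 (p1 y))) (p2 y)) (\<lambda>w y. rl f M B w (env (p1 (p1 y))))"
    using assms unfolding sound_def
    by (rule trk_pre[of _ _ _ ?h]) (auto intro!: ct_intros)
  then obtain g where g: "ct f g" and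
    gB: "\<And>w x a. (w \<or> M) \<Longrightarrow> hyp f M \<Gamma> w (env (p1 x)) (p2 x) \<Longrightarrow> rl f M A w (env (p1 x)) a \<Longrightarrow>
      \<exists>b. ev f (g x) a b \<and> rl f M B w (env (p1 x)) b"
    by (rule trk_curry) (auto; blast)
  show ?thesis unfolding sound_def
  proof (rule trk_ct[OF g])
    fix w x assume "(w \<or> M) \<and> hyp f M \<Gamma> w (env (p1 x)) (p2 x)"
    then show "rl f M (Imp A B) w (env (p1 x)) (g x)"
      \<comment> \<open>The implication has to act in every world \<open>v\<close> reachable from
        \<open>w\<close>; \<open>hyp_mono\<close> carries the assumptions over to
        \<open>v\<close>.\<close>
      by (auto intro!: gB intro: hyp_mono)
  qed
qed

lemma sound_AllI:
  assumes "trk f (\<lambda>w y. (w \<or> M) \<and> hyp f M \<Gamma> w (env (p1 (p1 y))) (p2 (p1 y)))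
    (\<lambda>w y. rl f M A w (case_nat (p2 y) (env (p1 (p1 y)))))"
  shows "sound f M \<Gamma> (All A)"
proof -
  obtain g where g: "ct f g" and
    gA: "\<And>w x n. (w \<or> M) \<Longrightarrow> hyp f M \<Gamma> w (env (p1 x)) (p2 x) \<Longrightarrow>
      \<exists>b. ev f (g x) n b \<and> rl f M A w (case_nat n (env (p1 x))) b"
    using assms by (rule trk_curry) (auto; blast)
  show ?thesis unfolding sound_def
    by (rule trk_ct[OF g]) (use gA in auto)
qed

lemma sound_weaken: "sound f M [] A \<Longrightarrow> sound f M \<Gamma> A"
  unfolding sound_def by (erule trk_pre[of _ _ _ "\<lambda>x. x"]) (auto intro!: ct_intros)

lemma sound_Eq: "(\<And>\<rho>. tval \<rho> s = tval \<rho> t) \<Longrightarrow> sound f M \<Gamma> (Eq s t)"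
  unfolding sound_def by (rule trk_ct[OF ct_const[of _ 0]]) simp

lemma sound_induction:
  "sound f M [] (Imp (inst zero A)
      (Imp (All (Imp A (subst (case_nat (succ (Var 0)) (\<lambda>i. Var (Suc i))) A))) (All A)))"
  (is "sound f M [] (Imp ?Z (Imp (All ?S) (All A)))")
proof (rule sound_ImpI, rule sound_ImpI, rule sound_AllI)
  let ?\<Gamma> = "[All ?S, ?Z]"
  \<comment> \<open>With \<open>x\<close> pairing the environment and the realizers of
    \<open>?\<Gamma>\<close>, \<open>p\<close> finds the realizer of the base case. On
    \<open>pair n (pair u x)\<close>, \<open>q1\<close> finds the realizer of the induction step and
    \<open>q2\<close> the previous value \<open>u\<close>, so \<open>?q\<close> applies the step to
    \<open>n\<close> and the result to \<open>u\<close>.\<close>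
  obtain p where p: "\<And>x. ev f p x (p1 (p2 (p2 x)))"
    using ct_p1[OF ct_p2[OF ct_p2[OF ct_id]]] unfolding ct_def by blast
  have "ct f (\<lambda>y. p1 (p2 (p2 (p2 y))))" by (intro ct_intros)
  then obtain q1 where q1: "\<And>y. ev f q1 y (p1 (p2 (p2 (p2 y))))" unfolding ct_def by blast
  have "ct f (\<lambda>y. p1 (p2 y))" by (intro ct_intros)
  then obtain q2 where q2: "\<And>y. ev f q2 y (p1 (p2 y))" unfolding ct_def by blast
  let ?q = "cC (cP (cC (cP q1 cF) cA) q2) cA"
  obtain R where R: "\<And>x b. ev f p x b \<Longrightarrow> ev f R (pair 0 x) b"
    "\<And>n x u b. ev f R (pair n x) u \<Longrightarrow> ev f ?q (pair n (pair u x)) b \<Longrightarrow> ev f R (pair (Suc n) x) b"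
    using ev_rec by blast
  have *: "\<exists>b. ev f R (pair n x) b \<and> rl f M A w (case_nat n (env (p1 x))) b"
    if w: "w \<or> M" and h: "hyp f M ?\<Gamma> w (env (p1 x)) (p2 x)" for w x n
  proof (induction n)
    case 0
    have "rl f M A w (case_nat 0 (env (p1 x))) (p1 (p2 (p2 x)))"
      using h by (simp add: rl_inst)
    then show ?case using R(1)[OF p] by blast
  next
    case (Suc n)
    then obtain u where u: "ev f R (pair n x) u" "rl f M A w (case_nat n (env (p1 x))) u" by blast
    have "rl f M (All ?S) w (env (p1 x)) (p1 (p2 x))" using h by (simp only: hyp.simps)
    then obtain s where s: "ev f (p1 (p2 x)) n s" "rl f M ?S w (case_nat n (env (p1 x))) s"
      unfolding rl.simps(5) by blast
    have "(\<lambda>i. tval (case_nat n (env (p1 x))) (case_nat (succ (Var 0)) (\<lambda>i. Var (Suc i)) i)) =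
        case_nat (Suc n) (env (p1 x))"
      by (rule ext) (simp split: nat.split)
    then obtain b where b: "ev f s u b" "rl f M A w (case_nat (Suc n) (env (p1 x))) b"
      using s(2) u(2) w by (auto simp: rl_subst)
    let ?y = "pair n (pair u x)"
    have "ev f (cC (cP q1 cF) cA) ?y s"
      by (rule ev_app[OF q1 ev.first]) (use s in simp)
    then have "ev f ?q ?y b" by (rule ev_app[OF _ q2]) (use b in simp)
    then show ?case using R(2)[OF u(1)] b(2) by blast
  qed
  have "trk f (\<lambda>w x. (w \<or> M) \<and> hyp f M ?\<Gamma> w (env (p1 (p2 x))) (p2 (p2 x)))
      (\<lambda>w x. rl f M A w (case_nat (p1 x) (env (p1 (p2 x)))))"
    unfolding trk_def using * by (intro exI[of _ R]) (metis pair_p)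
  then show "trk f (\<lambda>w y. (w \<or> M) \<and> hyp f M ?\<Gamma> w (env (p1 (p1 y))) (p2 (p1 y)))
      (\<lambda>w y. rl f M A w (case_nat (p2 y) (env (p1 (p1 y)))))"
    by (rule trk_pre[of _ _ _ "\<lambda>y. pair (p2 y) (p1 y)"]) (auto intro!: ct_intros)
qed

lemma sound_HA: "A \<in> HA \<Longrightarrow> sound f M [] A"
proof (induction rule: HA.induct)
  case (Succ_not_zero t)
  show ?case unfolding Neg_def Falsum_def
    by (rule sound_ImpI) (auto simp: sound_def intro: trk_ct[OF ct_const[of _ 0]])
next
  case (Succ_inject s t)
  show ?case
    by (rule sound_ImpI) (auto simp: sound_def intro: trk_ct[OF ct_const[of _ 0]])
next
  case (Proj_eq n i ts)
  then show ?case by (intro sound_Eq) simp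
next
  case (Comp_eq n p gs ts)
  then show ?case by (intro sound_Eq) (simp add: comp_def)
next
  case (Induction A)
  show ?case by (rule sound_induction)
qed (rule sound_Eq, simp)+

theorem soundness:
  assumes "derives T \<Gamma> A" and T: "\<And>A. A \<in> T \<Longrightarrow> sound f M [] A"
  shows "sound f M \<Gamma> A"
  using assms(1)
proof induction
  case (Axiom A \<Gamma>)
  then show ?case using T sound_weaken by blast
next
  case (Assm A \<Gamma>)
  then obtain i where "i < length \<Gamma>" "\<Gamma> ! i = A" by (auto simp: in_set_conv_nth)
  then show ?case unfolding sound_def
    by (intro trk_ct[OF ct_nthc[OF ct_p2[OF ct_id], of _ i]]) (use hyp_nth in blast)
next
  case (FalsumE \<Gamma> A)
  obtain d where d: "\<And>\<rho>. rl f M A False \<rho> d" using rl_default by blast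
  from FalsumE.IH show ?case unfolding sound_def
  proof (rule trk_bind, intro trk_ct[OF ct_const[of _ d]])
    fix w y
    assume "((w \<or> M) \<and> hyp f M \<Gamma> w (env (p1 (p1 y))) (p2 (p1 y))) \<and>
      rl f M Falsum w (env (p1 (p1 y))) (p2 y)"
    \<comment> \<open>Absurdity has no actual realizer, so only the potential world is left, and
      there the default value suffices.\<close>
    then have "w = False" by (simp add: Falsum_def)
    then show "rl f M A w (env (p1 (p1 y))) d" using d by simp
  qed
next
  case (AndI \<Gamma> A B)
  then show ?case unfolding sound_def by (auto dest: trk_pair)
next
  case (AndE1 \<Gamma> A B)
  then show ?case unfolding sound_def
    by (elim trk_bind) (rule trk_ct[of _ "\<lambda>y. p1 (p2 y)"], (intro ct_intros)[1], simp)
next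
  case (AndE2 \<Gamma> A B)
  then show ?case unfolding sound_def
    by (elim trk_bind) (rule trk_ct[of _ "\<lambda>y. p2 (p2 y)"], (intro ct_intros)[1], simp)
next
  case (OrI1 \<Gamma> A B)
  then show ?case unfolding sound_def
    by (elim trk_bind) (rule trk_ct[of _ "\<lambda>y. pair 0 (p2 y)"], (intro ct_intros)[1], simp)
next
  case (OrI2 \<Gamma> B A)
  then show ?case unfolding sound_def
    by (elim trk_bind) (rule trk_ct[of _ "\<lambda>y. pair 1 (p2 y)"], (intro ct_intros)[1], simp)
next
  case (OrE \<Gamma> A B C)
  let ?h = "\<lambda>y. pair (p1 (p1 y)) (pair (p2 (p2 y)) (p2 (p1 y)))"
  have "trk f (\<lambda>w y. ((w \<or> M) \<and> hyp f M \<Gamma> w (env (p1 (p1 y))) (p2 (p1 y))) \<and>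
      rl f M (Or A B) w (env (p1 (p1 y))) (p2 y)) (\<lambda>w y. rl f M C w (env (p1 (p1 y))))"
  proof (rule trk_if)
    show "ct f (\<lambda>y. p1 (p2 y))" by (intro ct_intros)
    show "trk f (\<lambda>w y. (((w \<or> M) \<and> hyp f M \<Gamma> w (env (p1 (p1 y))) (p2 (p1 y))) \<and>
        rl f M (Or A B) w (env (p1 (p1 y))) (p2 y)) \<and> p1 (p2 y) = 0)
        (\<lambda>w y. rl f M C w (env (p1 (p1 y))))"
      using OrE.IH(2) unfolding sound_def
      by (rule trk_pre[of _ _ _ ?h]) (auto intro!: ct_intros)
    show "trk f (\<lambda>w y. (((w \<or> M) \<and> hyp f M \<Gamma> w (env (p1 (p1 y))) (p2 (p1 y))) \<and>
        rl f M (Or A B) w (env (p1 (p1 y))) (p2 y)) \<and> p1 (p2 y) \<noteq> 0)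
        (\<lambda>w y. rl f M C w (env (p1 (p1 y))))"
      using OrE.IH(3) unfolding sound_def
      by (rule trk_pre[of _ _ _ ?h]) (auto intro!: ct_intros)
  qed
  with OrE.IH(1) show ?case unfolding sound_def by (rule trk_bind)
next
  case (ImpI A \<Gamma> B)
  then show ?case by (intro sound_ImpI)
next
  case (ImpE \<Gamma> A B)
  from ImpE.IH show ?case unfolding sound_def by (rule trk_app2) auto
next
  case (AllI \<Gamma> A)
  show ?case
    by (rule sound_AllI, rule trk_pre[OF AllI.IH[unfolded sound_def],
          of "\<lambda>y. pair (pair (p2 y) (p1 (p1 y))) (p2 (p1 y))"])
      (auto intro!: ct_intros simp: hyp_shift)
next
  case (AllE \<Gamma> A t)
  have "trk f (\<lambda>w x. (w \<or> M) \<and> hyp f M \<Gamma> w (env (p1 x)) (p2 x))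
      (\<lambda>w x b. b = tval (env (p1 x)) t)"
    by (rule trk_ct[OF ct_o[OF ct_tval[OF AllE.hyps(2)] ct_p1[OF ct_id]]]) simp
  with AllE.IH show ?case unfolding sound_def by (rule trk_app2) (auto simp: rl_inst)
next
  case (ExI \<Gamma> t A)
  have "trk f (\<lambda>w x. (w \<or> M) \<and> hyp f M \<Gamma> w (env (p1 x)) (p2 x))
      (\<lambda>w x b. b = tval (env (p1 x)) t)"
    by (rule trk_ct[OF ct_o[OF ct_tval[OF ExI.hyps(2)] ct_p1[OF ct_id]]]) simp
  from trk_pair[OF this ExI.IH[unfolded sound_def]] show ?case unfolding sound_def
    by (rule trk_imp) (auto simp: rl_inst)
next
  case (ExE \<Gamma> A B)
  let ?h = "\<lambda>y. pair (pair (p1 (p2 y)) (p1 (p1 y))) (pair (p2 (p2 y)) (p2 (p1 y)))"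
  from ExE.IH(1) show ?case unfolding sound_def
  proof (rule trk_bind)
    show "trk f (\<lambda>w y. ((w \<or> M) \<and> hyp f M \<Gamma> w (env (p1 (p1 y))) (p2 (p1 y))) \<and>
        rl f M (Ex A) w (env (p1 (p1 y))) (p2 y)) (\<lambda>w y. rl f M B w (env (p1 (p1 y))))"
      using ExE.IH(2) unfolding sound_def
      by (rule trk_pre[of _ _ _ ?h]) (auto intro!: ct_intros simp: hyp_shift rl_shift)
  qed
next
  case (EqRefl t \<Gamma>)
  show ?case by (rule sound_Eq) simp
next
  case (EqSubst \<Gamma> s t A)
  from trk_pair[OF EqSubst.IH[unfolded sound_def]] show ?case unfolding sound_def
  proof (rule trk_bind, intro trk_ct)
    show "ct f (\<lambda>y. p2 (p2 y))" by (intro ct_intros)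
    fix w y
    assume *: "((w \<or> M) \<and> hyp f M \<Gamma> w (env (p1 (p1 y))) (p2 (p1 y))) \<and>
        rl f M (Eq s t) w (env (p1 (p1 y))) (p1 (p2 y)) \<and>
        rl f M (inst s A) w (env (p1 (p1 y))) (p2 (p2 y))"
    show "rl f M (inst t A) w (env (p1 (p1 y))) (p2 (p2 y))"
    proof (cases w)
      case True
      then show ?thesis using * by (auto simp: rl_inst)
    next
      case False
      then show ?thesis using * rl_False_env unfolding rl_inst by metis
    qed
  qed
qed

subsection \<open>The arithmetical hierarchy\<close>

text \<open>All variables are absorbed into one coded argument, so that closure properties can be
  proved without syntax; \<open>hierarchy_fm\<close> leads back to prenex formulas.\<close>

fun SigP :: "nat \<Rightarrow> (nat \<Rightarrow> bool) \<Rightarrow> bool" and PiP :: "nat \<Rightarrow> (nat \<Rightarrow> bool) \<Rightarrow> bool" where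
  "SigP 0 P \<longleftrightarrow> pd P"
| "SigP (Suc k) P \<longleftrightarrow> (\<exists>Q. PiP k Q \<and> (\<forall>c. P c \<longleftrightarrow> (\<exists>x. Q (pair x c))))"
| "PiP 0 P \<longleftrightarrow> pd P"
| "PiP (Suc k) P \<longleftrightarrow> (\<exists>Q. SigP k Q \<and> (\<forall>c. P c \<longleftrightarrow> (\<forall>x. Q (pair x c))))"

lemma SigPI: "PiP k Q \<Longrightarrow> (\<And>c. P c \<longleftrightarrow> (\<exists>x. Q (pair x c))) \<Longrightarrow> SigP (Suc k) P"
  and PiPI: "SigP k Q \<Longrightarrow> (\<And>c. P c \<longleftrightarrow> (\<forall>x. Q (pair x c))) \<Longrightarrow> PiP (Suc k) P"
  unfolding SigP.simps PiP.simps by blast+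

lemma P_not: "(SigP k P \<longrightarrow> PiP k (\<lambda>x. \<not> P x)) \<and> (PiP k P \<longrightarrow> SigP k (\<lambda>x. \<not> P x))"
proof (induction k arbitrary: P)
  case 0
  show ?case by (auto intro: pd_not)
next
  case (Suc k)
  show ?case
  proof (intro conjI impI)
    assume "SigP (Suc k) P"
    then obtain Q where "PiP k Q" "\<And>c. P c \<longleftrightarrow> (\<exists>x. Q (pair x c))" by auto
    then show "PiP (Suc k) (\<lambda>x. \<not> P x)"
      using Suc by (intro PiPI[of k "\<lambda>x. \<not> Q x"]) auto
  next
    assume "PiP (Suc k) P"
    then obtain Q where "SigP k Q" "\<And>c. P c \<longleftrightarrow> (\<forall>x. Q (pair x c))" by auto
    then show "SigP (Suc k) (\<lambda>x. \<not> P x)"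
      using Suc by (intro SigPI[of k "\<lambda>x. \<not> Q x"]) auto
  qed
qed

lemma SigP_not: "PiP k P \<Longrightarrow> SigP k (\<lambda>x. \<not> P x)"
  and PiP_not: "SigP k P \<Longrightarrow> PiP k (\<lambda>x. \<not> P x)"
  using P_not by blast+

lemma SigP_o: "SigP k P \<Longrightarrow> pu g \<Longrightarrow> SigP k (\<lambda>x. P (g x))"
  and PiP_o: "PiP k P \<Longrightarrow> pu g \<Longrightarrow> PiP k (\<lambda>x. P (g x))"
proof (induction k arbitrary: P g)
  case 0
  {
    case 1
    then show ?case by (simp add: pd_o)
  next
    case 2
    then show ?case by (simp add: pd_o)
  }
next
  case (Suc k)
  have g: "pu (\<lambda>y. pair (p1 y) (g (p2 y)))" if "pu g" for g
    by (intro pu_pair pu_p1 pu_id pu_o[OF that] pu_p2)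
  {
    case 1
    then obtain Q where "PiP k Q" "\<And>c. P c \<longleftrightarrow> (\<exists>x. Q (pair x c))" by auto
    then show ?case
      by (intro SigPI[OF Suc(2)[OF _ g[OF 1(2)]], of Q]) auto
  next
    case 2
    then obtain Q where "SigP k Q" "\<And>c. P c \<longleftrightarrow> (\<forall>x. Q (pair x c))" by auto
    then show ?case
      by (intro PiPI[OF Suc(1)[OF _ g[OF 2(2)]], of Q]) auto
  }
qed

lemma SigP_PiP_Suc: "SigP k P \<Longrightarrow> PiP (Suc k) P"
  by (rule PiPI[OF SigP_o[OF _ pu_p2[OF pu_id]]]) auto

lemma PiP_SigP_Suc: "PiP k P \<Longrightarrow> SigP (Suc k) P"
  by (rule SigPI[OF PiP_o[OF _ pu_p2[OF pu_id]]]) auto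

lemma SigP_Suc: "SigP k P \<Longrightarrow> SigP (Suc k) P"
  and PiP_Suc: "PiP k P \<Longrightarrow> PiP (Suc k) P"
proof (induction k arbitrary: P)
  case 0
  {
    case 1
    then show ?case using PiP_SigP_Suc[of 0] by simp
  next
    case 2
    then show ?case using SigP_PiP_Suc[of 0] by simp
  }
next
  case (Suc k)
  {
    case 1
    then obtain Q where "PiP k Q" "\<And>c. P c \<longleftrightarrow> (\<exists>x. Q (pair x c))" by auto
    then show ?case using Suc(2) by (intro SigPI) auto
  next
    case 2
    then obtain Q where "SigP k Q" "\<And>c. P c \<longleftrightarrow> (\<forall>x. Q (pair x c))" by auto
    then show ?case using Suc(1) by (intro PiPI) auto
  }
qed

lemma SigP_conj: "SigP k P \<Longrightarrow> SigP k P' \<Longrightarrow> SigP k (\<lambda>x. P x \<and> P' x)"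
  and SigP_disj: "SigP k P \<Longrightarrow> SigP k P' \<Longrightarrow> SigP k (\<lambda>x. P x \<or> P' x)"
proof (induction k arbitrary: P P')
  case 0
  {
    case 1
    then show ?case by (simp add: pd_conj)
  next
    case 2
    then show ?case by (simp add: pd_disj)
  }
next
  case (Suc k)
  \<comment> \<open>De Morgan: the closure of \<open>PiP\<close> at level \<open>k\<close> comes
    from the induction hypotheses on \<open>SigP\<close> by complementing twice.\<close>
  have conj: "PiP k (\<lambda>x. Q x \<and> Q' x)" if "PiP k Q" "PiP k Q'" for Q Q'
    using PiP_not[OF Suc(2)[OF SigP_not SigP_not], OF that] by simp
  have disj: "PiP k (\<lambda>x. Q x \<or> Q' x)" if "PiP k Q" "PiP k Q'" for Q Q'
    using PiP_not[OF Suc(1)[OF SigP_not SigP_not], OF that] by simp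
  {
    case 1
    then obtain Q Q' where Q: "PiP k Q" "\<And>c. P c \<longleftrightarrow> (\<exists>x. Q (pair x c))"
      and Q': "PiP k Q'" "\<And>c. P' c \<longleftrightarrow> (\<exists>x. Q' (pair x c))" by auto
    have "PiP k (\<lambda>u. Q (pair (p1 (p1 u)) (p2 u)) \<and> Q' (pair (p2 (p1 u)) (p2 u)))"
      by (intro conj PiP_o[OF Q(1)] PiP_o[OF Q'(1)] pu_intros)
    then show ?case
    proof (rule SigPI)
      fix c
      show "(P c \<and> P' c) \<longleftrightarrow> (\<exists>x. Q (pair (p1 (p1 (pair x c))) (p2 (pair x c))) \<and>
          Q' (pair (p2 (p1 (pair x c))) (p2 (pair x c))))"
        unfolding Q(2) Q'(2) by (metis p1_pair p2_pair)
    qed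
  next
    case 2
    then obtain Q Q' where Q: "PiP k Q" "\<And>c. P c \<longleftrightarrow> (\<exists>x. Q (pair x c))"
      and Q': "PiP k Q'" "\<And>c. P' c \<longleftrightarrow> (\<exists>x. Q' (pair x c))" by auto
    from disj[OF Q(1) Q'(1)] show ?case
      by (rule SigPI) (auto simp: Q(2) Q'(2))
  }
qed

lemma SigP_ex:
  assumes "SigP (Suc k) P"
  shows "SigP (Suc k) (\<lambda>c. \<exists>x. P (pair x c))"
proof -
  obtain Q where Q: "PiP k Q" "\<And>c. P c \<longleftrightarrow> (\<exists>x. Q (pair x c))" using assms by auto
  have "PiP k (\<lambda>u. Q (pair (p1 (p1 u)) (pair (p2 (p1 u)) (p2 u))))"
    by (intro PiP_o[OF Q(1)] pu_intros)
  then show ?thesis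
  proof (rule SigPI)
    fix c
    show "(\<exists>x. P (pair x c)) \<longleftrightarrow> (\<exists>x. Q (pair (p1 (p1 (pair x c)))
        (pair (p2 (p1 (pair x c))) (p2 (pair x c)))))"
      unfolding Q(2) by (metis p1_pair p2_pair)
  qed
qed

text \<open>Collection: finitely many witnesses, one for each \<open>i\<close> below the bound, are
  coded in a single number \<open>s\<close> and read off by \<open>nthc\<close>. The existential
  quantifier thereby moves in front of the bounded one.\<close>

lemma SigP_ball: "SigP k P \<Longrightarrow> pu b \<Longrightarrow> SigP k (\<lambda>x. \<forall>i<b x. P (pair i x))"
  and PiP_ball: "PiP k P \<Longrightarrow> pu b \<Longrightarrow> PiP k (\<lambda>x. \<forall>i<b x. P (pair i x))"
proof (induction k arbitrary: P b)
  case 0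
  {
    case 1
    then show ?case by (simp add: pd_ball)
  next
    case 2
    then show ?case by (simp add: pd_ball)
  }
next
  case (Suc k)
  {
    case 1
    then obtain Q where Q: "PiP k Q" "\<And>c. P c \<longleftrightarrow> (\<exists>x. Q (pair x c))" by auto
    let ?Q = "\<lambda>u. Q (pair (nthc (p1 (p2 u)) (p1 u)) (pair (p1 u) (p2 (p2 u))))"
    have "PiP k (\<lambda>z. \<forall>i<b (p2 z). ?Q (pair i z))"
      by (intro Suc(2) PiP_o[OF Q(1)] pu_intros pu_o[OF 1(2)])
    then show ?case
    proof (rule SigPI)
      fix c
      have "(\<forall>i<b c. \<exists>x. Q (pair x (pair i c))) \<longleftrightarrow>
          (\<exists>s. \<forall>i<b c. Q (pair (nthc s i) (pair i c)))"
      proof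
        assume "\<forall>i<b c. \<exists>x. Q (pair x (pair i c))"
        then obtain h where h: "\<forall>i<b c. Q (pair (h i) (pair i c))" by metis
        obtain s where "\<forall>i<b c. nthc s i = h i"
          using nthc_list[of "map h [0..<b c]"] by auto
        with h show "\<exists>s. \<forall>i<b c. Q (pair (nthc s i) (pair i c))"
          by (intro exI[of _ s]) simp
      qed auto
      then show "(\<forall>i<b c. P (pair i c)) \<longleftrightarrow> (\<exists>x. \<forall>i<b (p2 (pair x c)). ?Q (pair i (pair x c)))"
        by (simp add: Q(2))
    qed
  next
    case 2
    then obtain Q where Q: "SigP k Q" "\<And>c. P c \<longleftrightarrow> (\<forall>x. Q (pair x c))" by auto
    let ?Q = "\<lambda>u. Q (pair (p1 (p2 u)) (pair (p1 u) (p2 (p2 u))))"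
    have "SigP k (\<lambda>z. \<forall>i<b (p2 z). ?Q (pair i z))"
      by (intro Suc(1) SigP_o[OF Q(1)] pu_intros pu_o[OF 2(2)])
    then show ?case
      by (rule PiPI) (auto simp: Q(2))
  }
qed

declare SigP.simps(2) [simp del] PiP.simps(2) [simp del]

lemma SigP_pd: "pd P \<Longrightarrow> SigP k P"
  by (induction k) (auto intro: SigP_Suc)

subsection \<open>Definability of oracle computations\<close>

text \<open>
  A computation is coded by a list of triples \<open>(e, a, b)\<close>, each of which follows from later ones
  by one of the evaluation rules.
\<close>

definition triple :: "nat \<Rightarrow> nat \<Rightarrow> nat \<Rightarrow> nat" where "triple e a b = pair e (pair a b)"

definition base :: "nat \<Rightarrow> nat \<Rightarrow> nat \<Rightarrow> nat \<Rightarrow> nat \<Rightarrow> bool" where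
  "base t p q a b \<longleftrightarrow> t = 0 \<and> b = p \<or> t = 1 \<and> b = a \<or> t = 2 \<and> b = p1 a \<or> t = 3 \<and> b = p2 a \<or>
     t = 4 \<and> b = Suc a \<or> t = 5 \<and> b = clo p a"

text \<open>\<open>y\<close> and \<open>z\<close> are the premises; rules with one premise leave
  \<open>z\<close> free, so that all rules have the same shape. In the clause for composition the
  equation \<open>y = triple p a (p2 (p2 y))\<close> leaves the intermediate value open, and
  \<open>z\<close> takes it up.\<close>

definition step :: "nat \<Rightarrow> nat \<Rightarrow> nat \<Rightarrow> nat \<Rightarrow> nat \<Rightarrow> nat \<Rightarrow> nat \<Rightarrow> bool" where
  "step t p q a b y z \<longleftrightarrow>
     t = 6 \<and> y = triple p (pair (clo p q) a) b \<or>
     t = 8 \<and> y = triple p a (p2 (p2 y)) \<and> z = triple q (p2 (p2 y)) b \<or>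
     t = 9 \<and> y = triple p a (p1 b) \<and> z = triple q a (p2 b) \<or>
     t = 10 \<and> y = triple (p1 a) (p2 a) b \<or>
     t = 11 \<and> p1 a = 0 \<and> y = triple p (p2 a) b \<or>
     t = 11 \<and> p1 a \<noteq> 0 \<and> y = triple q (pair (p1 a - 1) (p2 a)) b"

lemma triple_proj [simp]: "p1 (triple e a b) = e" "p1 (p2 (triple e a b)) = a" "p2 (p2 (triple e a b)) = b"
  and triple_eq [simp]: "triple e a b = triple e' a' b' \<longleftrightarrow> e = e' \<and> a = a' \<and> b = b'"
  by (simp_all add: triple_def)

definition baseT :: "nat \<Rightarrow> bool" where
  "baseT x = base (p1 (p1 x)) (p1 (p2 (p1 x))) (p2 (p2 (p1 x))) (p1 (p2 x)) (p2 (p2 x))"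

definition stepT :: "nat \<Rightarrow> nat \<Rightarrow> nat \<Rightarrow> bool" where
  "stepT x y z = step (p1 (p1 x)) (p1 (p2 (p1 x))) (p2 (p2 (p1 x))) (p1 (p2 x)) (p2 (p2 x)) y z"

text \<open>Oracle calls are kept apart from \<open>baseT\<close> because they are the only place
  where \<open>f\<close> enters; their complexity is that of the graph of \<open>f\<close>.\<close>

definition queryT :: "(nat \<Rightarrow> nat) \<Rightarrow> nat \<Rightarrow> bool" where
  "queryT f x \<longleftrightarrow> p1 (p1 x) = 7 \<and> f (p1 (p2 x)) = p2 (p2 x)"

definition evT :: "(nat \<Rightarrow> nat) \<Rightarrow> nat \<Rightarrow> bool" where
  "evT f x = ev f (p1 x) (p1 (p2 x)) (p2 (p2 x))"

lemma triple_surj: "triple (p1 x) (p1 (p2 x)) (p2 (p2 x)) = x"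
  by (simp add: triple_def)

lemma code_surj: "code (p1 e) (p1 (p2 e)) (p2 (p2 e)) = e"
  by (simp add: code_def)

lemma base_ev: "base t p q a b \<Longrightarrow> ev f (code t p q) a b"
  unfolding base_def by (elim disjE conjE; simp only: ev.intros)

lemma step_ev: "step t p q a b y z \<Longrightarrow> evT f y \<Longrightarrow> evT f z \<Longrightarrow> ev f (code t p q) a b"
  unfolding step_def
proof (elim disjE conjE)
  assume "t = 9" "y = triple p a (p1 b)" "z = triple q a (p2 b)" "evT f y" "evT f z"
  then show ?thesis using ev.pairing[of f p a "p1 b" q "p2 b"] by (simp add: evT_def)
next
  assume "t = 8" "y = triple p a (p2 (p2 y))" "z = triple q (p2 (p2 y)) b" "evT f y" "evT f z"
  then show ?thesis unfolding evT_def using ev.comp by (metis triple_proj)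
next
  assume "t = 11" "p1 a \<noteq> 0" "y = triple q (pair (p1 a - 1) (p2 a)) b" "evT f y" "evT f z"
  then show ?thesis using ev.caseS[of a "p1 a - 1" f q b p] by (simp add: evT_def)
qed (auto simp: evT_def intro: ev.intros)

lemma T_ev: "baseT x \<Longrightarrow> evT f x" "queryT f x \<Longrightarrow> evT f x"
  "stepT x y z \<Longrightarrow> evT f y \<Longrightarrow> evT f z \<Longrightarrow> evT f x"
  unfolding baseT_def queryT_def stepT_def
  by (auto simp: evT_def[of f x] dest: base_ev[of _ _ _ _ _ f] step_ev simp: code_surj)
    (metis code_surj ev.query)

inductive drv :: "(nat \<Rightarrow> nat) \<Rightarrow> nat list \<Rightarrow> bool" for f where
  Nil: "drv f []"
| Cons: "drv f xs \<Longrightarrow> baseT x \<or> queryT f x \<or> (\<exists>y\<in>set xs. \<exists>z\<in>set xs. stepT x y z) \<Longrightarrow> drv f (x # xs)"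

lemma drv_append: "drv f xs \<Longrightarrow> drv f ys \<Longrightarrow> drv f (xs @ ys)"
  by (induction rule: drv.induct) (auto intro: drv.Cons)

lemma drv_step:
  assumes "drv f xs" "y \<in> set xs" "drv f ys" "z \<in> set ys" "stepT x y z"
  shows "\<exists>xs. drv f (x # xs)"
  using assms drv_append[OF assms(1,3)] by (intro exI[of _ "xs @ ys"] drv.Cons) auto

lemma ev_drv: "ev f e a b \<Longrightarrow> \<exists>xs. drv f (triple e a b # xs)"
proof (induction rule: ev.induct)
  case (closure p c a b)
  then obtain xs where "drv f (triple p (pair (clo p c) a) b # xs)" by blast
  from this list.set_intros(1) this list.set_intros(1) show ?case
    by (rule drv_step) (simp add: stepT_def step_def)
next
  case (comp p a u q b)
  then obtain xs ys where "drv f (triple p a u # xs)" "drv f (triple q u b # ys)" by blast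
  from this(1) list.set_intros(1) this(2) list.set_intros(1) show ?case
    by (rule drv_step) (simp add: stepT_def step_def)
next
  case (pairing p a u q v)
  then obtain xs ys where "drv f (triple p a u # xs)" "drv f (triple q a v # ys)" by blast
  from this(1) list.set_intros(1) this(2) list.set_intros(1) show ?case
    by (rule drv_step) (simp add: stepT_def step_def)
next
  case (app a b p q)
  then obtain xs where "drv f (triple (p1 a) (p2 a) b # xs)" by blast
  from this list.set_intros(1) this list.set_intros(1) show ?case
    by (rule drv_step) (simp add: stepT_def step_def)
next
  case (case0 a p b q)
  then obtain xs where "drv f (triple p (p2 a) b # xs)" by blast
  from this list.set_intros(1) this list.set_intros(1) show ?case
    by (rule drv_step) (use case0.hyps in \<open>simp add: stepT_def step_def\<close>)
next
  case (caseS a m q b p)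
  then obtain xs where "drv f (triple q (pair m (p2 a)) b # xs)" by blast
  from this list.set_intros(1) this list.set_intros(1) show ?case
    by (rule drv_step) (use caseS.hyps in \<open>simp add: stepT_def step_def\<close>)
qed (rule exI[of _ "[]"], rule drv.Cons[OF drv.Nil],
    simp add: baseT_def base_def queryT_def)+

definition okT :: "(nat \<Rightarrow> nat) \<Rightarrow> nat \<Rightarrow> nat \<Rightarrow> nat \<Rightarrow> bool" where
  "okT f d l i \<longleftrightarrow> baseT (nthc d i) \<or> queryT f (nthc d i) \<or>
     (\<exists>j<l. \<exists>k<l. i < j \<and> i < k \<and> stepT (nthc d i) (nthc d j) (nthc d k))"

lemma drv_nth:
  "drv f xs \<Longrightarrow> i < length xs \<Longrightarrow> baseT (xs ! i) \<or> queryT f (xs ! i) \<or>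
     (\<exists>j<length xs. \<exists>k<length xs. i < j \<and> i < k \<and> stepT (xs ! i) (xs ! j) (xs ! k))"
proof (induction arbitrary: i rule: drv.induct)
  case (Cons xs x)
  have bex: "\<exists>j<length (x # xs). \<exists>k<length (x # xs). i < j \<and> i < k \<and>
      stepT ((x # xs) ! i) ((x # xs) ! j) ((x # xs) ! k)"
    if "j < length xs" "k < length xs" "i < Suc j" "i < Suc k"
      "stepT ((x # xs) ! i) (xs ! j) (xs ! k)" for j k
    using that by - (rule exI[of _ "Suc j"], rule conjI, simp, rule exI[of _ "Suc k"], simp)
  show ?case
  proof (cases i)
    case 0
    consider "baseT x" | "queryT f x" | j k where "j < length xs" "k < length xs"
        "stepT x (xs ! j) (xs ! k)"
      using Cons.hyps(2) by (auto simp only: in_set_conv_nth)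
    then show ?thesis using 0 bex by cases simp_all
  next
    case (Suc i')
    then have "i' < length xs" using Cons.prems by simp
    from Cons.IH[OF this]
    consider "baseT (xs ! i')" | "queryT f (xs ! i')" | j k where "j < length xs" "k < length xs"
        "i' < j" "i' < k" "stepT (xs ! i') (xs ! j) (xs ! k)"
      by blast
    then show ?thesis using Suc bex by cases simp_all
  qed
qed simp

text \<open>Kleene's normal form. The number \<open>z\<close> pairs a code of the list of triples
  with its length. Since \<open>okT\<close> justifies an entry only by entries of larger index, all
  entries are correct by induction on the distance to the end.\<close>

lemma evT_iff: "evT f x \<longleftrightarrow> (\<exists>z. 0 < p2 z \<and> nthc (p1 z) 0 = x \<and> (\<forall>i<p2 z. okT f (p1 z) (p2 z) i))"
proof
  assume "evT f x"
  then obtain xs where xs: "drv f (x # xs)"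
    using ev_drv[of f "p1 x" "p1 (p2 x)" "p2 (p2 x)"] by (auto simp: evT_def triple_surj)
  obtain d where d: "\<And>i. i < length (x # xs) \<Longrightarrow> nthc d i = (x # xs) ! i"
    using nthc_list by blast
  have "okT f d (length (x # xs)) i" if "i < length (x # xs)" for i
    using drv_nth[OF xs that] d that unfolding okT_def by metis
  then show "\<exists>z. 0 < p2 z \<and> nthc (p1 z) 0 = x \<and> (\<forall>i<p2 z. okT f (p1 z) (p2 z) i)"
    using d[of 0] by (intro exI[of _ "pair d (length (x # xs))"]) simp
next
  assume "\<exists>z. 0 < p2 z \<and> nthc (p1 z) 0 = x \<and> (\<forall>i<p2 z. okT f (p1 z) (p2 z) i)"
  then obtain d l where l: "0 < l" "nthc d 0 = x" "\<And>i. i < l \<Longrightarrow> okT f d l i" by auto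
  have "evT f (nthc d i)" if "i < l" for i
    using that
  proof (induction "l - i" arbitrary: i rule: less_induct)
    case less
    then have IH: "evT f (nthc d j)" if "i < j" "j < l" for j
      using that by (intro less.hyps) auto
    show ?case using l(3)[OF less.prems] IH T_ev unfolding okT_def by blast
  qed
  then show "evT f x" using l by blast
qed

lemma pd_baseT: "pu h \<Longrightarrow> pd (\<lambda>x. baseT (h x))"
  unfolding baseT_def base_def code_def by (intro pd_intros pu_intros)

lemma pd_stepT: "pu g \<Longrightarrow> pu h \<Longrightarrow> pu k \<Longrightarrow> pd (\<lambda>x. stepT (g x) (h x) (k x))"
  unfolding stepT_def step_def code_def triple_def by (intro pd_intros pu_intros)

lemma pd_less: "pu g \<Longrightarrow> pu h \<Longrightarrow> pd (\<lambda>x. g x < h x)"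
  using pd_not[OF pd_eq[OF pu_diff pu_const], of h g 0] by (simp add: not_le)

text \<open>The oracle is consulted under a bounded universal quantifier over the entries, which by
  \<open>SigP_ball\<close> does not raise the level, and the quantifier over computations is
  existential.\<close>

lemma SigP_evT:
  assumes "SigP (Suc m) (\<lambda>x. f (p1 x) = p2 x)"
  shows "SigP (Suc m) (evT f)"
proof -
  \<comment> \<open>Here \<open>u\<close> stands for \<open>pair i (pair (pair d l) x)\<close>, with
    \<open>d\<close> the coded list and \<open>l\<close> its length, and \<open>w\<close> for
    \<open>pair k (pair j u)\<close>.\<close>
  let ?d = "\<lambda>u. p1 (p1 (p2 u))" and ?l = "\<lambda>u. p2 (p1 (p2 u))"
  let ?i = "\<lambda>w. p1 (p2 (p2 w))" and ?dw = "\<lambda>w. p1 (p1 (p2 (p2 (p2 w))))"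
  have W: "pd (\<lambda>w. ?i w < p1 (p2 w) \<and> ?i w < p1 w \<and>
      stepT (nthc (?dw w) (?i w)) (nthc (?dw w) (p1 (p2 w))) (nthc (?dw w) (p1 w)))"
    by (intro pd_conj pd_less pd_stepT pu_intros)
  have b: "pu (\<lambda>v. ?l (p2 v))" "pu ?l" by (intro pu_intros)+
  have st: "pd (\<lambda>u. \<exists>j<?l u. \<exists>k<?l u. p1 u < j \<and> p1 u < k \<and>
      stepT (nthc (?d u) (p1 u)) (nthc (?d u) j) (nthc (?d u) k))"
    using pd_bex[OF pd_bex[OF W b(1)] b(2)] by simp
  have "pu (\<lambda>u. pair (p1 (p2 (nthc (?d u) (p1 u)))) (p2 (p2 (nthc (?d u) (p1 u)))))"
    by (intro pu_intros)
  from SigP_o[OF assms this] have "SigP (Suc m) (\<lambda>u. f (p1 (p2 (nthc (?d u) (p1 u)))) =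
      p2 (p2 (nthc (?d u) (p1 u))))" by simp
  with SigP_pd have qu: "SigP (Suc m) (\<lambda>u. queryT f (nthc (?d u) (p1 u)))"
    unfolding queryT_def by (rule SigP_conj) (intro pd_eq pu_intros)
  have "SigP (Suc m) (\<lambda>u. okT f (?d u) (?l u) (p1 u))"
    unfolding okT_def
    by (intro SigP_disj qu SigP_pd[OF st] SigP_pd[OF pd_baseT] pu_intros)
  from SigP_ball[OF this, of "\<lambda>y. p2 (p1 y)"]
  have "SigP (Suc m) (\<lambda>y. \<forall>i<p2 (p1 y). okT f (p1 (p1 y)) (p2 (p1 y)) i)"
    by (simp add: pu_p1 pu_p2 pu_id)
  then have "SigP (Suc m) (\<lambda>y. 0 < p2 (p1 y) \<and> nthc (p1 (p1 y)) 0 = p2 y \<and>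
      (\<forall>i<p2 (p1 y). okT f (p1 (p1 y)) (p2 (p1 y)) i))"
    by (intro SigP_conj[OF SigP_pd SigP_conj[OF SigP_pd]] pd_less pd_eq pu_intros)
  from SigP_ex[OF this] show ?thesis by (simp add: evT_iff[abs_def])
qed

text \<open>An iterated Turing jump in a form suited to quantifiers: the oracle tells whether a
  program outputs 0 on some input, so an existential statement with decidable matrix is settled by
  one query.\<close>

primrec jump :: "nat \<Rightarrow> nat \<Rightarrow> nat" where
  "jump 0 = (\<lambda>_. 0)"
| "jump (Suc m) = (\<lambda>e. if \<exists>x. ev (jump m) e x 0 then 0 else 1)"

text \<open>The answer 0 is an existential condition and the answer 1 its complement; both fit into
  the next existential level, hence so does the graph.\<close>

lemma SigP_jump: "SigP (Suc m) (\<lambda>x. jump m (p1 x) = p2 x)"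
proof (induction m)
  case 0
  have "pd (\<lambda>x. 0 = p2 x)" by (intro pd_eq pu_intros)
  then show ?case by (simp only: jump.simps SigP_pd)
next
  case (Suc m)
  have "SigP (Suc m) (\<lambda>y. evT (jump m) (triple (p2 y) (p1 y) 0))"
    unfolding triple_def by (intro SigP_o[OF SigP_evT[OF Suc]] pu_intros)
  from SigP_ex[OF this] have H: "SigP (Suc m) (\<lambda>e. \<exists>x. ev (jump m) e x 0)" by (simp add: evT_def)
  have H1: "SigP (Suc (Suc m)) (\<lambda>x. \<exists>y. ev (jump m) (p1 x) y 0)"
    by (rule SigP_Suc[OF SigP_o[OF H pu_p1[OF pu_id]]])
  have H0: "SigP (Suc (Suc m)) (\<lambda>x. \<not> (\<exists>y. ev (jump m) (p1 x) y 0))"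
    by (rule PiP_SigP_Suc[OF PiP_o[OF PiP_not[OF H] pu_p1[OF pu_id]]])
  have "SigP (Suc (Suc m)) (\<lambda>x. (p2 x = 0 \<and> (\<exists>y. ev (jump m) (p1 x) y 0)) \<or>
      (p2 x = 1 \<and> \<not> (\<exists>y. ev (jump m) (p1 x) y 0)))"
    by (intro SigP_disj SigP_conj H1 H0 SigP_pd pd_eq pu_intros)
  moreover have "(\<lambda>x. jump (Suc m) (p1 x) = p2 x) = (\<lambda>x. (p2 x = 0 \<and> (\<exists>y. ev (jump m) (p1 x) y 0)) \<or>
      (p2 x = 1 \<and> \<not> (\<exists>y. ev (jump m) (p1 x) y 0)))"
    by (rule ext) auto
  ultimately show ?case by (simp only:)
qed

lemma SigP_diagonal: "SigP (Suc m) (\<lambda>y. ev (jump m) y y 0)"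
proof -
  have "SigP (Suc m) (\<lambda>y. evT (jump m) (triple y y 0))"
    unfolding triple_def by (intro SigP_o[OF SigP_evT[OF SigP_jump]] pu_intros)
  then show ?thesis by (simp add: evT_def)
qed

lemma diagonal_undecidable:
  assumes "\<And>y. \<exists>b. ev (jump m) e y b \<and> (b = 0 \<longleftrightarrow> ev (jump m) y y 0)"
  shows False
proof -
  obtain i where i: "\<And>x. ev (jump m) i x (if x = 0 then 1 else 0)"
    using pu_ct[OF pu_if0[OF pu_id]] unfolding ct_def by blast
  \<comment> \<open>The usual diagonal program: run on its own code it outputs 0 exactly when
    \<open>e\<close> claims that it does not.\<close>
  let ?d = "cC e i"
  obtain b where b: "ev (jump m) e ?d b" "b = 0 \<longleftrightarrow> ev (jump m) ?d ?d 0" using assms by blast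
  have "ev (jump m) ?d ?d (if b = 0 then 1 else 0)" by (rule ev.comp[OF b(1) i])
  then show False using b(2) ev_det[of "jump m" ?d ?d _ 0] by (cases "b = 0") auto
qed

subsection \<open>Truth in the standard model\<close>

primrec tr :: "fm \<Rightarrow> (nat \<Rightarrow> nat) \<Rightarrow> bool" where
  "tr (Eq s t) = (\<lambda>\<rho>. tval \<rho> s = tval \<rho> t)"
| "tr (And A B) = (\<lambda>\<rho>. tr A \<rho> \<and> tr B \<rho>)"
| "tr (Or A B) = (\<lambda>\<rho>. tr A \<rho> \<or> tr B \<rho>)"
| "tr (Imp A B) = (\<lambda>\<rho>. tr A \<rho> \<longrightarrow> tr B \<rho>)"
| "tr (All A) = (\<lambda>\<rho>. \<forall>n. tr A (case_nat n \<rho>))"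
| "tr (Ex A) = (\<lambda>\<rho>. \<exists>n. tr A (case_nat n \<rho>))"

lemma fv_bound_tm_shift:
  "fv_bound_tm (subst_tm (\<lambda>j. Var (Suc j)) t) = (if fv_bound_tm t = 0 then 0 else Suc (fv_bound_tm t))"
proof (induction t)
  case (App p ts)
  then show ?case by (induction ts) auto
qed simp

lemma wf_tm_shift: "wf_tm t \<Longrightarrow> wf_tm (subst_tm (\<lambda>j. Var (Suc j)) t)"
  by (induction t) auto

text \<open>The matrix contains only the one term \<open>t\<close>, into which every new quantified
  variable is paired by the description \<open>r\<close>. The value of \<open>fv_bound\<close> is
  tracked so that the closure of a diagonal instance consists of a single quantifier.\<close>

lemma hierarchy_fm:
  assumes "wf_tm t" "fv_bound_tm t = Suc m"
  shows "SigP k P \<Longrightarrow> \<exists>A\<in>Sigma_fm k. (\<forall>\<rho>. tr A \<rho> \<longleftrightarrow> P (tval \<rho> t)) \<and> fv_bound A = Suc m"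
    and "PiP k P \<Longrightarrow> \<exists>A\<in>Pi_fm k. (\<forall>\<rho>. tr A \<rho> \<longleftrightarrow> P (tval \<rho> t)) \<and> fv_bound A = Suc m"
  using assms
proof (induction k arbitrary: P t m)
  case 0
  have "\<exists>A. wf_fm A \<and> qfree A \<and> (\<forall>\<rho>. tr A \<rho> \<longleftrightarrow> P (tval \<rho> t)) \<and> fv_bound A = Suc m"
    if "pd P" "wf_tm t" "fv_bound_tm t = Suc m" for P t m
  proof -
    obtain p where p: "wf_pr p" "arity p = 1"
        "\<And>xs. length xs = 1 \<Longrightarrow> pev p xs = (if P (xs ! 0) then 0 else 1)"
      using \<open>pd P\<close> unfolding pd_def pu_def PR_def by auto
    then show ?thesis using that by (intro exI[of _ "Eq (App p [t]) zero"]) simp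
  qed
  note * = this
  {
    case 1
    with *[OF 1(1)[unfolded SigP.simps] 1(2,3)] show ?case by simp
  next
    case 2
    with *[OF 2(1)[unfolded PiP.simps] 2(2,3)] show ?case by simp
  }
next
  case (Suc k)
  obtain r where r: "wf_pr r" "arity r = 2" "\<And>xs. length xs = 2 \<Longrightarrow> pev r xs = pair (xs ! 0) (xs ! 1)"
    using PR_pair[OF PR_nth[of 0 2] PR_nth[of 1 2]] unfolding PR_def by auto
  let ?t = "\<lambda>t. App r [Var 0, subst_tm (\<lambda>j. Var (Suc j)) t]"
  have val: "tval (case_nat n \<rho>) (?t t) = pair n (tval \<rho> t)" for n \<rho> t
    using r by (simp add: tval_subst)
  have t: "wf_tm (?t t)" "fv_bound_tm (?t t) = Suc (Suc m)" if "wf_tm t" "fv_bound_tm t = Suc m" for t m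
    using r that by (simp_all add: wf_tm_shift fv_bound_tm_shift)
  {
    case 1
    then obtain Q where Q: "PiP k Q" "\<And>c. P c \<longleftrightarrow> (\<exists>x. Q (pair x c))"
      by (auto simp: SigP.simps(2))
    obtain A where "A \<in> Pi_fm k" "\<And>\<rho>. tr A \<rho> \<longleftrightarrow> Q (tval \<rho> (?t t))" "fv_bound A = Suc (Suc m)"
      using Suc(2)[OF Q(1) t(1)[OF 1(2,3)] t(2)[OF 1(2,3)]] by blast
    then show ?case using val Q(2) by (intro bexI[of _ "Ex A"]) (simp_all del: tval.simps)
  next
    case 2
    then obtain Q where Q: "SigP k Q" "\<And>c. P c \<longleftrightarrow> (\<forall>x. Q (pair x c))"
      by (auto simp: PiP.simps(2))
    obtain A where "A \<in> Sigma_fm k" "\<And>\<rho>. tr A \<rho> \<longleftrightarrow> Q (tval \<rho> (?t t))" "fv_bound A = Suc (Suc m)"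
      using Suc(1)[OF Q(1) t(1)[OF 2(2,3)] t(2)[OF 2(2,3)]] by blast
    then show ?case using val Q(2) by (intro bexI[of _ "All A"]) (simp_all del: tval.simps)
  }
qed

subsection \<open>Decidability and canonical realizers\<close>

declare jump.simps [simp del]

lemma if_0_1 [simp]:
  "((if P then 0 else Suc 0) = 0) = P" "(0 < (if P then 0 else Suc 0)) = (\<not> P)"
  "((if P then 0 else Suc 0) = Suc 0) = (\<not> P)"
  by simp_all

lemma rl_ImpD:
  assumes "rl f M (Imp A B) w \<rho> x" "rl f M A v \<rho> a" "v \<longrightarrow> w" "v \<or> M"
  shows "\<exists>b. ev f x a b \<and> rl f M B v \<rho> b"
proof -
  have "(v \<longrightarrow> w) \<and> (v \<or> M) \<longrightarrow> (\<forall>a. rl f M A v \<rho> a \<longrightarrow> (\<exists>b. ev f x a b \<and> rl f M B v \<rho> b))"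
    using assms(1) unfolding rl.simps by (rule spec)
  then show ?thesis using assms(2-4) by simp
qed

lemma ct_pd: "pd P \<Longrightarrow> ct f g \<Longrightarrow> ct f (\<lambda>c. if P (g c) then 0 else 1)"
  unfolding pd_def by (drule pu_ct) (rule ct_o[of f "\<lambda>x. if P x then 0 else 1"])

lemma ct_trk: "ct f g \<longleftrightarrow> trk f (\<lambda>(w::unit) x. True) (\<lambda>w x b. b = g x)"
  by (simp add: ct_def trk_def)

lemma ct_if:
  assumes "ct f g" "ct f a" "ct f b"
  shows "ct f (\<lambda>x. if g x = 0 then a x else b x)"
proof -
  have "trk f (\<lambda>(w::unit) x. True) (\<lambda>w x u. u = (if g x = 0 then a x else b x))"
  proof (rule trk_if[OF assms(1)])
    show "trk f (\<lambda>(w::unit) x. True \<and> g x = 0) (\<lambda>w x u. u = (if g x = 0 then a x else b x))"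
      by (rule trk_ct[OF assms(2)]) simp
    show "trk f (\<lambda>(w::unit) x. True \<and> g x \<noteq> 0) (\<lambda>w x u. u = (if g x = 0 then a x else b x))"
      by (rule trk_ct[OF assms(3)]) simp
  qed
  then show ?thesis by (simp add: ct_trk)
qed

abbreviation dec :: "fm \<Rightarrow> nat \<Rightarrow> nat" where "dec A c \<equiv> if tr A (env c) then 0 else 1"

lemma ct_dec_qfree: "wf_fm A \<Longrightarrow> qfree A \<Longrightarrow> ct f (dec A)"
proof (induction A)
  case (Eq s t)
  have "pd (\<lambda>u. p1 u = p2 u)" by (intro pd_eq pu_intros)
  from ct_pd[OF this ct_pair[OF ct_tval ct_tval]] show ?case using Eq by simp
next
  case (And A B)
  then have AB: "ct f (dec A)" "ct f (dec B)" by simp_all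
  have "pd (\<lambda>u. p1 u = 0 \<and> p2 u = 0)" by (intro pd_intros pu_intros)
  from ct_pd[OF this ct_pair[OF AB]] show ?case by (simp cong: if_cong)
next
  case (Or A B)
  then have AB: "ct f (dec A)" "ct f (dec B)" by simp_all
  have "pd (\<lambda>u. p1 u = 0 \<or> p2 u = 0)" by (intro pd_intros pu_intros)
  from ct_pd[OF this ct_pair[OF AB]] show ?case by (simp cong: if_cong)
next
  case (Imp A B)
  then have AB: "ct f (dec A)" "ct f (dec B)" by simp_all
  have "pd (\<lambda>u. p1 u = 0 \<longrightarrow> p2 u = 0)"
    unfolding imp_conv_disj by (intro pd_intros pu_intros)
  from ct_pd[OF this ct_pair[OF AB]] show ?case by (simp cong: if_cong)
qed simp_all

text \<open>For fixed \<open>c\<close>, the question whether some \<open>g (pair x c)\<close> is 0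
  is a single query about the closure that stores \<open>c\<close>. The closure is a program for the
  lower oracle, yet its code can be built with any oracle.\<close>

lemma ct_jump:
  assumes "ct (jump m) g" "\<And>c. g c = 0 \<or> g c = 1"
  shows "ct (jump (Suc m)) (\<lambda>c. if \<exists>x. g (pair x c) = 0 then 0 else 1)"
proof -
  have "trk (jump m) (\<lambda>(w::unit) x. True) (\<lambda>w y b. b = g (pair (p2 y) (p1 y)))"
    by (rule trk_ct[OF ct_o[OF assms(1), of "\<lambda>y. pair (p2 y) (p1 y)"]]) (intro ct_intros, simp)
  then obtain e where e: "\<And>y. ev (jump m) e y (g (pair (p2 y) (p1 y)))"
    unfolding trk_def by blast
  let ?e = "cC (cP (cC (cC cF cS) cS) cS) e"
  have clo: "ev (jump m) (clo ?e c) x (g (pair x c))" for c x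
  proof (rule ev.closure, rule ev.comp[OF ev.pairing])
    let ?y = "pair (clo ?e c) x"
    have "ev (jump m) (cC (cC cF cS) cS) ?y (p2 (p2 (p1 ?y)))" by (intro ev_snd ev.first)
    then show "ev (jump m) (cC (cC cF cS) cS) ?y c" by simp
    show "ev (jump m) cS ?y x" using ev.second[of "jump m" 0 0 ?y] by simp
    show "ev (jump m) e (pair c x) (g (pair x c))" using e[of "pair c x"] by simp
  qed
  have "jump (Suc m) (clo ?e c) = (if \<exists>x. g (pair x c) = 0 then 0 else 1)" for c
  proof -
    have "ev (jump m) (clo ?e c) x 0 \<longleftrightarrow> g (pair x c) = 0" for x
      using clo[of c x] ev_det by metis
    then show ?thesis by (simp add: jump.simps(2))
  qed
  moreover have "ct (jump (Suc m)) (\<lambda>c. jump (Suc m) (clo ?e c))"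
    by (intro ct_query) (auto simp: ct_def intro: ev.curry)
  ultimately show ?thesis by simp
qed

text \<open>Each quantifier costs one jump, so the induction lowers the oracle level together with
  the number of quantifiers.\<close>

lemma ct_dec: "k \<le> m \<Longrightarrow> A \<in> Sigma_fm k \<union> Pi_fm k \<Longrightarrow> ct (jump m) (dec A)"
proof (induction k arbitrary: m A)
  case 0
  then show ?case by (auto intro: ct_dec_qfree)
next
  case (Suc k)
  then obtain m' where m: "m = Suc m'" "k \<le> m'" by (cases m) auto
  from Suc.prems(2) consider B where "A = Ex B" "B \<in> Pi_fm k" | B where "A = All B" "B \<in> Sigma_fm k"
    by auto
  then show ?case
  proof cases
    case 1
    then have "ct (jump m') (dec B)" using Suc.IH m(2) by blast
    from ct_jump[OF this] show ?thesis by (simp add: 1(1) m(1) cong: if_cong)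
  next
    case 2
    then have B: "ct (jump m') (dec B)" using Suc.IH m(2) by blast
    \<comment> \<open>A universal formula is decided by asking for a counterexample, so the decision
      is complemented before and after the jump.\<close>
    have "pd (\<lambda>x. x \<noteq> 0)" by (intro pd_intros pu_intros)
    from ct_jump[OF ct_pd[OF this B]]
    have "ct (jump m) (\<lambda>c. if \<exists>n. \<not> tr B (case_nat n (env c)) then 0 else 1)"
      by (simp add: m(1) cong: if_cong)
    from ct_pd[OF \<open>pd (\<lambda>x. x \<noteq> 0)\<close> this] show ?thesis by (simp add: 2(1) cong: if_cong)
  qed
qed

text \<open>\<open>h\<close> finds a realizer from the environment alone, an actual one if the
  formula is true and otherwise at least a potential one; the premise
  \<open>w \<longrightarrow> tr A (env c)\<close> covers both. For such formulas realizability
  coincides with truth.\<close>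

definition canonical :: "(nat \<Rightarrow> nat) \<Rightarrow> bool \<Rightarrow> fm \<Rightarrow> (nat \<Rightarrow> nat) \<Rightarrow> bool" where
  "canonical f M A h \<longleftrightarrow> ct f h \<and> (\<forall>c x. rl f M A True (env c) x \<longrightarrow> tr A (env c)) \<and>
     (\<forall>c w. (w \<longrightarrow> tr A (env c)) \<longrightarrow> rl f M A w (env c) (h c))"

lemma canonical_ct: "canonical f M A h \<Longrightarrow> ct f h"
  and canonical_tr: "canonical f M A h \<Longrightarrow> rl f M A True (env c) x \<Longrightarrow> tr A (env c)"
  and canonical_rl: "canonical f M A h \<Longrightarrow> w \<longrightarrow> tr A (env c) \<Longrightarrow> rl f M A w (env c) (h c)"
  unfolding canonical_def by blast+

lemma ct_const_closure:
  assumes "ct f h"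
  obtains g where "ct f g" "\<And>x a. ev f (g x) a (h x)"
proof -
  have "trk f (\<lambda>(w::unit) x. True) (\<lambda>w y b. b = h (p1 y))"
    by (rule trk_ct[OF ct_o[OF assms ct_p1[OF ct_id]]]) simp
  then show ?thesis by (rule trk_curry) (use that in simp)
qed

lemma canonical_qfree: "wf_fm A \<Longrightarrow> qfree A \<Longrightarrow> \<exists>h. canonical f M A h"
proof (induction A)
  case (Eq s t)
  show ?case by (intro exI[of _ "\<lambda>_. 0"]) (simp add: canonical_def ct_const)
next
  case (And A B)
  then obtain h h' where "canonical f M A h" "canonical f M B h'" by auto
  then show ?case
    by (intro exI[of _ "\<lambda>c. pair (h c) (h' c)"]) (auto simp: canonical_def intro!: ct_pair)
next
  case (Or A B)
  then obtain h h' where h: "canonical f M A h" "canonical f M B h'" by auto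
  let ?h = "\<lambda>c. if dec A c = 0 then pair 0 (h c) else pair 1 (h' c)"
  have "canonical f M (Or A B) ?h"
    unfolding canonical_def
  proof (intro conjI allI impI)
    show "ct f ?h" using Or.prems h unfolding canonical_def
      by (intro ct_if ct_dec_qfree ct_pair ct_const) auto
  next
    fix c x assume "rl f M (Or A B) True (env c) x"
    then show "tr (Or A B) (env c)"
      using canonical_tr[OF h(1)] canonical_tr[OF h(2)] by (cases "p1 x = 0") auto
  next
    fix c w assume "w \<longrightarrow> tr (Or A B) (env c)"
    then show "rl f M (Or A B) w (env c) (?h c)"
      using canonical_rl[OF h(1), of w c] canonical_rl[OF h(2), of w c] by (cases "tr A (env c)") auto
  qed
  then show ?case by blast
next
  case (Imp A B)
  then obtain h h' where h: "canonical f M A h" "canonical f M B h'" by auto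
  \<comment> \<open>The realizer of the implication ignores its argument and returns the canonical
    realizer of the conclusion.\<close>
  obtain g where g: "ct f g" "\<And>x a. ev f (g x) a (h' x)"
    using ct_const_closure h(2) unfolding canonical_def by blast
  have "canonical f M (Imp A B) g"
    unfolding canonical_def
  proof (intro conjI allI impI)
    show "ct f g" by (rule g)
  next
    fix c x assume x: "rl f M (Imp A B) True (env c) x"
    have "tr B (env c)" if "tr A (env c)"
    proof -
      have "rl f M A True (env c) (h c)" using that by (intro canonical_rl[OF h(1)]) simp
      from rl_ImpD[OF x this] obtain b where "rl f M B True (env c) b" by auto
      then show ?thesis by (rule canonical_tr[OF h(2)])
    qed
    then show "tr (Imp A B) (env c)" by simp
  next
    fix c w assume w: "w \<longrightarrow> tr (Imp A B) (env c)"
    have "rl f M B v (env c) (h' c)" if "v \<longrightarrow> w" "rl f M A v (env c) a" for v a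
    proof -
      have "v \<longrightarrow> tr A (env c)" using that(2) canonical_tr[OF h(1), of c a] by auto
      then have "v \<longrightarrow> tr B (env c)" using that(1) w by auto
      then show ?thesis by (rule canonical_rl[OF h(2)])
    qed
    then show "rl f M (Imp A B) w (env c) (g c)"
      unfolding rl.simps using g(2) by blast
  qed
  then show ?case by blast
qed simp_all

text \<open>The closure waits for the instance and then computes its realizer, without deciding the
  universal formula. Canonical realizers thus reach \<open>Pi_fm (Suc m)\<close> over
  \<open>jump m\<close>, one level beyond decidability, and both separations rest on this.\<close>

lemma canonical_All:
  assumes "canonical f M A h"
  shows "\<exists>h. canonical f M (All A) h"
proof -
  have "trk f (\<lambda>(w::unit) x. True) (\<lambda>w y b. b = h (pair (p2 y) (p1 y)))"
    by (rule trk_ct[OF ct_o[of f h "\<lambda>y. pair (p2 y) (p1 y)"]])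
      (use assms in \<open>auto simp: canonical_def intro!: ct_intros\<close>)
  then obtain g where g: "ct f g" "\<And>c n. ev f (g c) n (h (pair n c))"
    by (rule trk_curry) auto
  have "canonical f M (All A) g"
    unfolding canonical_def
  proof (intro conjI allI impI)
    show "ct f g" by (rule g)
  next
    fix c x assume "rl f M (All A) True (env c) x"
    then show "tr (All A) (env c)"
      using canonical_tr[OF assms, of "pair _ c"] by auto
  next
    fix c w assume w: "w \<longrightarrow> tr (All A) (env c)"
    have "rl f M A w (env (pair n c)) (h (pair n c))" for n
    proof -
      have "w \<longrightarrow> tr A (env (pair n c))" using w by simp
      then show ?thesis by (rule canonical_rl[OF assms])
    qed
    then show "rl f M (All A) w (env c) (g c)" using g(2) by auto
  qed
  then show ?thesis by blast
qed

lemma rl_Ex_tr: "canonical f M A h \<Longrightarrow> rl f M (Ex A) True (env c) x \<Longrightarrow> tr A (env (pair (p1 x) c))"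
  by (rule canonical_tr) auto

lemma rl_Ex_canonical:
  "canonical f M A h \<Longrightarrow> w \<longrightarrow> tr A (env (pair n c)) \<Longrightarrow> rl f M (Ex A) w (env c) (pair n (h (pair n c)))"
  using canonical_rl[of f M A h w "pair n c"] by (simp only: rl.simps p1_pair p2_pair env_pair)

lemma trk_search:
  assumes "ct f (dec A)"
  shows "trk f (\<lambda>w c. \<exists>n. tr A (env (pair n c))) (\<lambda>w c n. tr A (env (pair n c)))"
proof -
  obtain g where g: "\<And>c. ev f g c (dec A c)" using assms unfolding ct_def by blast
  obtain s where s: "\<And>x n. ev f g (pair n x) 0 \<Longrightarrow>
      (\<And>m. m < n \<Longrightarrow> \<exists>r. ev f g (pair m x) (Suc r)) \<Longrightarrow> ev f s x n"
    using ev_search[of f g] by blast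
  have "\<exists>n. ev f s c n \<and> tr A (env (pair n c))" if "\<exists>n. tr A (env (pair n c))" for c
  proof -
    let ?n = "LEAST n. tr A (env (pair n c))"
    have n: "tr A (env (pair ?n c))" using that by (rule LeastI_ex)
    have "\<not> tr A (env (pair m c))" if "m < ?n" for m using that by (rule not_less_Least)
    then have "\<exists>r. ev f g (pair m c) (Suc r)" if "m < ?n" for m
      using that g[of "pair m c"] by (metis One_nat_def)
    then have "ev f s c ?n" using g[of "pair ?n c"] n by (intro s) auto
    then show ?thesis using n by blast
  qed
  then show ?thesis unfolding trk_def by blast
qed

text \<open>A search halts only if there is a witness, so the truth of \<open>Ex A\<close> is
  decided beforehand. If it is false the witness is 0, whose instance still has a potential
  realizer.\<close>

lemma canonical_Ex:
  assumes "canonical f M A h" "ct f (dec A)" "ct f (dec (Ex A))"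
  shows "\<exists>h. canonical f M (Ex A) h"
proof -
  have "trk f (\<lambda>(w::unit) c. True) (\<lambda>w c n. tr (Ex A) (env c) \<longrightarrow> tr A (env (pair n c)))"
  proof (rule trk_if[OF assms(3)])
    show "trk f (\<lambda>(w::unit) c. True \<and> dec (Ex A) c = 0)
        (\<lambda>w c n. tr (Ex A) (env c) \<longrightarrow> tr A (env (pair n c)))"
      by (rule trk_imp[OF trk_search[OF assms(2)]]) (auto split: if_splits)
    show "trk f (\<lambda>(w::unit) c. True \<and> dec (Ex A) c \<noteq> 0)
        (\<lambda>w c n. tr (Ex A) (env c) \<longrightarrow> tr A (env (pair n c)))"
      by (rule trk_ct[OF ct_const[of f 0]]) (auto split: if_splits)
  qed
  then obtain s where "\<forall>c. \<exists>n. ev f s c n \<and> (tr (Ex A) (env c) \<longrightarrow> tr A (env (pair n c)))"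
    unfolding trk_def by blast
  then obtain n where n: "\<And>c. ev f s c (n c)" "\<And>c. tr (Ex A) (env c) \<longrightarrow> tr A (env (pair (n c) c))"
    by metis
  have ctn: "ct f n" unfolding ct_def using n(1) by blast
  let ?h = "\<lambda>c. pair (n c) (h (pair (n c) c))"
  have "canonical f M (Ex A) ?h"
    unfolding canonical_def
  proof (intro conjI allI impI)
    show "ct f ?h"
      by (intro ct_pair ctn ct_o[OF canonical_ct[OF assms(1)]] ct_id)
  next
    fix c x assume "rl f M (Ex A) True (env c) x"
    from rl_Ex_tr[OF assms(1) this] show "tr (Ex A) (env c)" by auto
  next
    fix c w assume "w \<longrightarrow> tr (Ex A) (env c)"
    then show "rl f M (Ex A) w (env c) (?h c)"
      using n(2) by (intro rl_Ex_canonical[OF assms(1)]) blast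
  qed
  then show ?thesis by blast
qed

lemma canonical_hierarchy:
  "k \<le> m \<Longrightarrow> A \<in> Sigma_fm k \<union> Pi_fm k \<Longrightarrow> \<exists>h. canonical (jump m) M A h"
proof (induction k arbitrary: A)
  case 0
  then show ?case by (auto intro: canonical_qfree)
next
  case (Suc k)
  from Suc.prems(2) consider B where "A = Ex B" "B \<in> Pi_fm k" | B where "A = All B" "B \<in> Sigma_fm k"
    by auto
  then show ?case
  proof cases
    case 1
    then obtain h where "canonical (jump m) M B h" using Suc by fastforce
    then show ?thesis unfolding 1(1)
      by (rule canonical_Ex) (use 1 Suc.prems ct_dec[of k m B] ct_dec[of "Suc k" m A] in auto)
  next
    case 2
    then show ?thesis using Suc canonical_All by fastforce
  qed
qed

subsection \<open>The separations\<close>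

lemma derives_closure: "A \<in> T \<Longrightarrow> wf_fm A \<Longrightarrow> derives T \<Gamma> ((All ^^ k) A)"
  by (induction k arbitrary: \<Gamma>) (auto intro: derives.Axiom derives.AllI)

lemma wf_Falsum [simp]: "wf_fm Falsum" by (simp add: Falsum_def)

lemma wf_Neg [simp]: "wf_fm (Neg A) = wf_fm A" by (simp add: Neg_def)

lemma wf_Alls [simp]: "wf_fm ((All ^^ k) A) = wf_fm A" by (induction k) auto

lemma derives_nn_closure:
  assumes "A \<in> T" "wf_fm A"
  shows "derives T \<Gamma> (Neg (Neg (univ_closure A)))"
  unfolding Neg_def univ_closure_def using assms
  by (intro derives.ImpI) (auto intro!: derives.ImpE[OF derives.Assm derives_closure])

text \<open>If \<open>A\<close> had no actual realizer, a constant program would realize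
  \<open>Neg A\<close>: there is nothing to map in the actual world, and in the potential one
  absurdity holds.\<close>

lemma rl_Neg_Neg:
  assumes "rl f M (Neg (Neg A)) True \<rho> x"
  shows "\<exists>a. rl f M A True \<rho> a"
proof (rule ccontr)
  assume no: "\<not> (\<exists>a. rl f M A True \<rho> a)"
  have "rl f M (Neg A) True \<rho> (cK 0)"
    unfolding Neg_def rl.simps
  proof (intro allI impI)
    fix v a assume "rl f M A v \<rho> a"
    with no have "\<not> v" by auto
    then show "\<exists>b. ev f (cK 0) a b \<and> rl f M Falsum v \<rho> b"
      using ev_const by (auto simp: Falsum_def)
  qed
  then have "\<exists>b. rl f M Falsum True \<rho> b"
    using rl_ImpD[OF assms[unfolded Neg_def[of "Neg A"]]] by auto
  then show False by (simp add: Falsum_def)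
qed

text \<open>The number \<open>cK 0\<close> carries no information and is the same whether
  \<open>A\<close> is true or false. An alleged realizer of double negation elimination can
  therefore be run on it before the truth of \<open>A\<close> is known.\<close>

lemma rl_Neg_Neg_const:
  assumes "w \<longrightarrow> (\<exists>a. rl f M A True \<rho> a)"
  shows "rl f M (Neg (Neg A)) w \<rho> (cK 0)"
  unfolding Neg_def rl.simps
proof (intro allI impI)
  fix v x
  assume v: "(v \<longrightarrow> w) \<and> (v \<or> M)" and x: "\<forall>u. (u \<longrightarrow> v) \<and> (u \<or> M) \<longrightarrow>
    (\<forall>a. rl f M A u \<rho> a \<longrightarrow> (\<exists>b. ev f x a b \<and> rl f M Falsum u \<rho> b))"
  have "\<not> v"
  proof
    assume v1: v
    then obtain a where "rl f M A True \<rho> a" using v assms by blast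
    then show False using x v1 by (auto simp: Falsum_def)
  qed
  then show "\<exists>b. ev f (cK 0) x b \<and> rl f M Falsum v \<rho> b"
    using ev_const by (auto simp: Falsum_def)
qed

text \<open>Realizing the doubly negated closure of \<open>B\<close> yields a realizer of the
  closure itself. As \<open>B\<close> has a single free variable, this is one program that realizes
  all instances, and such a program is refuted by the assumption \<open>no\<close>.\<close>

lemma not_entails:
  assumes P: "\<And>A. A \<in> P \<Longrightarrow> wf_fm A \<and> sound f M [] A"
    and B: "B \<in> Q" "fv_bound B = Suc 0"
    and no: "\<And>a. (\<And>n. \<exists>b. ev f a n b \<and> rl f M B True (env (pair n 0)) b) \<Longrightarrow> False"
  shows "\<not> entails (nn_closure P) (nn_closure Q)"
proof
  assume "entails (nn_closure P) (nn_closure Q)"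
  moreover have "Neg (Neg (univ_closure B)) \<in> nn_closure Q" using B by (auto simp: nn_closure_def)
  ultimately have d: "derives (HA \<union> nn_closure P) [] (Neg (Neg (univ_closure B)))"
    by (auto simp: entails_def)
  have "sound f M [] C" if C: "C \<in> HA \<union> nn_closure P" for C
  proof (cases "C \<in> HA")
    case True
    then show ?thesis by (rule sound_HA)
  next
    case False
    then obtain A where A: "A \<in> P" "C = Neg (Neg (univ_closure A))"
      using C by (auto simp: nn_closure_def)
    have "derives {A} [] C" unfolding A(2) using P[OF A(1)] by (intro derives_nn_closure) auto
    then show ?thesis by (rule soundness) (use P[OF A(1)] in auto)
  qed
  from soundness[OF d this] obtain e where "\<forall>w x. (w \<or> M) \<and> hyp f M [] w (env (p1 x)) (p2 x) \<longrightarrow>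
      (\<exists>b. ev f e x b \<and> rl f M (Neg (Neg (univ_closure B))) w (env (p1 x)) b)"
    unfolding sound_def trk_def ..
  from this[rule_format, of True "pair 0 0"] obtain b where
    "rl f M (Neg (Neg (univ_closure B))) True (env 0) b" by auto
  from rl_Neg_Neg[OF this] obtain a where "rl f M (All B) True (env 0) a"
    by (auto simp: univ_closure_def B)
  then show False by (intro no[of a]) simp
qed

section \<open>Separation by Kleene realizability\<close>

lemma Sigma_Pi_wf: "A \<in> Sigma_fm k \<Longrightarrow> wf_fm A" "A \<in> Pi_fm k \<Longrightarrow> wf_fm A"
  by (induction k arbitrary: A) auto

lemma sound_Sigma_DNE:
  assumes "A \<in> Sigma_fm (Suc m)"
  shows "sound (jump m) False [] (Imp (Neg (Neg A)) A)"
proof (rule sound_ImpI)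
  let ?f = "jump m"
  obtain B where B: "A = Ex B" "B \<in> Pi_fm m" using assms by auto
  obtain h where h: "canonical ?f False B h" using canonical_hierarchy[of m m B] B(2) by auto
  have dec: "ct ?f (dec B)" using ct_dec[of m m B] B(2) by auto
  let ?P = "\<lambda>w x. (w \<or> False) \<and> hyp ?f False [Neg (Neg A)] w (env (p1 x)) (p2 x)"
  \<comment> \<open>Only the world \<open>True\<close> is considered here, and there
    \<open>rl_Neg_Neg\<close> guarantees that a witness exists. The search terminates although its
    input gives no hint of the witness.\<close>
  have "trk ?f ?P (\<lambda>w x n. tr B (env (pair n (p1 x))))"
  proof (rule trk_pre[OF trk_search[OF dec] ct_p1[OF ct_id]])
    fix w x assume "?P w x"
    then have "rl ?f False (Neg (Neg A)) True (env (p1 x)) (p1 (p2 x))" by auto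
    from rl_Neg_Neg[OF this] obtain a where "rl ?f False A True (env (p1 x)) a" ..
    from rl_Ex_tr[OF h this[unfolded B(1)]] show "\<exists>n. tr B (env (pair n (p1 x)))" by (rule exI)
  qed
  then show "sound ?f False [Neg (Neg A)] A"
    unfolding sound_def B(1)
  proof (rule trk_bind)
    let ?h = "\<lambda>y. pair (p2 y) (h (pair (p2 y) (p1 (p1 y))))"
    have "ct ?f ?h" by (intro ct_pair ct_o[OF canonical_ct[OF h]] ct_intros)
    then show "trk ?f (\<lambda>w y. ((w \<or> False) \<and> hyp ?f False [Neg (Neg (Ex B))] w (env (p1 (p1 y))) (p2 (p1 y))) \<and>
        tr B (env (pair (p2 y) (p1 (p1 y))))) (\<lambda>w y. rl ?f False (Ex B) w (env (p1 (p1 y))))"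
      by (rule trk_ct) (rule rl_Ex_canonical[OF h], simp)
  qed
qed

lemma Sigma_DNE_not_Pi_LEM: "\<not> entails (nn_closure (Sigma_DNE (Suc m))) (nn_closure (Pi_LEM (Suc m)))"
proof -
  let ?f = "jump m"
  obtain A where A: "A \<in> Pi_fm (Suc m)" "\<And>\<rho>. tr A \<rho> \<longleftrightarrow> \<not> ev ?f (\<rho> 0) (\<rho> 0) 0" "fv_bound A = Suc 0"
    using hierarchy_fm(2)[OF _ _ PiP_not[OF SigP_diagonal[of m]], of "Var 0" 0]
    by (auto simp del: Pi_fm.simps)
  obtain B where B: "A = All B" "B \<in> Sigma_fm m" using A(1) by auto
  obtain h where h: "canonical ?f False A h"
    using canonical_hierarchy[of m m B] B canonical_All by (metis UnI1 le_refl)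
  show ?thesis
  proof (rule not_entails)
    fix C assume "C \<in> Sigma_DNE (Suc m)"
    then show "wf_fm C \<and> sound ?f False [] C"
      by (auto simp: Sigma_DNE_def Sigma_Pi_wf intro: sound_Sigma_DNE simp del: Sigma_fm.simps)
  next
    show "Or A (Neg A) \<in> Pi_LEM (Suc m)" using A(1) by (auto simp: Pi_LEM_def)
    show "fv_bound (Or A (Neg A)) = Suc 0" by (simp add: A(3) Neg_def Falsum_def)
  next
    fix a
    assume a: "\<And>n. \<exists>b. ev ?f a n b \<and> rl ?f False (Or A (Neg A)) True (env (pair n 0)) b"
    \<comment> \<open>The tag 0 marks the left disjunct, which says that the computation does not
      output 0; \<open>i\<close> turns the tag into a decision of the diagonal problem.\<close>
    obtain i where i: "\<And>x. ev ?f i x (if x = 0 then 1 else 0)"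
      using pu_ct[OF pu_if0[OF pu_id]] unfolding ct_def by blast
    show False
    proof (rule diagonal_undecidable)
      fix n
      obtain b where b: "ev ?f a n b" "rl ?f False (Or A (Neg A)) True (env (pair n 0)) b"
        using a by blast
      have "ev ?f (cC (cC a cF) i) n (if p1 b = 0 then 1 else 0)"
        by (rule ev.comp[OF ev_fst[OF b(1)] i])
      moreover have "p1 b = 0 \<longleftrightarrow> \<not> ev ?f n n 0"
      proof
        assume "p1 b = 0"
        then have "tr A (env (pair n 0))" using b(2) by (intro canonical_tr[OF h]) auto
        then show "\<not> ev ?f n n 0" using A(2) by simp
      next
        assume "\<not> ev ?f n n 0"
        then have "tr A (env (pair n 0))" using A(2) by simp
        then have "rl ?f False A True (env (pair n 0)) (h (pair n 0))"
          by (intro canonical_rl[OF h]) simp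
        then have "\<not> rl ?f False (Neg A) True (env (pair n 0)) (p2 b)"
          unfolding Neg_def by (auto simp: Falsum_def)
        then show "p1 b = 0" using b(2) by auto
      qed
      ultimately show "\<exists>b. ev ?f (cC (cC a cF) i) n b \<and> (b = 0 \<longleftrightarrow> ev ?f n n 0)" by auto
    qed
  qed
qed

section \<open>Separation by modified realizability\<close>

lemma sound_Delta_LEM:
  assumes "A \<in> Pi_fm (Suc m)" "B \<in> Sigma_fm (Suc m)"
  shows "sound (jump m) True [] (Imp (Iff A B) (Or B (Neg B)))"
proof (rule sound_ImpI)
  let ?f = "jump m"
  obtain A0 where A0: "A = All A0" "A0 \<in> Sigma_fm m" using assms by auto
  obtain h where h: "canonical ?f True A h"
    using canonical_hierarchy[of m m A0] A0 canonical_All by (metis UnI1 le_refl)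
  obtain B0 where B0: "B = Ex B0" "B0 \<in> Pi_fm m" using assms by auto
  obtain k where k: "canonical ?f True B0 k" using canonical_hierarchy[of m m B0] B0(2) by auto
  have dec: "ct ?f (dec B0)" using ct_dec[of m m B0] B0(2) by auto
  have cth: "ct ?f h" and ctk: "ct ?f k" using h k unfolding canonical_def by auto
  let ?P = "\<lambda>w x. (w \<or> True) \<and> hyp ?f True [Iff A B] w (env (p1 x)) (p2 x)"
  \<comment> \<open>The candidate is the value of the realizer of \<open>Imp A B\<close> on the
    canonical realizer of \<open>A\<close>. It is promised to be genuine only if \<open>A\<close> is
    true in the actual world; afterwards its witness is checked by \<open>dec B0\<close>.\<close>
  let ?R = "\<lambda>w x v. w \<and> tr A (env (p1 x)) \<longrightarrow> rl ?f True B True (env (p1 x)) v"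
  have run: "trk ?f ?P ?R"
  proof (rule trk_app)
    show "ct ?f (\<lambda>x. p1 (p1 (p2 x)))" "ct ?f (\<lambda>x. h (p1 x))"
      by (intro ct_intros ct_o[OF cth])+
    fix w x assume "?P w x"
    then have imp: "rl ?f True (Imp A B) w (env (p1 x)) (p1 (p1 (p2 x)))"
      by (simp add: Iff_def del: rl.simps(4))
    have can: "rl ?f True A v (env (p1 x)) (h (p1 x))" if "v \<longrightarrow> tr A (env (p1 x))" for v
      using that by (rule canonical_rl[OF h])
    \<comment> \<open>If \<open>A\<close> is false, the argument is only a potential realizer. The
      call still halts, because with \<open>M\<close> an implication also has to act in the world
      \<open>False\<close>.\<close>
    show "\<exists>b. ev ?f (p1 (p1 (p2 x))) (h (p1 x)) b \<and> ?R w x b"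
    proof (cases "w \<and> tr A (env (p1 x))")
      case True
      then show ?thesis using rl_ImpD[OF imp can[of True]] by blast
    next
      case False
      then show ?thesis using rl_ImpD[OF imp can[of False]] by blast
    qed
  qed
  have "trk ?f (\<lambda>w y. ?P w (p1 y) \<and> ?R w (p1 y) (p2 y)) (\<lambda>w y. rl ?f True (Or B (Neg B)) w (env (p1 (p1 y))))"
  proof (rule trk_if)
    show "ct ?f (\<lambda>y. dec B0 (pair (p1 (p2 y)) (p1 (p1 y))))"
      by (rule ct_o[OF dec]) (intro ct_intros)
    let ?h = "\<lambda>y. pair 0 (pair (p1 (p2 y)) (k (pair (p1 (p2 y)) (p1 (p1 y)))))"
    show "trk ?f (\<lambda>w y. (?P w (p1 y) \<and> ?R w (p1 y) (p2 y)) \<and> dec B0 (pair (p1 (p2 y)) (p1 (p1 y))) = 0)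
        (\<lambda>w y. rl ?f True (Or B (Neg B)) w (env (p1 (p1 y))))"
    proof (rule trk_ct)
      show "ct ?f ?h" by (intro ct_intros ct_o[OF ctk])
      fix w y
      assume "(?P w (p1 y) \<and> ?R w (p1 y) (p2 y)) \<and> dec B0 (pair (p1 (p2 y)) (p1 (p1 y))) = 0"
      then have "tr B0 (env (pair (p1 (p2 y)) (p1 (p1 y))))" by (simp split: if_splits)
      then have "rl ?f True B w (env (p1 (p1 y))) (p2 (?h y))"
        unfolding B0(1) p2_pair by (intro rl_Ex_canonical[OF k]) simp
      then show "rl ?f True (Or B (Neg B)) w (env (p1 (p1 y))) (?h y)" by simp
    qed
    show "trk ?f (\<lambda>w y. (?P w (p1 y) \<and> ?R w (p1 y) (p2 y)) \<and> dec B0 (pair (p1 (p2 y)) (p1 (p1 y))) \<noteq> 0)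
        (\<lambda>w y. rl ?f True (Or B (Neg B)) w (env (p1 (p1 y))))"
    proof (rule trk_ct[OF ct_const])
      fix w y
      assume y: "(?P w (p1 y) \<and> ?R w (p1 y) (p2 y)) \<and> dec B0 (pair (p1 (p2 y)) (p1 (p1 y))) \<noteq> 0"
      then have nB0: "\<not> tr B0 (env (pair (p1 (p2 y)) (p1 (p1 y))))" by (simp split: if_splits)
      have "rl ?f True (Neg B) w (env (p1 (p1 y))) (cK 0)"
        unfolding Neg_def rl.simps(4)
      proof (intro allI impI)
        fix v b assume v: "(v \<longrightarrow> w) \<and> (v \<or> True)" and b: "rl ?f True B v (env (p1 (p1 y))) b"
        \<comment> \<open>An actual realizer of \<open>B\<close> would make \<open>A\<close> true by
          the converse implication, hence the candidate genuine, against the failed check.\<close>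
        have "\<not> v"
        proof
          assume v1: v
          have "rl ?f True (Imp B A) w (env (p1 (p1 y))) (p2 (p1 (p2 (p1 y))))"
            using y by (simp add: Iff_def del: rl.simps(4))
          from rl_ImpD[OF this b] obtain a where "rl ?f True A True (env (p1 (p1 y))) a"
            using v v1 by auto
          then have "tr A (env (p1 (p1 y)))" by (rule canonical_tr[OF h])
          then have "rl ?f True B True (env (p1 (p1 y))) (p2 y)" using y v v1 by blast
          from rl_Ex_tr[OF k this[unfolded B0(1)]] nB0 show False by blast
        qed
        then show "\<exists>c. ev ?f (cK 0) b c \<and> rl ?f True Falsum v (env (p1 (p1 y))) c"
          using ev_const by (auto simp: Falsum_def)
      qed
      then show "rl ?f True (Or B (Neg B)) w (env (p1 (p1 y))) (pair 1 (cK 0))" by simp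
    qed
  qed
  with run show "sound ?f True [Iff A B] (Or B (Neg B))"
    unfolding sound_def by (rule trk_bind)
qed

lemma Delta_LEM_not_Sigma_DNE:
  "\<not> entails (nn_closure (Delta_LEM (Suc m))) (nn_closure (Sigma_DNE (Suc m)))"
proof -
  let ?f = "jump m"
  obtain A where A: "A \<in> Sigma_fm (Suc m)" "\<And>\<rho>. tr A \<rho> \<longleftrightarrow> ev ?f (\<rho> 0) (\<rho> 0) 0" "fv_bound A = Suc 0"
    using hierarchy_fm(1)[OF _ _ SigP_diagonal[of m], of "Var 0" 0]
    by (auto simp del: Sigma_fm.simps)
  obtain B where B: "A = Ex B" "B \<in> Pi_fm m" using A(1) by auto
  obtain h where h: "canonical ?f True B h" using canonical_hierarchy[of m m B] B(2) by auto
  obtain g where g: "\<And>c. ev ?f g c (dec B c)"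
    using ct_dec[of m m B] B(2) unfolding ct_def by blast
  show ?thesis
  proof (rule not_entails)
    fix C assume "C \<in> Delta_LEM (Suc m)"
    then obtain A B where C: "C = Imp (Iff A B) (Or B (Neg B))"
        "A \<in> Pi_fm (Suc m)" "B \<in> Sigma_fm (Suc m)"
      unfolding Delta_LEM_def by blast
    have "wf_fm A" "wf_fm B" using Sigma_Pi_wf C by blast+
    then show "wf_fm C \<and> sound ?f True [] C"
      using sound_Delta_LEM[OF C(2,3)] by (simp add: C(1)) (simp add: Iff_def)
  next
    show "Imp (Neg (Neg A)) A \<in> Sigma_DNE (Suc m)" using A(1) by (auto simp: Sigma_DNE_def)
    show "fv_bound (Imp (Neg (Neg A)) A) = Suc 0" by (simp add: A(3) Neg_def Falsum_def)
  next
    fix a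
    assume a: "\<And>n. \<exists>b. ev ?f a n b \<and> rl ?f True (Imp (Neg (Neg A)) A) True (env (pair n 0)) b"
    \<comment> \<open>\<open>?v\<close> feeds \<open>cK 0\<close>, a realizer of the double
      negation, to the alleged realizer for \<open>n\<close> and obtains a candidate.
      \<open>?e\<close> then tests the witness in the candidate by \<open>g\<close>; the code of the
      environment is \<open>pair n 0\<close>.\<close>
    let ?v = "cC (cP a (cK (cK 0))) cA"
    let ?e = "cC (cP (cC ?v cF) (cP cI (cK 0))) g"
    show False
    proof (rule diagonal_undecidable)
      fix n
      let ?c = "pair n 0"
      obtain u where u: "ev ?f a n u" "rl ?f True (Imp (Neg (Neg A)) A) True (env ?c) u"
        using a by blast
      have NN: "rl ?f True (Neg (Neg A)) w (env ?c) (cK 0)" if w: "w \<longrightarrow> tr A (env ?c)" for w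
      proof (rule rl_Neg_Neg_const, rule impI)
        assume w
        then obtain x where "tr B (env (pair x ?c))" using w by (auto simp: B(1))
        then have "rl ?f True A True (env ?c) (pair x (h (pair x ?c)))"
          unfolding B(1) by (intro rl_Ex_canonical[OF h] impI)
        then show "\<exists>a. rl ?f True A True (env ?c) a" by (rule exI)
      qed
      obtain v where v: "ev ?f u (cK 0) v" "tr A (env ?c) \<longrightarrow> rl ?f True A True (env ?c) v"
      proof (cases "tr A (env ?c)")
        case True
        then show ?thesis using that rl_ImpD[OF u(2) NN[of True]] by blast
      next
        case False
        then show ?thesis using that rl_ImpD[OF u(2) NN[of False]] by blast
      qed
      have "ev ?f ?v n v" by (rule ev_app[OF u(1) ev_const v(1)])
      from ev.comp[OF ev.pairing[OF ev_fst[OF this] ev.pairing[OF ev_ident ev_const]] g]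
      have "ev ?f ?e n (dec B (pair (p1 v) ?c))" .
      moreover have "tr B (env (pair (p1 v) ?c)) \<longleftrightarrow> tr A (env ?c)"
        using v(2) rl_Ex_tr[OF h, of ?c v] by (auto simp: B(1))
      moreover have "tr A (env ?c) \<longleftrightarrow> ev ?f n n 0" using A(2) by simp
      ultimately show "\<exists>b. ev ?f ?e n b \<and> (b = 0 \<longleftrightarrow> ev ?f n n 0)" by auto
    qed
  qed
qed

subsection \<open>Substitution\<close>

lemma subst_tm_Var [simp]: "subst_tm Var t = t"
  by (induction t) (simp_all add: map_idI)

lemma up_Var [simp]: "up Var = Var"
  by (rule ext) (simp add: up_def split: nat.split)

lemma subst_Var [simp]: "subst Var A = A"
  by (induction A) simp_all

lemma subst_tm_subst_tm: "subst_tm \<sigma> (subst_tm \<tau> t) = subst_tm (\<lambda>i. subst_tm \<sigma> (\<tau> i)) t"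
  by (induction t) simp_all

lemma up_up: "(\<lambda>i. subst_tm (up \<sigma>) (up \<tau> i)) = up (\<lambda>i. subst_tm \<sigma> (\<tau> i))"
  by (rule ext) (simp add: up_def subst_tm_subst_tm split: nat.split)

lemma subst_subst: "subst \<sigma> (subst \<tau> A) = subst (\<lambda>i. subst_tm \<sigma> (\<tau> i)) A"
  by (induction A arbitrary: \<sigma> \<tau>) (simp_all add: subst_tm_subst_tm up_up)

lemma wf_subst_tm: "wf_tm t \<Longrightarrow> (\<And>i. wf_tm (\<sigma> i)) \<Longrightarrow> wf_tm (subst_tm \<sigma> t)"
  by (induction t) auto

lemma wf_up: "(\<And>i. wf_tm (\<sigma> i)) \<Longrightarrow> wf_tm (up \<sigma> i)"
  by (simp add: up_def wf_subst_tm split: nat.split)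

lemma wf_subst: "wf_fm A \<Longrightarrow> (\<And>i. wf_tm (\<sigma> i)) \<Longrightarrow> wf_fm (subst \<sigma> A)"
  by (induction A arbitrary: \<sigma>) (simp_all add: wf_subst_tm wf_up)

lemma wf_shift [simp]: "wf_fm A \<Longrightarrow> wf_fm (shift A)"
  unfolding shift_def by (rule wf_subst) simp_all

lemma wf_inst: "wf_fm A \<Longrightarrow> wf_tm t \<Longrightarrow> wf_fm (inst t A)"
  unfolding inst_def by (rule wf_subst) (simp_all split: nat.split)

lemma qfree_subst [simp]: "qfree (subst \<sigma> A) = qfree A"
  by (induction A arbitrary: \<sigma>) simp_all

lemma qfree_shift [simp]: "qfree (shift A) = qfree A"
  by (simp add: shift_def)

lemma subst_hierarchy:
  "A \<in> Sigma_fm k \<Longrightarrow> (\<And>i. wf_tm (\<sigma> i)) \<Longrightarrow> subst \<sigma> A \<in> Sigma_fm k"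
  "A \<in> Pi_fm k \<Longrightarrow> (\<And>i. wf_tm (\<sigma> i)) \<Longrightarrow> subst \<sigma> A \<in> Pi_fm k"
proof (induction k arbitrary: A \<sigma>)
  case 0
  {
    case 1
    then show ?case by (simp add: wf_subst)
  next
    case 2
    then show ?case by (simp add: wf_subst)
  }
next
  case (Suc k)
  {
    case 1
    then show ?case using Suc(2) wf_up by fastforce
  next
    case 2
    then show ?case using Suc(1) wf_up by fastforce
  }
qed

lemma inst_shift [simp]: "inst t (shift A) = A"
  by (simp add: inst_def shift_def subst_subst)

lemma inst_up: "inst t (subst (up \<sigma>) A) = subst (case_nat t \<sigma>) A"
proof -
  have "(\<lambda>i. subst_tm (case_nat t Var) (up \<sigma> i)) = case_nat t \<sigma>"
    by (rule ext) (simp add: up_def subst_tm_subst_tm split: nat.split)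
  then show ?thesis by (simp add: inst_def subst_subst)
qed

text \<open>Under \<open>AllI\<close> and \<open>ExE\<close> an assumed quantified formula appears
  shifted. Instantiated with the new variable, its body comes back unchanged.\<close>

lemma inst_Var0: "inst (Var 0) (subst (up (\<lambda>i. Var (Suc i))) A) = A"
proof -
  have "case_nat (Var 0) (\<lambda>i. Var (Suc i)) = Var"
    by (rule ext) (simp split: nat.split)
  then show ?thesis by (simp add: inst_up)
qed

lemma shift_simps [simp]:
  "shift (And A B) = And (shift A) (shift B)" "shift (Or A B) = Or (shift A) (shift B)"
  "shift (Imp A B) = Imp (shift A) (shift B)"
  "shift Falsum = Falsum" "shift (Neg A) = Neg (shift A)" "shift (Iff A B) = Iff (shift A) (shift B)"
  by (simp_all add: shift_def Falsum_def Neg_def Iff_def)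

lemma shift_Q:
  "shift (All A) = All (subst (up (\<lambda>i. Var (Suc i))) A)"
  "shift (Ex A) = Ex (subst (up (\<lambda>i. Var (Suc i))) A)"
  by (simp_all add: shift_def)

lemma subst_Neg [simp]: "subst \<sigma> (Neg A) = Neg (subst \<sigma> A)"
  by (simp add: Neg_def Falsum_def)

lemma fv_bound_App: "t \<in> set ts \<Longrightarrow> fv_bound_tm t \<le> fv_bound_tm (App p ts)"
  by (induction ts) auto

lemma subst_tm_cong: "(\<And>i. i < fv_bound_tm t \<Longrightarrow> \<sigma> i = \<tau> i) \<Longrightarrow> subst_tm \<sigma> t = subst_tm \<tau> t"
proof (induction t)
  case (App p ts)
  have "subst_tm \<sigma> t = subst_tm \<tau> t" if "t \<in> set ts" for t
    using that fv_bound_App[OF that, of p] by (intro App.IH App.prems) auto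
  then show ?case by simp
qed simp

lemma subst_cong: "(\<And>i. i < fv_bound A \<Longrightarrow> \<sigma> i = \<tau> i) \<Longrightarrow> subst \<sigma> A = subst \<tau> A"
proof (induction A arbitrary: \<sigma> \<tau>)
  case (All A)
  have "up \<sigma> i = up \<tau> i" if "i < fv_bound A" for i
    using that All.prems by (cases i) (simp_all add: up_def)
  then have "subst (up \<sigma>) A = subst (up \<tau>) A" by (rule All.IH)
  then show ?case by simp
next
  case (Ex A)
  have "up \<sigma> i = up \<tau> i" if "i < fv_bound A" for i
    using that Ex.prems by (cases i) (simp_all add: up_def)
  then have "subst (up \<sigma>) A = subst (up \<tau>) A" by (rule Ex.IH)
  then show ?case by simp
next
  case (Eq s t)
  have "subst_tm \<sigma> s = subst_tm \<tau> s" "subst_tm \<sigma> t = subst_tm \<tau> t"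
    by (rule subst_tm_cong, rule Eq, simp)+
  then show ?case by simp
next
  case (And A B)
  have "subst \<sigma> A = subst \<tau> A" "subst \<sigma> B = subst \<tau> B"
    by (rule And.IH, rule And.prems, simp)+
  then show ?case by simp
next
  case (Or A B)
  have "subst \<sigma> A = subst \<tau> A" "subst \<sigma> B = subst \<tau> B"
    by (rule Or.IH, rule Or.prems, simp)+
  then show ?case by simp
next
  case (Imp A B)
  have "subst \<sigma> A = subst \<tau> A" "subst \<sigma> B = subst \<tau> B"
    by (rule Imp.IH, rule Imp.prems, simp)+
  then show ?case by simp
qed

lemma fv_bound_Alls: "fv_bound ((All ^^ k) A) = fv_bound A - k"
  by (induction k) auto

lemma subst_univ_closure: "subst \<sigma> (univ_closure A) = univ_closure A"
proof -
  have "subst \<sigma> (univ_closure A) = subst Var (univ_closure A)"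
    by (rule subst_cong) (simp add: univ_closure_def fv_bound_Alls)
  then show ?thesis by simp
qed

lemma shift_univ_closure: "shift (univ_closure A) = univ_closure A"
  by (simp add: shift_def subst_univ_closure)

subsection \<open>Structural rules\<close>

lemma derives_wf: "derives T \<Gamma> A \<Longrightarrow> wf_fm A"
  by (induction rule: derives.induct) (auto intro: wf_inst)

lemma derives_weaken: "derives T \<Gamma> A \<Longrightarrow> set \<Gamma> \<subseteq> set \<Gamma>' \<Longrightarrow> derives T \<Gamma>' A"
proof (induction arbitrary: \<Gamma>' rule: derives.induct)
  case (OrE \<Gamma> A B C)
  have "derives T (A # \<Gamma>') C" by (rule OrE.IH(2)) (use OrE.prems in auto)
  moreover have "derives T (B # \<Gamma>') C" by (rule OrE.IH(3)) (use OrE.prems in auto)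
  ultimately show ?case by (rule derives.OrE[OF OrE.IH(1)[OF OrE.prems]])
next
  case (ImpI A \<Gamma> B)
  have "derives T (A # \<Gamma>') B" by (rule ImpI.IH) (use ImpI.prems in auto)
  then show ?case using ImpI.hyps by (intro derives.ImpI)
next
  case (AllI \<Gamma> A)
  have "derives T (map shift \<Gamma>') A" by (rule AllI.IH) (use AllI.prems in auto)
  then show ?case by (rule derives.AllI)
next
  case (ExE \<Gamma> A B)
  have "derives T (A # map shift \<Gamma>') (shift B)" by (rule ExE.IH(2)) (use ExE.prems in auto)
  then show ?case by (rule derives.ExE[OF ExE.IH(1)[OF ExE.prems] _ ExE.hyps(3)])
next
  case (Axiom A \<Gamma>)
  show ?case using Axiom by (intro derives.Axiom)
next
  case (Assm A \<Gamma>)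
  show ?case using Assm by (intro derives.Assm) auto
next
  case (FalsumE \<Gamma> A)
  show ?case by (rule derives.FalsumE[OF FalsumE.IH[OF FalsumE.prems] FalsumE.hyps(2)])
next
  case (AndI \<Gamma> A B)
  show ?case by (rule derives.AndI[OF AndI.IH[OF AndI.prems]])
next
  case (AndE1 \<Gamma> A B)
  show ?case by (rule derives.AndE1[OF AndE1.IH[OF AndE1.prems]])
next
  case (AndE2 \<Gamma> A B)
  show ?case by (rule derives.AndE2[OF AndE2.IH[OF AndE2.prems]])
next
  case (OrI1 \<Gamma> A B)
  show ?case by (rule derives.OrI1[OF OrI1.IH[OF OrI1.prems] OrI1.hyps(2)])
next
  case (OrI2 \<Gamma> B A)
  show ?case by (rule derives.OrI2[OF OrI2.IH[OF OrI2.prems] OrI2.hyps(2)])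
next
  case (ImpE \<Gamma> A B)
  show ?case by (rule derives.ImpE[OF ImpE.IH[OF ImpE.prems]])
next
  case (AllE \<Gamma> A t)
  show ?case by (rule derives.AllE[OF AllE.IH[OF AllE.prems] AllE.hyps(2)])
next
  case (ExI \<Gamma> t A)
  show ?case by (rule derives.ExI[OF ExI.IH[OF ExI.prems] ExI.hyps(2,3)])
next
  case (EqRefl t \<Gamma>)
  show ?case by (rule derives.EqRefl[OF EqRefl.hyps])
next
  case (EqSubst \<Gamma> s t A)
  show ?case by (rule derives.EqSubst[OF EqSubst.IH[OF EqSubst.prems] EqSubst.hyps(3)])
qed

lemma derives_Nil: "derives T [] A \<Longrightarrow> derives T \<Gamma> A"
  by (erule derives_weaken) simp

lemma derives_mono: "derives T \<Gamma> A \<Longrightarrow> T \<subseteq> T' \<Longrightarrow> derives T' \<Gamma> A"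
proof (induction rule: derives.induct)
  case (Axiom A \<Gamma>)
  then show ?case by (intro derives.Axiom) auto
qed (rule derives.intros; assumption)+

text \<open>The outermost of \<open>Suc k\<close> quantifiers binds index \<open>k\<close> of the
  matrix. Quantifiers are stripped from the outside, and \<open>\<sigma>\<close> collects the terms
  chosen so far.\<close>

lemma derives_Alls_inst:
  assumes "derives T \<Gamma> (subst \<sigma> ((All ^^ k) A))" "\<And>i. \<tau> (i + k) = \<sigma> i" "\<And>i. wf_tm (\<tau> i)"
  shows "derives T \<Gamma> (subst \<tau> A)"
  using assms
proof (induction k arbitrary: \<sigma>)
  case 0
  then have "\<tau> = \<sigma>" by auto
  then show ?case using 0 by simp
next
  case (Suc k)
  from Suc.prems(1) have "derives T \<Gamma> (All (subst (up \<sigma>) ((All ^^ k) A)))" by simp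
  from derives.AllE[OF this Suc.prems(3)[of k]]
  have "derives T \<Gamma> (subst (case_nat (\<tau> k) \<sigma>) ((All ^^ k) A))" by (simp add: inst_up)
  then show ?case
  proof (rule Suc.IH)
    show "\<tau> (i + k) = case_nat (\<tau> k) \<sigma> i" for i using Suc.prems(2) by (cases i) simp_all
  qed (rule Suc.prems)
qed

lemma derives_Alls: "derives T [] A \<Longrightarrow> derives T [] ((All ^^ k) A)"
  by (induction k) (auto intro: derives.AllI)

lemma derives_univ_closure_inst:
  assumes "derives T \<Gamma> (univ_closure A)" "\<And>i. wf_tm (\<tau> i)"
  shows "derives T \<Gamma> (subst \<tau> A)"
  by (rule derives_Alls_inst[of _ _ "\<lambda>i. \<tau> (i + fv_bound A)" "fv_bound A"])
    (use assms in \<open>simp_all flip: univ_closure_def add: subst_univ_closure\<close>)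

lemma derives_subst: "derives T [] A \<Longrightarrow> (\<And>i. wf_tm (\<tau> i)) \<Longrightarrow> derives T [] (subst \<tau> A)"
  by (rule derives_univ_closure_inst) (simp_all add: univ_closure_def derives_Alls)

subsection \<open>Schemas under the double negation\<close>

text \<open>Closures are collected, not the instances themselves, because closed formulas are fixed
  by the \<open>shift\<close> that \<open>AllI\<close> and \<open>ExE\<close> apply to the context.
  An instance is recovered from its closure by the identity substitution.\<close>

lemma compactness:
  "derives (T \<union> P) \<Gamma> A \<Longrightarrow> \<exists>Cs. set Cs \<subseteq> univ_closure ` P \<and> derives T (\<Gamma> @ Cs) A"
proof (induction rule: derives.induct)
  case (Axiom A \<Gamma>)
  show ?case
  proof (cases "A \<in> T")
    case True
    then show ?thesis using Axiom by (intro exI[of _ "[]"]) (auto intro: derives.Axiom)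
  next
    case False
    have "derives T (\<Gamma> @ [univ_closure A]) (univ_closure A)"
      using Axiom by (intro derives.Assm) (auto simp: univ_closure_def)
    from derives_univ_closure_inst[OF this, of Var] show ?thesis
      using Axiom False by (intro exI[of _ "[univ_closure A]"]) auto
  qed
next
  case (Assm A \<Gamma>)
  then show ?case by (intro exI[of _ "[]"]) (auto intro: derives.Assm)
next
  case (AndI \<Gamma> A B)
  then obtain Cs Ds where "set Cs \<subseteq> univ_closure ` P" "set Ds \<subseteq> univ_closure ` P"
    "derives T (\<Gamma> @ Cs) A" "derives T (\<Gamma> @ Ds) B" by auto
  then show ?case
    by (intro exI[of _ "Cs @ Ds"]) (auto intro!: derives.AndI elim: derives_weaken)
next
  case (OrE \<Gamma> A B C)
  then obtain Cs Ds Es where *: "set Cs \<subseteq> univ_closure ` P" "set Ds \<subseteq> univ_closure ` P"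
    "set Es \<subseteq> univ_closure ` P" "derives T (\<Gamma> @ Cs) (Or A B)" "derives T (A # \<Gamma> @ Ds) C"
    "derives T (B # \<Gamma> @ Es) C" by auto
  have "derives T (\<Gamma> @ Cs @ Ds @ Es) C"
    by (rule derives.OrE[OF derives_weaken[OF *(4)] derives_weaken[OF *(5)] derives_weaken[OF *(6)]]) auto
  then show ?case using * by (intro exI[of _ "Cs @ Ds @ Es"]) auto
next
  case (ImpE \<Gamma> A B)
  then obtain Cs Ds where *: "set Cs \<subseteq> univ_closure ` P" "set Ds \<subseteq> univ_closure ` P"
    "derives T (\<Gamma> @ Cs) (Imp A B)" "derives T (\<Gamma> @ Ds) A" by auto
  have "derives T (\<Gamma> @ Cs @ Ds) B"
    by (rule derives.ImpE[OF derives_weaken[OF *(3)] derives_weaken[OF *(4)]]) auto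
  then show ?case using * by (intro exI[of _ "Cs @ Ds"]) auto
next
  case (AllI \<Gamma> A)
  then obtain Cs where *: "set Cs \<subseteq> univ_closure ` P" "derives T (map shift \<Gamma> @ Cs) A" by auto
  have "map shift Cs = Cs" using *(1) by (intro map_idI) (auto simp: shift_univ_closure)
  then show ?case using * by (intro exI[of _ Cs]) (auto intro: derives.AllI)
next
  case (ExE \<Gamma> A B)
  then obtain Cs Ds where *: "set Cs \<subseteq> univ_closure ` P" "set Ds \<subseteq> univ_closure ` P"
    "derives T (\<Gamma> @ Cs) (Ex A)" "derives T (A # map shift \<Gamma> @ Ds) (shift B)" by auto
  have "map shift Ds = Ds" using *(2) by (intro map_idI) (auto simp: shift_univ_closure)
  then have B: "derives T (A # map shift (\<Gamma> @ Cs @ Ds)) (shift B)"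
    by (intro derives_weaken[OF *(4)]) auto
  have "derives T (\<Gamma> @ Cs @ Ds) B"
    by (rule derives.ExE[OF derives_weaken[OF *(3)] B ExE.hyps(3)]) auto
  then show ?case using * by (intro exI[of _ "Cs @ Ds"]) auto
next
  case (EqSubst \<Gamma> s t A)
  then obtain Cs Ds where *: "set Cs \<subseteq> univ_closure ` P" "set Ds \<subseteq> univ_closure ` P"
    "derives T (\<Gamma> @ Cs) (Eq s t)" "derives T (\<Gamma> @ Ds) (inst s A)" by auto
  have "derives T (\<Gamma> @ Cs @ Ds) (inst t A)"
    by (rule derives.EqSubst[OF derives_weaken[OF *(3)] derives_weaken[OF *(4)] EqSubst.hyps(3)]) auto
  then show ?case using * by (intro exI[of _ "Cs @ Ds"]) auto
next
  case (ImpI A \<Gamma> B)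
  then show ?case by (auto intro: derives.ImpI)
next
  case (EqRefl t \<Gamma>)
  then show ?case by (intro exI[of _ "[]"]) (auto intro: derives.EqRefl)
qed (blast intro: derives.intros)+

lemma derives_NegE: "derives T \<Gamma> (Neg A) \<Longrightarrow> derives T \<Gamma> A \<Longrightarrow> derives T \<Gamma> Falsum"
  unfolding Neg_def by (rule derives.ImpE)

lemma derives_NegI: "derives T (A # \<Gamma>) Falsum \<Longrightarrow> wf_fm A \<Longrightarrow> derives T \<Gamma> (Neg A)"
  unfolding Neg_def by (rule derives.ImpI)

text \<open>With absurdity as the goal, an assumption \<open>C\<close> can be discharged to
  \<open>Neg C\<close>, which \<open>Neg (Neg C)\<close> refutes; the assumptions are removed one at
  a time.\<close>

lemma derives_Falsum_nn:
  "derives T (Cs @ \<Gamma>) Falsum \<Longrightarrow> (\<And>C. C \<in> set Cs \<Longrightarrow> derives T [] (Neg (Neg C))) \<Longrightarrow>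
    derives T \<Gamma> Falsum"
proof (induction Cs)
  case (Cons C Cs)
  have C: "derives T [] (Neg (Neg C))" by (rule Cons.prems) simp
  have "wf_fm C" using derives_wf[OF C] by simp
  then have "derives T (Cs @ \<Gamma>) (Neg C)" using Cons.prems(1) by (intro derives_NegI) auto
  then have "derives T (Cs @ \<Gamma>) Falsum" by (rule derives_NegE[OF derives_Nil[OF C]])
  then show ?case by (rule Cons.IH) (rule Cons.prems, simp)
qed simp

lemma entails_nn_closure:
  assumes P: "\<And>A. A \<in> P \<Longrightarrow> wf_fm A" and Q: "\<And>A. A \<in> Q \<Longrightarrow> derives (HA \<union> P) [] A"
  shows "entails (nn_closure P) (nn_closure Q)"
  unfolding entails_def
proof
  let ?T = "HA \<union> nn_closure P"
  fix B assume "B \<in> nn_closure Q"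
  then obtain A where A: "A \<in> Q" "B = Neg (Neg (univ_closure A))" by (auto simp: nn_closure_def)
  have "derives (HA \<union> P) [] (univ_closure A)"
    unfolding univ_closure_def using Q[OF A(1)] by (rule derives_Alls)
  then obtain Cs where Cs: "set Cs \<subseteq> univ_closure ` P" "derives HA Cs (univ_closure A)"
    using compactness by fastforce
  have wf: "wf_fm (univ_closure A)" using derives_wf[OF Cs(2)] .
  let ?N = "Neg (univ_closure A)"
  have "derives ?T (Cs @ [?N]) (univ_closure A)"
    by (rule derives_weaken[OF derives_mono[OF Cs(2)]]) auto
  moreover have "derives ?T (Cs @ [?N]) ?N" using wf by (intro derives.Assm) simp_all
  ultimately have "derives ?T (Cs @ [?N]) Falsum" by (rule derives_NegE[rotated])
  then have "derives ?T [?N] Falsum"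
  proof (rule derives_Falsum_nn)
    fix C assume "C \<in> set Cs"
    then obtain D where D: "D \<in> P" "C = univ_closure D" using Cs by auto
    then have "Neg (Neg C) \<in> ?T" by (auto simp: nn_closure_def)
    then show "derives ?T [] (Neg (Neg C))"
      using P[OF D(1)] by (intro derives.Axiom) (simp_all add: D(2) univ_closure_def)
  qed
  then show "derives ?T [] B" unfolding A(2) using wf by (intro derives_NegI) simp_all
qed

subsection \<open>Derived rules\<close>

lemma derives_cut: "derives T [A] B \<Longrightarrow> derives T \<Gamma> A \<Longrightarrow> derives T \<Gamma> B"
  by (rule derives.ImpE[OF derives_Nil[OF derives.ImpI]]) (auto dest: derives_wf)

lemma derives_cut2:
  assumes "derives T [A, B] C" "derives T \<Gamma> A" "derives T \<Gamma> B"
  shows "derives T \<Gamma> C"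
proof -
  have "derives T [] (Imp B (Imp A C))"
    using assms derives_wf by (intro derives.ImpI) auto
  then show ?thesis using assms derives_Nil derives.ImpE by blast
qed

lemma derives_IffI:
  "derives T (A # \<Gamma>) B \<Longrightarrow> derives T (B # \<Gamma>) A \<Longrightarrow> derives T \<Gamma> (Iff A B)"
  unfolding Iff_def by (intro derives.AndI derives.ImpI) (auto dest: derives_wf)

lemma derives_IffD1: "derives T \<Gamma> (Iff A B) \<Longrightarrow> derives T \<Gamma> A \<Longrightarrow> derives T \<Gamma> B"
  and derives_IffD2: "derives T \<Gamma> (Iff A B) \<Longrightarrow> derives T \<Gamma> B \<Longrightarrow> derives T \<Gamma> A"
  unfolding Iff_def by (blast intro: derives.AndE1 derives.AndE2 derives.ImpE)+

lemma wf_Iff [simp]: "wf_fm (Iff A B) \<longleftrightarrow> wf_fm A \<and> wf_fm B"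
  by (auto simp: Iff_def)

lemma derives_Cons: "derives T \<Gamma> A \<Longrightarrow> derives T (B # \<Gamma>) A"
  by (erule derives_weaken) auto

lemma derives_hd: "wf_fm A \<Longrightarrow> derives T (A # \<Gamma>) A"
  by (intro derives.Assm) auto

lemma derives_Iff_trans:
  assumes "derives T \<Gamma> (Iff A B)" "derives T \<Gamma> (Iff B C)"
  shows "derives T \<Gamma> (Iff A C)"
proof -
  have "wf_fm A" "wf_fm C" using assms[THEN derives_wf] by simp_all
  then show ?thesis
    by (meson assms derives_Cons derives_IffD1 derives_IffD2 derives_IffI derives_hd)
qed

lemma derives_Iff_Or:
  assumes "derives T \<Gamma> (Iff A A')" "derives T \<Gamma> (Iff B B')"
  shows "derives T \<Gamma> (Iff (Or A B) (Or A' B'))"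
proof -
  have wf: "wf_fm A" "wf_fm B" "wf_fm A'" "wf_fm B'" using assms[THEN derives_wf] by simp_all
  show ?thesis
  proof (rule derives_IffI)
    show "derives T (Or A B # \<Gamma>) (Or A' B')"
    proof (rule derives.OrE[OF derives_hd])
      show "derives T (A # Or A B # \<Gamma>) (Or A' B')"
        using wf assms by (intro derives.OrI1 derives_IffD1[of _ _ A A'] derives_Cons derives_hd)
      show "derives T (B # Or A B # \<Gamma>) (Or A' B')"
        using wf assms by (intro derives.OrI2 derives_IffD1[of _ _ B B'] derives_Cons derives_hd)
    qed (use wf in simp)
    show "derives T (Or A' B' # \<Gamma>) (Or A B)"
    proof (rule derives.OrE[OF derives_hd])
      show "derives T (A' # Or A' B' # \<Gamma>) (Or A B)"
        using wf assms by (intro derives.OrI1 derives_IffD2[of _ _ A A'] derives_Cons derives_hd)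
      show "derives T (B' # Or A' B' # \<Gamma>) (Or A B)"
        using wf assms by (intro derives.OrI2 derives_IffD2[of _ _ B B'] derives_Cons derives_hd)
    qed (use wf in simp)
  qed
qed

lemma derives_All_Var0:
  "shift (All A) \<in> set \<Gamma> \<Longrightarrow> wf_fm A \<Longrightarrow> derives T \<Gamma> A"
proof -
  assume "shift (All A) \<in> set \<Gamma>" "wf_fm A"
  then have "derives T \<Gamma> (All (subst (up (\<lambda>i. Var (Suc i))) A))"
    by (intro derives.Assm) (auto simp: shift_Q intro!: wf_subst wf_up)
  from derives.AllE[OF this, of "Var 0"] show ?thesis by (simp add: inst_Var0)
qed

lemma derives_Ex_Var0: "derives T \<Gamma> A \<Longrightarrow> derives T \<Gamma> (shift (Ex A))"
  unfolding shift_Q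
  by (rule derives.ExI[of _ _ "Var 0"]) (auto simp: inst_Var0 intro!: wf_subst wf_up dest: derives_wf)

lemma derives_Imp_All:
  assumes "derives T (map shift \<Gamma>) (Imp A B)"
  shows "derives T \<Gamma> (Imp (All A) (All B))"
proof -
  have wf: "wf_fm A" using derives_wf[OF assms] by simp
  show ?thesis
  proof (rule derives.ImpI, rule derives.AllI)
    show "derives T (map shift (All A # \<Gamma>)) B"
      by (rule derives.ImpE[OF derives_weaken[OF assms] derives_All_Var0]) (use wf in auto)
  qed (use wf in simp)
qed

lemma derives_Imp_Ex:
  assumes "derives T (map shift \<Gamma>) (Imp A B)"
  shows "derives T \<Gamma> (Imp (Ex A) (Ex B))"
proof -
  have wf: "wf_fm A" "wf_fm B" using derives_wf[OF assms] by simp_all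
  have "derives T (A # map shift (Ex A # \<Gamma>)) (shift (Ex B))"
    by (rule derives_Ex_Var0[OF derives.ImpE[OF derives_weaken[OF assms] derives_hd]]) (use wf in auto)
  from derives.ExE[OF derives_hd this] show ?thesis
    using wf by (intro derives.ImpI) auto
qed

lemma derives_Iff_All:
  "derives T (map shift \<Gamma>) (Iff A B) \<Longrightarrow> derives T \<Gamma> (Iff (All A) (All B))"
  and derives_Iff_Ex:
  "derives T (map shift \<Gamma>) (Iff A B) \<Longrightarrow> derives T \<Gamma> (Iff (Ex A) (Ex B))"
  unfolding Iff_def
  by (intro derives.AndI derives_Imp_All derives_Imp_Ex; erule derives.AndE1 derives.AndE2)+

lemma derives_Iff_Ex_shift: "wf_fm A \<Longrightarrow> derives T \<Gamma> (Iff A (Ex (shift A)))"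
proof (rule derives_IffI)
  assume wf: "wf_fm A"
  show "derives T (A # \<Gamma>) (Ex (shift A))"
    using wf by (intro derives.ExI[of _ _ zero]) (simp_all add: derives_hd)
  have "derives T (shift A # map shift (Ex (shift A) # \<Gamma>)) (shift A)"
    using wf by (simp add: derives_hd)
  from derives.ExE[OF derives_hd this wf] wf show "derives T (Ex (shift A) # \<Gamma>) A" by simp
qed

lemma derives_Iff_All_shift: "wf_fm A \<Longrightarrow> derives T \<Gamma> (Iff A (All (shift A)))"
proof (rule derives_IffI)
  assume wf: "wf_fm A"
  show "derives T (A # \<Gamma>) (All (shift A))"
    using wf by (intro derives.AllI) (simp add: derives_hd)
  have "derives T (All (shift A) # \<Gamma>) (inst zero (shift A))"
    using wf by (intro derives.AllE derives_hd) simp_all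
  then show "derives T (All (shift A) # \<Gamma>) A" by simp
qed

section \<open>Padding by dummy quantifiers\<close>

lemma shift_hierarchy:
  "A \<in> Sigma_fm k \<Longrightarrow> shift A \<in> Sigma_fm k" "A \<in> Pi_fm k \<Longrightarrow> shift A \<in> Pi_fm k"
  unfolding shift_def by (rule subst_hierarchy; simp)+

text \<open>Formulas of level \<open>k\<close> have exactly \<open>k\<close> quantifiers, so the
  levels are not nested. The dummy quantifier is added innermost, which keeps the leading quantifier
  and the alternation.\<close>

lemma pad_Suc:
  "A \<in> Sigma_fm k \<Longrightarrow> \<exists>A'\<in>Sigma_fm (Suc k). \<forall>\<Gamma>. derives T \<Gamma> (Iff A A')"
  "A \<in> Pi_fm k \<Longrightarrow> \<exists>A'\<in>Pi_fm (Suc k). \<forall>\<Gamma>. derives T \<Gamma> (Iff A A')"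
proof (induction k arbitrary: A)
  case 0
  {
    case 1
    then show ?case using derives_Iff_Ex_shift by (intro bexI[of _ "Ex (shift A)"]) auto
  next
    case 2
    then show ?case using derives_Iff_All_shift by (intro bexI[of _ "All (shift A)"]) auto
  }
next
  case (Suc k)
  {
    case 1
    then obtain B where B: "A = Ex B" "B \<in> Pi_fm k" by auto
    then obtain B' where "B' \<in> Pi_fm (Suc k)" "\<forall>\<Gamma>. derives T \<Gamma> (Iff B B')" using Suc(2) by blast
    then show ?case using B derives_Iff_Ex by (intro bexI[of _ "Ex B'"]) auto
  next
    case 2
    then obtain B where B: "A = All B" "B \<in> Sigma_fm k" by auto
    then obtain B' where "B' \<in> Sigma_fm (Suc k)" "\<forall>\<Gamma>. derives T \<Gamma> (Iff B B')" using Suc(1) by blast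
    then show ?case using B derives_Iff_All by (intro bexI[of _ "All B'"]) auto
  }
qed

lemma pad_le:
  assumes "k \<le> n" "A \<in> Sigma_fm k"
  shows "\<exists>A'\<in>Sigma_fm n. derives T [] (Iff A A')"
  using assms(1)
proof (induction n rule: dec_induct)
  case base
  have "wf_fm A" using assms(2) Sigma_Pi_wf by blast
  then have "derives T [] (Iff A A)" by (intro derives_IffI derives_hd)
  then show ?case using assms(2) by blast
next
  case (step n)
  then obtain A' where "A' \<in> Sigma_fm n" "derives T [] (Iff A A')" by blast
  then show ?case using pad_Suc(1)[of A' n T] derives_Iff_trans by blast
qed

subsection \<open>Duals\<close>

primrec dl :: "fm \<Rightarrow> fm" where
  "dl (Eq s t) = Neg (Eq s t)"
| "dl (And A B) = Neg (And A B)"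
| "dl (Or A B) = Neg (Or A B)"
| "dl (Imp A B) = Neg (Imp A B)"
| "dl (All A) = Ex (dl A)"
| "dl (Ex A) = All (dl A)"

lemma dl_qfree: "qfree A \<Longrightarrow> dl A = Neg A"
  by (cases A) simp_all

lemma qfree_Neg [simp]: "qfree (Neg A) = qfree A"
  by (simp add: Neg_def Falsum_def)

lemma dl_hierarchy: "A \<in> Sigma_fm k \<Longrightarrow> dl A \<in> Pi_fm k" "A \<in> Pi_fm k \<Longrightarrow> dl A \<in> Sigma_fm k"
  by (induction k arbitrary: A) (auto simp: dl_qfree)

lemma hierarchy_wf: "A \<in> Sigma_fm k \<union> Pi_fm k \<Longrightarrow> wf_fm A \<and> wf_fm (dl A)"
  using Sigma_Pi_wf dl_hierarchy by blast

lemma dual_excl: "A \<in> Sigma_fm k \<union> Pi_fm k \<Longrightarrow> derives T [A, dl A] Falsum"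
proof (induction k arbitrary: A)
  case 0
  then have "derives T [A, Neg A] (Neg A)" "derives T [A, Neg A] A"
    by (auto intro: derives.Assm)
  then show ?case using 0 by (auto simp: dl_qfree intro: derives_NegE)
next
  case (Suc k)
  from Suc.prems consider B where "A = Ex B" "B \<in> Pi_fm k" | B where "A = All B" "B \<in> Sigma_fm k"
    by auto
  then show ?case
  proof cases
    case 1
    then have wf: "wf_fm B" "wf_fm (dl B)" using hierarchy_wf by blast+
    have "derives T [B, dl B] Falsum" using Suc.IH 1 by blast
    then have "derives T (B # map shift [Ex B, All (dl B)]) Falsum"
      by (rule derives_cut2) (use wf in \<open>auto intro: derives_hd derives_All_Var0\<close>)
    from derives.ExE[OF derives_hd] this wf show ?thesis by (auto simp: 1)
  next
    case 2
    then have wf: "wf_fm B" "wf_fm (dl B)" using hierarchy_wf by blast+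
    have "derives T [B, dl B] Falsum" using Suc.IH 2 by blast
    then have *: "derives T (dl B # map shift [All B, Ex (dl B)]) Falsum"
      by (rule derives_cut2) (use wf in \<open>auto intro: derives_hd derives_All_Var0\<close>)
    have "derives T [All B, Ex (dl B)] (Ex (dl B))" using wf by (intro derives.Assm) auto
    from derives.ExE[OF this] * show ?thesis by (auto simp: 2)
  qed
qed

text \<open>Pointwise, a refuted left disjunct leaves the right one. With a formula and its dual as
  the disjuncts, in one order or the other, this turns a negation into a prenex formula.\<close>

lemma neg_Ex:
  assumes "derives T [] (Or A B)"
  shows "derives T [Neg (Ex A)] (All B)"
proof (rule derives.AllI)
  have wf: "wf_fm A" "wf_fm B" using derives_wf[OF assms] by simp_all
  let ?\<Gamma> = "map shift [Neg (Ex A)]"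
  show "derives T ?\<Gamma> B"
  proof (rule derives.OrE[OF derives_Nil[OF assms]])
    show "derives T (B # ?\<Gamma>) B" using wf by (intro derives_hd)
    have "derives T (A # ?\<Gamma>) (Neg (shift (Ex A)))" using wf by (intro derives.Assm) auto
    moreover have "derives T (A # ?\<Gamma>) (shift (Ex A))" using wf by (intro derives_Ex_Var0 derives_hd)
    ultimately have "derives T (A # ?\<Gamma>) Falsum" by (rule derives_NegE)
    then show "derives T (A # ?\<Gamma>) B" by (rule derives.FalsumE[OF _ wf(2)])
  qed
qed

lemma Or_commute: "derives T \<Gamma> (Or A B) \<Longrightarrow> derives T \<Gamma> (Or B A)"
proof -
  assume *: "derives T \<Gamma> (Or A B)"
  then have "wf_fm A" "wf_fm B" using derives_wf by force+
  then show ?thesis by (intro derives.OrE[OF *] derives.OrI1 derives.OrI2 derives_hd)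
qed

lemma dual_neg_Sigma:
  assumes "A \<in> Sigma_fm (Suc k)" "\<And>B. B \<in> Sigma_fm k \<union> Pi_fm k \<Longrightarrow> derives T [] (Or B (dl B))"
  shows "derives T [Neg A] (dl A)"
proof -
  obtain B where B: "A = Ex B" "B \<in> Pi_fm k" using assms(1) by auto
  then have "derives T [] (Or B (dl B))" using assms(2) by blast
  then show ?thesis by (simp add: B(1) neg_Ex)
qed

lemma dual_neg_Pi:
  assumes "A \<in> Pi_fm (Suc k)" "\<And>B. B \<in> Sigma_fm k \<union> Pi_fm k \<Longrightarrow> derives T [] (Or B (dl B))"
  shows "derives T [Neg (dl A)] A"
proof -
  obtain B where B: "A = All B" "B \<in> Sigma_fm k" using assms(1) by auto
  then have "derives T [] (Or B (dl B))" using assms(2) by blast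
  then show ?thesis by (simp add: B(1) neg_Ex Or_commute)
qed

subsection \<open>The positive parts\<close>

lemma Sigma_LEM_wf: "C \<in> Sigma_LEM n \<Longrightarrow> wf_fm C"
proof -
  assume "C \<in> Sigma_LEM n"
  then obtain A where A: "C = Or A (Neg A)" "A \<in> Sigma_fm n" unfolding Sigma_LEM_def by blast
  from Sigma_Pi_wf(1)[OF A(2)] show ?thesis by (simp add: A(1))
qed

lemma Pi_LEM_wf: "C \<in> Pi_LEM n \<Longrightarrow> wf_fm C"
proof -
  assume "C \<in> Pi_LEM n"
  then obtain A where A: "C = Or A (Neg A)" "A \<in> Pi_fm n" unfolding Pi_LEM_def by blast
  from Sigma_Pi_wf(2)[OF A(2)] show ?thesis by (simp add: A(1))
qed

lemma Sigma_DNE_wf: "C \<in> Sigma_DNE n \<Longrightarrow> wf_fm C"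
proof -
  assume "C \<in> Sigma_DNE n"
  then obtain A where A: "C = Imp (Neg (Neg A)) A" "A \<in> Sigma_fm n" unfolding Sigma_DNE_def by blast
  from Sigma_Pi_wf(1)[OF A(2)] show ?thesis by (simp add: A(1))
qed

text \<open>Excluded middle is available for existential formulas only, so a universal
  \<open>A\<close> is treated through \<open>dl A\<close>. That \<open>Neg (dl A)\<close> gives back
  \<open>A\<close> uses the dichotomy for the matrix, one level below.\<close>

lemma Sigma_LEM_Pi_LEM: "entails (nn_closure (Sigma_LEM n)) (nn_closure (Pi_LEM n))"
proof (rule entails_nn_closure[OF Sigma_LEM_wf])
  let ?T = "HA \<union> Sigma_LEM n"
  have LEM: "derives ?T [] (Or A (Neg A))" if le: "k \<le> n" "A \<in> Sigma_fm k" for k A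
  proof -
    obtain A' where A': "A' \<in> Sigma_fm n" "derives ?T [] (Iff A A')"
      using pad_le[OF le, of ?T] by blast
    have wf: "wf_fm A" "wf_fm A'" using derives_wf[OF A'(2)] by simp_all
    have "derives ?T [] (Or A' (Neg A'))"
      using A' wf by (intro derives.Axiom) (auto simp: Sigma_LEM_def)
    then show ?thesis
    proof (rule derives.OrE)
      show "derives ?T [A'] (Or A (Neg A))"
        using wf by (intro derives.OrI1 derives_IffD2[OF derives_Cons[OF A'(2)]] derives_hd) simp_all
      have "derives ?T [A, Neg A'] A'"
        by (rule derives_IffD1[OF derives_Nil[OF A'(2)] derives_hd[OF wf(1)]])
      moreover have "derives ?T [A, Neg A'] (Neg A')" using wf by (intro derives.Assm) auto
      ultimately have "derives ?T [A, Neg A'] Falsum" by (rule derives_NegE[rotated])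
      then show "derives ?T [Neg A'] (Or A (Neg A))"
        using wf by (intro derives.OrI2 derives_NegI)
    qed
  qed
  have dual: "derives ?T [] (Or A (dl A))" if "k \<le> n" "A \<in> Sigma_fm k \<union> Pi_fm k" for k A
    using that
  proof (induction k arbitrary: A)
    case 0
    then show ?case using LEM[of 0 A] by (auto simp: dl_qfree)
  next
    case (Suc k)
    have IH: "derives ?T [] (Or B (dl B))" if "B \<in> Sigma_fm k \<union> Pi_fm k" for B
      using Suc.IH that Suc.prems by simp
    have wf: "wf_fm A" "wf_fm (dl A)" using hierarchy_wf Suc.prems by blast+
    from Suc.prems(2) consider "A \<in> Sigma_fm (Suc k)" | "A \<in> Pi_fm (Suc k)" by blast
    then show ?case
    proof cases
      case 1
      show ?thesis
        using wf by (intro derives.OrE[OF LEM[OF Suc.prems(1) 1]] derives.OrI1 derives.OrI2[OF dual_neg_Sigma[OF 1 IH]] derives_hd)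
    next
      case 2
      from LEM[OF Suc.prems(1) dl_hierarchy(2)[OF 2]] show ?thesis
      proof (rule derives.OrE)
        show "derives ?T [dl A] (Or A (dl A))" using wf by (intro derives.OrI2 derives_hd)
        show "derives ?T [Neg (dl A)] (Or A (dl A))"
          using wf by (intro derives.OrI1[OF dual_neg_Pi[OF 2 IH]])
      qed
    qed
  qed
  fix C assume "C \<in> Pi_LEM n"
  then obtain A where A: "C = Or A (Neg A)" "A \<in> Pi_fm n" by (auto simp: Pi_LEM_def)
  have wf: "wf_fm A" "wf_fm (dl A)" using hierarchy_wf A by blast+
  show "derives ?T [] C" unfolding A(1)
  proof (rule derives.OrE[OF dual[of n A]])
    show "derives ?T [A] (Or A (Neg A))" using wf by (intro derives.OrI1 derives_hd) simp_all
    have "derives ?T [A, dl A] Falsum" using dual_excl A(2) by blast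
    then show "derives ?T [dl A] (Or A (Neg A))" using wf by (intro derives.OrI2 derives_NegI)
  qed (use A in auto)
qed

lemma Sigma_LEM_Sigma_DNE: "entails (nn_closure (Sigma_LEM n)) (nn_closure (Sigma_DNE n))"
proof (rule entails_nn_closure[OF Sigma_LEM_wf])
  let ?T = "HA \<union> Sigma_LEM n"
  fix C assume "C \<in> Sigma_DNE n"
  then obtain A where A: "C = Imp (Neg (Neg A)) A" "A \<in> Sigma_fm n" by (auto simp: Sigma_DNE_def)
  have wf: "wf_fm A" using Sigma_Pi_wf A by blast
  have "derives ?T [Neg (Neg A)] (Or A (Neg A))"
    using A wf by (intro derives.Axiom) (auto simp: Sigma_LEM_def)
  then have "derives ?T [Neg (Neg A)] A"
  proof (rule derives.OrE)
    show "derives ?T [A, Neg (Neg A)] A" using wf by (rule derives_hd)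
    have "derives ?T [Neg A, Neg (Neg A)] Falsum"
      by (rule derives_NegE[of _ _ "Neg A"]) (use wf in \<open>auto intro!: derives.Assm\<close>)
    then show "derives ?T [Neg A, Neg (Neg A)] A" using wf by (rule derives.FalsumE)
  qed
  then show "derives ?T [] C" unfolding A(1) using wf by (intro derives.ImpI) simp_all
qed

lemma Pi_LEM_Delta_LEM: "entails (nn_closure (Pi_LEM n)) (nn_closure (Delta_LEM n))"
proof (rule entails_nn_closure[OF Pi_LEM_wf])
  let ?T = "HA \<union> Pi_LEM n"
  fix C assume "C \<in> Delta_LEM n"
  then obtain A B where C: "C = Imp (Iff A B) (Or B (Neg B))" "A \<in> Pi_fm n" "B \<in> Sigma_fm n"
    by (auto simp: Delta_LEM_def)
  have wf: "wf_fm A" "wf_fm B" using Sigma_Pi_wf C by blast+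
  have "derives ?T [Iff A B] (Or A (Neg A))"
    using C wf by (intro derives.Axiom) (auto simp: Pi_LEM_def)
  then have "derives ?T [Iff A B] (Or B (Neg B))"
  proof (rule derives.OrE)
    have "derives ?T [A, Iff A B] B"
      by (rule derives_IffD1[of _ _ A]) (use wf in \<open>auto intro!: derives.Assm\<close>)
    then show "derives ?T [A, Iff A B] (Or B (Neg B))" using wf by (intro derives.OrI1) simp_all
    have "derives ?T [B, Neg A, Iff A B] A"
      by (rule derives_IffD2[of _ _ A B]) (use wf in \<open>auto intro!: derives.Assm\<close>)
    then have "derives ?T [B, Neg A, Iff A B] Falsum"
      by (rule derives_NegE[rotated]) (use wf in \<open>auto intro!: derives.Assm\<close>)
    then show "derives ?T [Neg A, Iff A B] (Or B (Neg B))"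
      using wf by (intro derives.OrI2 derives_NegI)
  qed
  then show "derives ?T [] C" unfolding C(1) using wf by (intro derives.ImpI) simp_all
qed

subsection \<open>Disjunctions of existential formulas\<close>

lemma inst_tm_shift: "subst_tm (case_nat t Var) (subst_tm (\<lambda>j. Var (Suc j)) s) = s"
  by (simp add: subst_tm_subst_tm)

lemma inst_Eq: "inst t (Eq u v) = Eq (subst_tm (case_nat t Var) u) (subst_tm (case_nat t Var) v)"
  by (simp add: inst_def)

lemma derives_Eq_wf: "derives T \<Gamma> (Eq s t) \<Longrightarrow> wf_tm s \<and> wf_tm t"
  by (drule derives_wf) simp

lemma derives_Eq_cong:
  assumes "derives T \<Gamma> (Eq s t)" "wf_tm u"
  shows "derives T \<Gamma> (Eq (subst_tm (case_nat s Var) u) (subst_tm (case_nat t Var) u))"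
proof -
  let ?s = "subst_tm (case_nat s Var) u"
  have wf: "wf_tm ?s"
    using derives_Eq_wf[OF assms(1)] assms(2) by (intro wf_subst_tm) (auto split: nat.split)
  have "derives T \<Gamma> (inst s (Eq (subst_tm (\<lambda>j. Var (Suc j)) ?s) u))"
    using wf by (simp add: inst_Eq inst_tm_shift derives.EqRefl)
  from derives.EqSubst[OF assms(1) this] show ?thesis
    using wf assms(2) by (simp add: inst_Eq inst_tm_shift wf_tm_shift)
qed

lemma derives_Eq_trans:
  assumes "derives T \<Gamma> (Eq s t)" "derives T \<Gamma> (Eq t u)"
  shows "derives T \<Gamma> (Eq s u)"
proof -
  have wf: "wf_tm s" using derives_Eq_wf[OF assms(1)] by simp
  have "derives T \<Gamma> (inst t (Eq (subst_tm (\<lambda>j. Var (Suc j)) s) (Var 0)))"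
    using assms(1) by (simp add: inst_Eq inst_tm_shift)
  from derives.EqSubst[OF assms(2) this] show ?thesis
    using wf by (simp add: inst_Eq inst_tm_shift wf_tm_shift)
qed

lemma derives_Eq_sym:
  assumes "derives T \<Gamma> (Eq s t)"
  shows "derives T \<Gamma> (Eq t s)"
proof -
  have wf: "wf_tm s" using derives_Eq_wf[OF assms(1)] by simp
  have "derives T \<Gamma> (inst s (Eq (Var 0) (subst_tm (\<lambda>j. Var (Suc j)) s)))"
    using wf by (simp add: inst_Eq inst_tm_shift derives.EqRefl)
  from derives.EqSubst[OF assms this] show ?thesis
    using wf by (simp add: inst_Eq inst_tm_shift wf_tm_shift)
qed

lemma derives_Eq_App1:
  "derives T \<Gamma> (Eq s t) \<Longrightarrow> wf_pr p \<Longrightarrow> arity p = 1 \<Longrightarrow> derives T \<Gamma> (Eq (App p [s]) (App p [t]))"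
  using derives_Eq_cong[of T \<Gamma> s t "App p [Var 0]"] by simp

lemma derives_Eq_App2:
  assumes "derives T \<Gamma> (Eq s s')" "derives T \<Gamma> (Eq r r')" "wf_pr p" "arity p = 2"
  shows "derives T \<Gamma> (Eq (App p [s, r]) (App p [s', r']))"
proof (rule derives_Eq_trans)
  have wf: "wf_tm r" "wf_tm s'" using derives_Eq_wf assms(1,2) by blast+
  show "derives T \<Gamma> (Eq (App p [s, r]) (App p [s', r]))"
    using derives_Eq_cong[OF assms(1), of "App p [Var 0, subst_tm (\<lambda>j. Var (Suc j)) r]"] assms wf
    by (simp add: inst_tm_shift wf_tm_shift)
  show "derives T \<Gamma> (Eq (App p [s', r]) (App p [s', r']))"
    using derives_Eq_cong[OF assms(2), of "App p [subst_tm (\<lambda>j. Var (Suc j)) s', Var 0]"] assms wf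
    by (simp add: inst_tm_shift wf_tm_shift)
qed

text \<open>A number \<open>x\<close> codes the side \<open>pPar x\<close> of a disjunction and the witness \<open>pHalf x\<close>.\<close>

definition "pNot = Rec (Comp 0 Succ [Zero]) (Comp 2 Zero [])"
definition "pPar = Rec Zero (Comp 2 pNot [Proj 2 1])"
definition "pAdd = Rec (Proj 1 0) (Comp 3 Succ [Proj 3 1])"
definition "pHalf = Rec Zero (Comp 2 pAdd [Comp 2 pPar [Proj 2 0], Proj 2 1])"
definition "pDbl = Rec Zero (Comp 2 Succ [Comp 2 Succ [Proj 2 1]])"

lemma wf_prs [simp]:
  "wf_pr pNot" "arity pNot = 1" "wf_pr pPar" "arity pPar = 1" "wf_pr pAdd" "arity pAdd = 2"
  "wf_pr pHalf" "arity pHalf = 1" "wf_pr pDbl" "arity pDbl = 1"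
  by (simp_all add: pNot_def pPar_def pAdd_def pHalf_def pDbl_def)

section \<open>Parity and halving inside HA\<close>

context
  fixes T :: "fm set"
  assumes HA: "HA \<subseteq> T"
begin

lemma Rec0:
  "wf_tm (App (Rec f g) (zero # ts)) \<Longrightarrow> derives T \<Gamma> (Eq (App (Rec f g) (zero # ts)) (App f ts))"
  by (rule derives.Axiom[OF subsetD[OF HA HA.Rec_zero]]) auto

lemma RecS:
  "wf_tm (App (Rec f g) (succ t # ts)) \<Longrightarrow> derives T \<Gamma>
    (Eq (App (Rec f g) (succ t # ts)) (App g (t # App (Rec f g) (t # ts) # ts)))"
  by (rule derives.Axiom[OF subsetD[OF HA HA.Rec_succ]]) auto

lemma CompE:
  "wf_tm (App (Comp n f gs) ts) \<Longrightarrow>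
    derives T \<Gamma> (Eq (App (Comp n f gs) ts) (App f (map (\<lambda>g. App g ts) gs)))"
  by (rule derives.Axiom[OF subsetD[OF HA HA.Comp_eq]]) auto

lemma ProjE: "wf_tm (App (Proj n i) ts) \<Longrightarrow> derives T \<Gamma> (Eq (App (Proj n i) ts) (ts ! i))"
  by (rule derives.Axiom[OF subsetD[OF HA HA.Proj_eq]]) auto

lemma Not0: "derives T \<Gamma> (Eq (App pNot [zero]) (succ zero))"
  unfolding pNot_def
  by (rule derives_Eq_trans[OF Rec0 CompE[of 0 Succ "[Zero]" "[]", simplified]]) simp_all

lemma Not1: "derives T \<Gamma> (Eq (App pNot [succ zero]) zero)"
  using derives_Eq_trans[OF RecS CompE, of "Comp 0 Succ [Zero]" 2 Zero "[]" zero "[]" \<Gamma>]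
  by (simp add: pNot_def)

lemma Par0: "derives T \<Gamma> (Eq (App pPar [zero]) zero)"
  unfolding pPar_def by (rule Rec0) simp

lemma ParS: "wf_tm t \<Longrightarrow> derives T \<Gamma> (Eq (App pPar [succ t]) (App pNot [App pPar [t]]))"
proof -
  assume wf: "wf_tm t"
  have 1: "derives T \<Gamma> (Eq (App pPar [succ t]) (App (Comp 2 pNot [Proj 2 1]) [t, App pPar [t]]))"
    unfolding pPar_def by (rule RecS) (use wf in simp)
  have 2: "derives T \<Gamma> (Eq (App (Comp 2 pNot [Proj 2 1]) [t, App pPar [t]])
      (App pNot [App (Proj 2 1) [t, App pPar [t]]]))"
    using CompE[of 2 pNot "[Proj 2 1]" "[t, App pPar [t]]"] wf by simp
  have 3: "derives T \<Gamma> (Eq (App (Proj 2 1) [t, App pPar [t]]) (App pPar [t]))"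
    using ProjE[of 2 1 "[t, App pPar [t]]"] wf by simp
  show ?thesis
    by (rule derives_Eq_trans[OF 1 derives_Eq_trans[OF 2 derives_Eq_App1[OF 3]]]) simp_all
qed

lemma Add0: "wf_tm r \<Longrightarrow> derives T \<Gamma> (Eq (App pAdd [zero, r]) r)"
  using derives_Eq_trans[OF Rec0 ProjE, of 1 0 "Comp 3 Succ [Proj 3 1]" "[r]" \<Gamma>]
  by (simp add: pAdd_def)

lemma Add1: "wf_tm r \<Longrightarrow> derives T \<Gamma> (Eq (App pAdd [succ zero, r]) (succ r))"
proof -
  assume wf: "wf_tm r"
  let ?ts = "[zero, App pAdd [zero, r], r]"
  have 1: "derives T \<Gamma> (Eq (App pAdd [succ zero, r]) (App (Comp 3 Succ [Proj 3 1]) ?ts))"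
    unfolding pAdd_def by (rule RecS) (use wf in simp)
  have 2: "derives T \<Gamma> (Eq (App (Comp 3 Succ [Proj 3 1]) ?ts) (App Succ [App (Proj 3 1) ?ts]))"
    using CompE[of 3 Succ "[Proj 3 1]" ?ts] wf by simp
  have 3: "derives T \<Gamma> (Eq (App (Proj 3 1) ?ts) (App pAdd [zero, r]))"
    using ProjE[of 3 1 ?ts] wf by simp
  show ?thesis
    by (rule derives_Eq_trans[OF 1 derives_Eq_trans[OF 2 derives_Eq_App1[OF derives_Eq_trans[OF 3 Add0[OF wf]]]]])
      simp_all
qed

lemma Half0: "derives T \<Gamma> (Eq (App pHalf [zero]) zero)"
  unfolding pHalf_def by (rule Rec0) simp

lemma HalfS: "wf_tm t \<Longrightarrow> derives T \<Gamma> (Eq (App pHalf [succ t]) (App pAdd [App pPar [t], App pHalf [t]]))"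
proof -
  assume wf: "wf_tm t"
  let ?ts = "[t, App pHalf [t]]"
  let ?g = "Comp 2 pPar [Proj 2 0]"
  have 1: "derives T \<Gamma> (Eq (App pHalf [succ t]) (App (Comp 2 pAdd [?g, Proj 2 1]) ?ts))"
    unfolding pHalf_def by (rule RecS) (use wf in simp)
  have 2: "derives T \<Gamma> (Eq (App (Comp 2 pAdd [?g, Proj 2 1]) ?ts) (App pAdd [App ?g ?ts, App (Proj 2 1) ?ts]))"
    using CompE[of 2 pAdd "[?g, Proj 2 1]" ?ts] wf by simp
  have 3: "derives T \<Gamma> (Eq (App (Proj 2 1) ?ts) (App pHalf [t]))"
    using ProjE[of 2 1 ?ts] wf by simp
  have 4: "derives T \<Gamma> (Eq (App ?g ?ts) (App pPar [App (Proj 2 0) ?ts]))"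
    using CompE[of 2 pPar "[Proj 2 0]" ?ts] wf by simp
  have 5: "derives T \<Gamma> (Eq (App (Proj 2 0) ?ts) t)"
    using ProjE[of 2 0 ?ts] wf by simp
  have 6: "derives T \<Gamma> (Eq (App ?g ?ts) (App pPar [t]))"
    by (rule derives_Eq_trans[OF 4 derives_Eq_App1[OF 5]]) simp_all
  show ?thesis
    by (rule derives_Eq_trans[OF 1 derives_Eq_trans[OF 2 derives_Eq_App2[OF 6 3]]]) simp_all
qed

lemma Dbl0: "derives T \<Gamma> (Eq (App pDbl [zero]) zero)"
  unfolding pDbl_def by (rule Rec0) simp

lemma DblS: "wf_tm t \<Longrightarrow> derives T \<Gamma> (Eq (App pDbl [succ t]) (succ (succ (App pDbl [t]))))"
proof -
  assume wf: "wf_tm t"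
  let ?ts = "[t, App pDbl [t]]"
  let ?g = "Comp 2 Succ [Proj 2 1]"
  have 1: "derives T \<Gamma> (Eq (App pDbl [succ t]) (App (Comp 2 Succ [?g]) ?ts))"
    unfolding pDbl_def by (rule RecS) (use wf in simp)
  have 2: "derives T \<Gamma> (Eq (App (Comp 2 Succ [?g]) ?ts) (succ (App ?g ?ts)))"
    using CompE[of 2 Succ "[?g]" ?ts] wf by simp
  have 3: "derives T \<Gamma> (Eq (App ?g ?ts) (succ (App (Proj 2 1) ?ts)))"
    using CompE[of 2 Succ "[Proj 2 1]" ?ts] wf by simp
  have 4: "derives T \<Gamma> (Eq (App (Proj 2 1) ?ts) (App pDbl [t]))"
    using ProjE[of 2 1 ?ts] wf by simp
  have 5: "derives T \<Gamma> (Eq (App ?g ?ts) (succ (App pDbl [t])))"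
    by (rule derives_Eq_trans[OF 3 derives_Eq_App1[OF 4]]) simp_all
  show ?thesis
    by (rule derives_Eq_trans[OF 1 derives_Eq_trans[OF 2 derives_Eq_App1[OF 5]]]) simp_all
qed

lemma even_Suc:
  assumes "derives T \<Gamma> (Eq (App pPar [d]) zero)" "derives T \<Gamma> (Eq (App pHalf [d]) v)" "wf_tm d"
  shows "derives T \<Gamma> (Eq (App pPar [succ d]) (succ zero))" "derives T \<Gamma> (Eq (App pHalf [succ d]) v)"
proof -
  show "derives T \<Gamma> (Eq (App pPar [succ d]) (succ zero))"
    by (rule derives_Eq_trans[OF ParS derives_Eq_trans[OF derives_Eq_App1[OF assms(1)] Not0]])
      (use assms in simp_all)
  have "wf_tm v" using assms(2) derives_Eq_wf by blast
  then show "derives T \<Gamma> (Eq (App pHalf [succ d]) v)"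
    by (intro derives_Eq_trans[OF HalfS derives_Eq_trans[OF derives_Eq_App2[OF assms(1,2)] Add0]])
      (use assms in simp_all)
qed

lemma odd_Suc:
  assumes "derives T \<Gamma> (Eq (App pPar [d]) (succ zero))" "derives T \<Gamma> (Eq (App pHalf [d]) v)" "wf_tm d"
  shows "derives T \<Gamma> (Eq (App pPar [succ d]) zero)" "derives T \<Gamma> (Eq (App pHalf [succ d]) (succ v))"
proof -
  show "derives T \<Gamma> (Eq (App pPar [succ d]) zero)"
    by (rule derives_Eq_trans[OF ParS derives_Eq_trans[OF derives_Eq_App1[OF assms(1)] Not1]])
      (use assms in simp_all)
  have "wf_tm v" using assms(2) derives_Eq_wf by blast
  then show "derives T \<Gamma> (Eq (App pHalf [succ d]) (succ v))"
    by (intro derives_Eq_trans[OF HalfS derives_Eq_trans[OF derives_Eq_App2[OF assms(1,2)] Add1]])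
      (use assms in simp_all)
qed

text \<open>Doubling supplies the codes of the left side, and its successor those of the right side
  by \<open>even_Suc\<close>. Both equations are proved together because the recursion for
  \<open>pHalf\<close> refers to the parity.\<close>

lemma Par_Half_Dbl:
  "derives T [] (Eq (App pPar [App pDbl [Var 0]]) zero)"
  "derives T [] (Eq (App pHalf [App pDbl [Var 0]]) (Var 0))"
proof -
  let ?I = "\<lambda>t. And (Eq (App pPar [App pDbl [t]]) zero) (Eq (App pHalf [App pDbl [t]]) t)"
  let ?S = "subst (case_nat (succ (Var 0)) (\<lambda>i. Var (Suc i))) (?I (Var 0))"
  have wf: "wf_fm (?I (Var 0))" by simp
  have "derives T [] (?I zero)"
    by (intro derives.AndI derives_Eq_trans[OF derives_Eq_App1[OF Dbl0] Par0]
        derives_Eq_trans[OF derives_Eq_App1[OF Dbl0] Half0]) simp_all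
  then have 0: "derives T [] (inst zero (?I (Var 0)))" by (simp add: inst_def)
  let ?d = "App pDbl [Var 0]"
  have d: "derives T [?I (Var 0)] (Eq (App pPar [?d]) zero)"
    "derives T [?I (Var 0)] (Eq (App pHalf [?d]) (Var 0))"
    by (rule derives.AndE1[OF derives_hd[OF wf]], rule derives.AndE2[OF derives_hd[OF wf]])
  note odd = even_Suc[OF d] and even = odd_Suc[OF even_Suc[OF d]]
  have "derives T [?I (Var 0)] (?I (succ (Var 0)))"
    by (intro derives.AndI derives_Eq_trans[OF derives_Eq_App1[OF DblS] even(1)]
        derives_Eq_trans[OF derives_Eq_App1[OF DblS] even(2)]) simp_all
  then have S: "derives T [] (All (Imp (?I (Var 0)) ?S))"
    by (intro derives.AllI derives.ImpI) simp_all
  have "derives T [] (Imp (inst zero (?I (Var 0))) (Imp (All (Imp (?I (Var 0)) ?S)) (All (?I (Var 0)))))"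
  proof (rule derives.Axiom)
    show "Imp (inst zero (?I (Var 0))) (Imp (All (Imp (?I (Var 0)) ?S)) (All (?I (Var 0)))) \<in> T"
      using HA HA.Induction[OF wf] by blast
  qed (simp add: inst_def)
  from derives.AllE[OF derives.ImpE[OF derives.ImpE[OF this 0] S], of "Var 0"]
  have "derives T [] (?I (Var 0))" by (simp add: inst_def)
  then show "derives T [] (Eq (App pPar [App pDbl [Var 0]]) zero)"
    "derives T [] (Eq (App pHalf [App pDbl [Var 0]]) (Var 0))"
    by (rule derives.AndE1, rule derives.AndE2)
qed

end

text \<open>\<open>mrg S P P'\<close> is a prenex form of \<open>(S \<and> P) \<or> (\<not> S \<and> P')\<close> for formulas with the same prefix.\<close>

fun mrg :: "fm \<Rightarrow> fm \<Rightarrow> fm \<Rightarrow> fm" where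
  "mrg S (All P) (All P') = All (mrg (shift S) P P')"
| "mrg S (Ex P) (Ex P') = Ex (mrg (shift S) P P')"
| "mrg S P P' = Or (And S P) (And (Neg S) P')"

lemma mrg_qfree: "qfree P \<Longrightarrow> mrg S P P' = Or (And S P) (And (Neg S) P')"
  by (cases P) simp_all

lemma mrg_hierarchy:
  "wf_fm S \<Longrightarrow> qfree S \<Longrightarrow> P \<in> Sigma_fm k \<Longrightarrow> P' \<in> Sigma_fm k \<Longrightarrow> mrg S P P' \<in> Sigma_fm k"
  "wf_fm S \<Longrightarrow> qfree S \<Longrightarrow> P \<in> Pi_fm k \<Longrightarrow> P' \<in> Pi_fm k \<Longrightarrow> mrg S P P' \<in> Pi_fm k"
  by (induction k arbitrary: S P P') (auto simp: mrg_qfree)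

text \<open>Intuitionistically a disjunction cannot in general be pulled out from under a universal
  quantifier. Here the context settles \<open>S\<close>, so the case distinction can be resolved at
  the matrix, below all quantifiers.\<close>

lemma mrg_left:
  "wf_fm S \<Longrightarrow> S \<in> set \<Gamma> \<Longrightarrow> (P \<in> Sigma_fm k \<and> P' \<in> Sigma_fm k) \<or> (P \<in> Pi_fm k \<and> P' \<in> Pi_fm k) \<Longrightarrow>
    derives T \<Gamma> (Iff (mrg S P P') P)"
proof (induction k arbitrary: S P P' \<Gamma>)
  case 0
  then have wf: "wf_fm P" "wf_fm P'" and qf: "qfree P" by auto
  let ?M = "Or (And S P) (And (Neg S) P')"
  have "derives T \<Gamma> (Iff ?M P)"
  proof (rule derives_IffI)
    show "derives T (P # \<Gamma>) ?M"
      using 0 wf by (intro derives.OrI1 derives.AndI) (auto intro: derives.Assm)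
    show "derives T (?M # \<Gamma>) P"
    proof (rule derives.OrE[OF derives_hd])
      show "derives T (And S P # ?M # \<Gamma>) P"
        using 0 wf by (intro derives.AndE2[OF derives_hd]) simp
      have "derives T (And (Neg S) P' # ?M # \<Gamma>) (Neg S)"
        using 0 wf by (intro derives.AndE1[OF derives_hd]) simp
      moreover have "derives T (And (Neg S) P' # ?M # \<Gamma>) S" using 0 by (intro derives.Assm) auto
      ultimately have "derives T (And (Neg S) P' # ?M # \<Gamma>) Falsum" by (rule derives_NegE)
      then show "derives T (And (Neg S) P' # ?M # \<Gamma>) P" by (rule derives.FalsumE[OF _ wf(1)])
    qed (use 0 wf in simp)
  qed
  then show ?case using qf by (simp add: mrg_qfree)
next
  case (Suc k)
  have S: "wf_fm (shift S)" "shift S \<in> set (map shift \<Gamma>)" using Suc.prems by auto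
  from Suc.prems(3) consider
      Q Q' where "P = Ex Q" "P' = Ex Q'" "Q \<in> Pi_fm k" "Q' \<in> Pi_fm k"
    | Q Q' where "P = All Q" "P' = All Q'" "Q \<in> Sigma_fm k" "Q' \<in> Sigma_fm k" by auto
  then show ?case
  proof cases
    case 1
    then have "derives T (map shift \<Gamma>) (Iff (mrg (shift S) Q Q') Q)" by (intro Suc.IH[OF S]) simp
    then show ?thesis by (simp add: 1(1,2) derives_Iff_Ex)
  next
    case 2
    then have "derives T (map shift \<Gamma>) (Iff (mrg (shift S) Q Q') Q)" by (intro Suc.IH[OF S]) simp
    then show ?thesis by (simp add: 2(1,2) derives_Iff_All)
  qed
qed

lemma mrg_right:
  "wf_fm S \<Longrightarrow> Neg S \<in> set \<Gamma> \<Longrightarrow> (P \<in> Sigma_fm k \<and> P' \<in> Sigma_fm k) \<or> (P \<in> Pi_fm k \<and> P' \<in> Pi_fm k) \<Longrightarrow>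
    derives T \<Gamma> (Iff (mrg S P P') P')"
proof (induction k arbitrary: S P P' \<Gamma>)
  case 0
  then have wf: "wf_fm P" "wf_fm P'" and qf: "qfree P" by auto
  let ?M = "Or (And S P) (And (Neg S) P')"
  have "derives T \<Gamma> (Iff ?M P')"
  proof (rule derives_IffI)
    show "derives T (P' # \<Gamma>) ?M"
      using 0 wf by (intro derives.OrI2 derives.AndI) (auto intro: derives.Assm)
    show "derives T (?M # \<Gamma>) P'"
    proof (rule derives.OrE[OF derives_hd])
      show "derives T (And (Neg S) P' # ?M # \<Gamma>) P'"
        using 0 wf by (intro derives.AndE2[OF derives_hd]) simp
      have "derives T (And S P # ?M # \<Gamma>) S"
        using 0 wf by (intro derives.AndE1[OF derives_hd]) simp
      moreover have "derives T (And S P # ?M # \<Gamma>) (Neg S)" using 0 by (intro derives.Assm) auto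
      ultimately have "derives T (And S P # ?M # \<Gamma>) Falsum" by (rule derives_NegE[rotated])
      then show "derives T (And S P # ?M # \<Gamma>) P'" by (rule derives.FalsumE[OF _ wf(2)])
    qed (use 0 wf in simp)
  qed
  then show ?case using qf by (simp add: mrg_qfree)
next
  case (Suc k)
  have "shift (Neg S) \<in> set (map shift \<Gamma>)" using Suc.prems(2) unfolding set_map by (rule imageI)
  then have S: "wf_fm (shift S)" "Neg (shift S) \<in> set (map shift \<Gamma>)" using Suc.prems by auto
  from Suc.prems(3) consider
      Q Q' where "P = Ex Q" "P' = Ex Q'" "Q \<in> Pi_fm k" "Q' \<in> Pi_fm k"
    | Q Q' where "P = All Q" "P' = All Q'" "Q \<in> Sigma_fm k" "Q' \<in> Sigma_fm k" by auto
  then show ?case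
  proof cases
    case 1
    then have "derives T (map shift \<Gamma>) (Iff (mrg (shift S) Q Q') Q')" by (intro Suc.IH[OF S]) simp
    then show ?thesis by (simp add: 1(1,2) derives_Iff_Ex)
  next
    case 2
    then have "derives T (map shift \<Gamma>) (Iff (mrg (shift S) Q Q') Q')" by (intro Suc.IH[OF S]) simp
    then show ?thesis by (simp add: 2(1,2) derives_Iff_All)
  qed
qed

text \<open>A witness of \<open>X\<close> is replaced by the code \<open>t\<close> computed from it,
  from which \<open>p\<close> recovers it; \<open>S\<close> says on which side of the disjunction
  the code lies.\<close>

lemma Ex_reindex:
  fixes p :: pr
  defines "\<sigma> \<equiv> case_nat (App p [Var 0]) (\<lambda>i. Var (Suc i))"
  assumes imp: "derives T [] (Imp S (Imp (subst \<sigma> X) M))"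
    and t: "wf_tm t" "wf_pr p" "arity p = 1"
    and S: "derives T [] (subst (case_nat t (\<lambda>i. Var (Suc i))) S)"
    and eq: "derives T [] (Eq (App p [t]) (Var 0))"
    and wf: "wf_fm X" "wf_fm M"
  shows "derives T [Ex X] (Ex M)"
proof -
  let ?\<tau> = "case_nat t (\<lambda>i. Var (Suc i))" and ?\<Gamma> = "X # map shift [Ex X]"
  \<comment> \<open>\<open>?X\<close> abstracts the witness from the remaining variables, so that
    \<open>EqSubst\<close> can replace the old witness by the provably equal
    \<open>App p [t]\<close>.\<close>
  let ?X = "subst (case_nat (Var 0) (\<lambda>i. Var (Suc (Suc i)))) X"
  have tau: "wf_tm (?\<tau> i)" for i using t by (simp split: nat.split)
  have e: "(\<lambda>i. subst_tm ?\<tau> (\<sigma> i)) = case_nat (App p [t]) (\<lambda>i. Var (Suc i))"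
    unfolding \<sigma>_def by (rule ext) (simp split: nat.split)
  have X: "inst s ?X = subst (case_nat s (\<lambda>i. Var (Suc i))) X" for s
  proof -
    have "(\<lambda>i. subst_tm (case_nat s Var) (case_nat (Var 0) (\<lambda>i. Var (Suc (Suc i))) i)) =
        case_nat s (\<lambda>i. Var (Suc i))"
      by (rule ext) (simp split: nat.split)
    then show ?thesis by (simp add: inst_def subst_subst)
  qed
  have id: "case_nat (Var 0) (\<lambda>i. Var (Suc i)) = Var" by (rule ext) (simp split: nat.split)
  have "derives T ?\<Gamma> (inst (Var 0) ?X)" unfolding X id using wf by (simp add: derives_hd)
  moreover have "wf_fm ?X" using wf by (intro wf_subst) (auto split: nat.split)
  ultimately have "derives T ?\<Gamma> (inst (App p [t]) ?X)"
    by (rule derives.EqSubst[OF derives_Nil[OF derives_Eq_sym[OF eq]]])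
  then have "derives T ?\<Gamma> (subst ?\<tau> (subst \<sigma> X))" unfolding X subst_subst e .
  moreover have "derives T ?\<Gamma> (Imp (subst ?\<tau> S) (Imp (subst ?\<tau> (subst \<sigma> X)) (subst ?\<tau> M)))"
    using derives_Nil[OF derives_subst[OF imp tau]] by simp
  ultimately have "derives T ?\<Gamma> (subst ?\<tau> M)"
    using derives_Nil[OF S] derives.ImpE by blast
  then have "derives T ?\<Gamma> (shift (Ex M))"
    unfolding shift_Q using t wf
    by (intro derives.ExI[of _ _ t]) (auto simp: inst_up intro!: wf_subst wf_up)
  from derives.ExE[OF derives_hd this] wf show ?thesis by simp
qed

text \<open>One existential quantifier has to serve both disjuncts. Its value is a code whose parity
  selects the disjunct and whose half is the witness; the decidability of the equation for the
  parity recovers the disjunction.\<close>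

lemma Sigma_disj:
  assumes HA: "HA \<subseteq> T" and em: "\<And>R. wf_fm R \<Longrightarrow> qfree R \<Longrightarrow> derives T [] (Or R (Neg R))"
    and BD: "B \<in> Sigma_fm (Suc m)" "D \<in> Sigma_fm (Suc m)"
  shows "\<exists>C\<in>Sigma_fm (Suc m). derives T [] (Iff (Or B D) C)"
proof -
  obtain B0 D0 where B0: "B = Ex B0" "B0 \<in> Pi_fm m" and D0: "D = Ex D0" "D0 \<in> Pi_fm m"
    using BD by auto
  let ?\<sigma> = "case_nat (App pHalf [Var 0]) (\<lambda>i. Var (Suc i))"
  let ?S = "Eq (App pPar [Var 0]) zero"
  have wf\<sigma>: "wf_tm (?\<sigma> i)" for i by (simp split: nat.split)
  let ?B = "subst ?\<sigma> B0" and ?D = "subst ?\<sigma> D0"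
  have BD1: "?B \<in> Pi_fm m" "?D \<in> Pi_fm m"
    using subst_hierarchy(2) B0(2) D0(2) wf\<sigma> by blast+
  let ?M = "mrg ?S ?B ?D"
  have M: "?M \<in> Pi_fm m" by (intro mrg_hierarchy BD1) simp_all
  have wf: "wf_fm B0" "wf_fm D0" "wf_fm ?B" "wf_fm ?D" "wf_fm ?M"
    using Sigma_Pi_wf(2) B0(2) D0(2) BD1 M by blast+
  have L: "derives T (?S # \<Gamma>) (Iff ?M ?B)" for \<Gamma>
    using BD1 by (intro mrg_left[of _ _ _ m]) simp_all
  have R: "derives T (Neg ?S # \<Gamma>) (Iff ?M ?D)" for \<Gamma>
    using BD1 by (intro mrg_right[of _ _ _ m]) simp_all
  let ?d = "App pDbl [Var 0]"
  note even = Par_Half_Dbl[OF HA] and odd = even_Suc[OF HA Par_Half_Dbl[OF HA]]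
  have BC: "derives T [B] (Ex ?M)"
    unfolding B0(1)
  proof (rule Ex_reindex[of T ?S pHalf B0 ?M ?d])
    have "derives T [?B, ?S] ?M"
      by (rule derives_IffD2[OF derives_Cons[OF L] derives_hd[OF wf(3)]])
    then show "derives T [] (Imp ?S (Imp ?B ?M))" using wf by (intro derives.ImpI) simp_all
  qed (use wf even in simp_all)
  have DC: "derives T [D] (Ex ?M)"
    unfolding D0(1)
  proof (rule Ex_reindex[of T "Neg ?S" pHalf D0 ?M "succ ?d"])
    have "derives T [?D, Neg ?S] ?M"
      by (rule derives_IffD2[OF derives_Cons[OF R] derives_hd[OF wf(4)]])
    then show "derives T [] (Imp (Neg ?S) (Imp ?D ?M))" using wf by (intro derives.ImpI) simp_all
    let ?E = "Eq (App pPar [succ ?d]) zero"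
    have "derives T [?E] (Eq (succ zero) zero)"
      by (rule derives_Eq_trans[OF derives_Eq_sym[OF derives_Nil[OF odd(1)]] derives_hd]) simp_all
    moreover have "derives T [?E] (Neg (Eq (succ zero) zero))"
      using HA HA.Succ_not_zero[of zero] by (intro derives.Axiom) auto
    ultimately have "derives T [?E] Falsum" by (rule derives_NegE[rotated])
    then have "derives T [] (Neg ?E)" by (rule derives_NegI) simp
    then show "derives T [] (subst (case_nat (succ ?d) (\<lambda>i. Var (Suc i))) (Neg ?S))" by simp
  qed (use wf odd in simp_all)
  have inst\<sigma>: "inst (App pHalf [Var 0]) (subst (up (\<lambda>i. Var (Suc i))) X) = subst ?\<sigma> X" for X
    by (rule inst_up)
  have ExB: "derives T \<Gamma> (shift (Ex X))" if "derives T \<Gamma> (subst ?\<sigma> X)" "wf_fm X" for X \<Gamma>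
    unfolding shift_Q using that
    by (intro derives.ExI[of _ _ "App pHalf [Var 0]"]) (auto simp: inst\<sigma> intro!: wf_subst wf_up)
  have "derives T (?M # map shift [Ex ?M]) (shift (Or B D))"
  proof (rule derives.OrE[OF derives_Nil[OF em[of ?S]]])
    let ?\<Gamma> = "?M # map shift [Ex ?M]"
    have "derives T (?S # ?\<Gamma>) ?B"
      by (rule derives_IffD1[OF L derives_Cons[OF derives_hd[OF wf(5)]]])
    from ExB[OF this wf(1)] show "derives T (?S # ?\<Gamma>) (shift (Or B D))"
      unfolding B0(1) D0(1) shift_simps using wf by (intro derives.OrI1) simp_all
    have "derives T (Neg ?S # ?\<Gamma>) ?D"
      by (rule derives_IffD1[OF R derives_Cons[OF derives_hd[OF wf(5)]]])
    from ExB[OF this wf(2)] show "derives T (Neg ?S # ?\<Gamma>) (shift (Or B D))"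
      unfolding B0(1) D0(1) shift_simps using wf by (intro derives.OrI2) simp_all
  qed simp_all
  from derives.ExE[OF derives_hd this] have CBD: "derives T [Ex ?M] (Or B D)"
    using wf by (simp add: B0(1) D0(1))
  have "derives T [Or B D] (Ex ?M)"
    by (rule derives.OrE[OF derives_hd derives_weaken[OF BC] derives_weaken[OF DC]])
      (use wf in \<open>auto simp: B0(1) D0(1)\<close>)
  then have "derives T [] (Iff (Or B D) (Ex ?M))" using CBD by (rule derives_IffI)
  then show ?thesis using M by (intro bexI[of _ "Ex ?M"]) simp_all
qed

section \<open>Stability under double negation\<close>

lemma stable_Iff:
  assumes "derives T [] (Iff A A')" "derives T [Neg (Neg A')] A'"
  shows "derives T [Neg (Neg A)] A"
proof -
  have wf: "wf_fm A" "wf_fm A'" using derives_wf[OF assms(1)] by simp_all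
  let ?\<Gamma> = "[A, Neg A', Neg (Neg A)]"
  have "derives T ?\<Gamma> A'" by (rule derives_IffD1[OF derives_Nil[OF assms(1)] derives_hd[OF wf(1)]])
  moreover have "derives T ?\<Gamma> (Neg A')" using wf by (intro derives.Assm) simp_all
  ultimately have "derives T ?\<Gamma> Falsum" by (rule derives_NegE[rotated])
  then have "derives T [Neg A', Neg (Neg A)] (Neg A)" using wf by (intro derives_NegI)
  moreover have "derives T [Neg A', Neg (Neg A)] (Neg (Neg A))" using wf by (intro derives.Assm) simp_all
  ultimately have "derives T [Neg A', Neg (Neg A)] Falsum" by (rule derives_NegE[rotated])
  then have "derives T [Neg (Neg A)] (Neg (Neg A'))" using wf by (intro derives_NegI) simp_all
  from derives_cut[OF assms(2) this] show ?thesis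
    by (rule derives_IffD2[OF derives_Nil[OF assms(1)]])
qed

lemma stable_raa:
  assumes "derives T [Neg (Neg A)] A" "derives T (Neg A # \<Gamma>) Falsum"
  shows "derives T \<Gamma> A"
proof -
  have "wf_fm A" using derives_wf[OF assms(1)] .
  then show ?thesis using assms by (intro derives_cut[OF assms(1)] derives_NegI) simp_all
qed

text \<open>Refuting the disjunction refutes \<open>A\<close>, which gives \<open>B\<close> and
  hence the disjunction again. So it is not refutable, and stability proves it.\<close>

lemma stable_em:
  assumes neg: "derives T [Neg A] B" and st: "derives T [Neg (Neg (Or A B))] (Or A B)"
  shows "derives T [] (Or A B)"
proof (rule stable_raa[OF st])
  have wf: "wf_fm A" "wf_fm B" using derives_wf[OF st] by simp_all
  let ?N = "Neg (Or A B)"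
  have N: "derives T \<Gamma> ?N" if "?N \<in> set \<Gamma>" for \<Gamma> using that wf by (intro derives.Assm) simp_all
  have "derives T [A, ?N] (Or A B)" using wf by (intro derives.OrI1 derives_hd)
  with N have "derives T [A, ?N] Falsum" by (rule derives_NegE) simp
  then have "derives T [?N] (Neg A)" using wf by (intro derives_NegI)
  then have "derives T [?N] (Or A B)" using wf by (intro derives.OrI2 derives_cut[OF neg])
  with N show "derives T [?N] Falsum" by (rule derives_NegE) simp
qed

lemma Sigma_DNE_Delta_LEM:
  assumes n: "n = Suc m"
  shows "entails (nn_closure (Sigma_DNE n)) (nn_closure (Delta_LEM n))"
proof (rule entails_nn_closure[OF Sigma_DNE_wf])
  let ?T = "HA \<union> Sigma_DNE n"
  have DNE: "derives ?T [Neg (Neg A)] A" if le: "k \<le> n" "A \<in> Sigma_fm k" for k A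
  proof -
    obtain A' where A': "A' \<in> Sigma_fm n" "derives ?T [] (Iff A A')"
      using pad_le[OF le, of ?T] by blast
    have wf: "wf_fm A'" using derives_wf[OF A'(2)] by simp
    have "derives ?T [Neg (Neg A')] (Imp (Neg (Neg A')) A')"
      using A' wf by (intro derives.Axiom) (auto simp: Sigma_DNE_def)
    from derives.ImpE[OF this derives_hd] have "derives ?T [Neg (Neg A')] A'" using wf by simp
    with A'(2) show ?thesis by (rule stable_Iff)
  qed
  \<comment> \<open>\<open>Or R (Neg R)\<close> is itself quantifier-free, hence stable by the
    padded schema.\<close>
  have em: "derives ?T [] (Or R (Neg R))" if "wf_fm R" "qfree R" for R
    by (rule stable_em[OF derives_hd DNE[of 0]]) (use that in simp_all)
  have DNE_Or: "derives ?T [Neg (Neg (Or B D))] (Or B D)"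
    if le: "Suc k \<le> n" and BD: "B \<in> Sigma_fm (Suc k)" "D \<in> Sigma_fm (Suc k)" for k B D
  proof -
    obtain C where "C \<in> Sigma_fm (Suc k)" "derives ?T [] (Iff (Or B D) C)"
      using Sigma_disj[OF Un_upper1 em BD] by blast
    then show ?thesis using stable_Iff DNE[OF le] by blast
  qed
  \<comment> \<open>A universal formula counts as an existential one of the next level by a dummy
    quantifier. This costs a level, so the dichotomy \<open>dual\<close> stops below
    \<open>n\<close>.\<close>
  have DNE_SP: "derives ?T [Neg (Neg (Or B D))] (Or B D)"
    if le: "Suc (Suc k) \<le> n" and B: "B \<in> Sigma_fm (Suc k)" and D: "D \<in> Pi_fm (Suc k)" for k B D
  proof -
    obtain B' where B': "B' \<in> Sigma_fm (Suc (Suc k))" "derives ?T [] (Iff B B')"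
      using pad_Suc(1)[OF B, of ?T] by blast
    have D': "Ex (shift D) \<in> Sigma_fm (Suc (Suc k))" using shift_hierarchy(2)[OF D] by simp
    have "derives ?T [] (Iff D (Ex (shift D)))"
      using D Sigma_Pi_wf(2) by (intro derives_Iff_Ex_shift) blast
    from stable_Iff[OF derives_Iff_Or[OF B'(2) this] DNE_Or[OF le B'(1) D']] show ?thesis .
  qed
  have Or_stable_commute: "derives ?T [Neg (Neg (Or A B))] (Or A B)"
    if st: "derives ?T [Neg (Neg (Or B A))] (Or B A)" for A B
  proof (rule stable_Iff[OF _ st])
    have "wf_fm A" "wf_fm B" using derives_wf[OF st] by simp_all
    then show "derives ?T [] (Iff (Or A B) (Or B A))"
      by (intro derives_IffI Or_commute[OF derives_hd]) simp_all
  qed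
  have dual: "derives ?T [] (Or A (dl A))" if "Suc k \<le> n" "A \<in> Sigma_fm k \<union> Pi_fm k" for k A
    using that
  proof (induction k arbitrary: A)
    case 0
    then show ?case using em[of A] by (auto simp: dl_qfree)
  next
    case (Suc k)
    have IH: "derives ?T [] (Or B (dl B))" if "B \<in> Sigma_fm k \<union> Pi_fm k" for B
      using Suc.IH that Suc.prems by simp
    from Suc.prems(2) consider "A \<in> Sigma_fm (Suc k)" | "A \<in> Pi_fm (Suc k)" by blast
    then show ?case
    proof cases
      case 1
      show ?thesis
        by (rule stable_em[OF dual_neg_Sigma[OF 1 IH] DNE_SP[OF Suc.prems(1) 1 dl_hierarchy(1)[OF 1]]])
    next
      case 2
      show ?thesis
        by (rule Or_commute, rule stable_em[OF dual_neg_Pi[OF 2 IH]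
              DNE_SP[OF Suc.prems(1) dl_hierarchy(2)[OF 2] 2]])
    qed
  qed
  fix C assume "C \<in> Delta_LEM n"
  then obtain A B where C: "C = Imp (Iff A B) (Or B (Neg B))" "A \<in> Pi_fm n" "B \<in> Sigma_fm n"
    by (auto simp: Delta_LEM_def)
  have wf: "wf_fm A" "wf_fm B" "wf_fm (dl A)" using Sigma_Pi_wf C dl_hierarchy by blast+
  have negA: "derives ?T [Neg (dl A)] A"
    by (rule dual_neg_Pi[of A m]) (use C n dual[of m] in auto)
  \<comment> \<open>At level \<open>n\<close> the dichotomy of \<open>A\<close> and
    \<open>dl A\<close> is out of reach of \<open>DNE_SP\<close>. The equivalence allows
    \<open>B\<close> in place of \<open>A\<close>, and then both disjuncts lie in
    \<open>Sigma_fm n\<close>.\<close>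
  let ?I = "Iff A B" and ?O = "Or B (dl A)"
  have "derives ?T [?I] ?O"
  proof (rule stable_raa)
    show "derives ?T [Neg (Neg ?O)] ?O"
      by (rule DNE_Or[of m]) (use C(2,3) n dl_hierarchy(2)[OF C(2)] in simp_all)
    let ?\<Gamma> = "[Neg ?O, ?I]"
    have "derives ?T (dl A # ?\<Gamma>) ?O" using wf by (intro derives.OrI2 derives_hd)
    moreover have "derives ?T (dl A # ?\<Gamma>) (Neg ?O)" using wf by (intro derives.Assm) simp_all
    ultimately have "derives ?T (dl A # ?\<Gamma>) Falsum" by (rule derives_NegE[rotated])
    then have "derives ?T ?\<Gamma> (Neg (dl A))" using wf by (intro derives_NegI)
    from derives_cut[OF negA this] have "derives ?T ?\<Gamma> B"
      by (rule derives_IffD1[rotated]) (use wf in \<open>auto intro: derives.Assm\<close>)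
    then have "derives ?T ?\<Gamma> ?O" using wf by (intro derives.OrI1)
    moreover have "derives ?T ?\<Gamma> (Neg ?O)" using wf by (intro derives_hd) simp
    ultimately show "derives ?T ?\<Gamma> Falsum" by (rule derives_NegE[rotated])
  qed
  then have "derives ?T [?I] (Or B (Neg B))"
  proof (rule derives.OrE)
    show "derives ?T [B, ?I] (Or B (Neg B))" using wf by (intro derives.OrI1 derives_hd) simp_all
    have "derives ?T [A, dl A] Falsum" using dual_excl C(2) by blast
    moreover have "derives ?T [B, dl A, ?I] A"
      by (rule derives_IffD2[of _ _ A B]) (use wf in \<open>auto intro: derives.Assm\<close>)
    moreover have "derives ?T [B, dl A, ?I] (dl A)" using wf by (intro derives.Assm) simp_all
    ultimately have "derives ?T [B, dl A, ?I] Falsum" by (rule derives_cut2)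
    then show "derives ?T [dl A, ?I] (Or B (Neg B))" using wf by (intro derives.OrI2 derives_NegI)
  qed
  then show "derives ?T [] C" unfolding C(1) using wf by (intro derives.ImpI) simp_all
qed

lemma derives_axioms:
  assumes "derives S \<Gamma> A" and T: "\<And>B. B \<in> S \<Longrightarrow> wf_fm B \<Longrightarrow> derives T [] B"
  shows "derives T \<Gamma> A"
  using assms(1)
proof (induction rule: derives.induct)
  case (Axiom A \<Gamma>)
  from T[OF Axiom] show ?case by (rule derives_Nil)
qed (rule derives.intros; assumption)+

lemma entails_trans:
  assumes "entails P Q" "entails Q R"
  shows "entails P R"
  unfolding entails_def
proof
  fix A assume "A \<in> R"
  then have "derives (HA \<union> Q) [] A" using assms(2) unfolding entails_def by blast
  then show "derives (HA \<union> P) [] A"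
  proof (rule derives_axioms)
    fix B assume "B \<in> HA \<union> Q" "wf_fm B"
    then show "derives (HA \<union> P) [] B"
      using assms(1) unfolding entails_def by (auto intro: derives.Axiom)
  qed
qed

theorem theorem2:
  fixes n :: nat
  assumes "n \<ge> 1"
  shows
    "entails (nn_closure (Sigma_LEM n)) (nn_closure (Pi_LEM n)) \<and>
     (entails (nn_closure (Pi_LEM n)) (nn_closure (Delta_LEM n)) \<and>
      \<not> entails (nn_closure (Delta_LEM n)) (nn_closure (Pi_LEM n))) \<and>
     (entails (nn_closure (Sigma_LEM n)) (nn_closure (Sigma_DNE n)) \<and>
      \<not> entails (nn_closure (Sigma_DNE n)) (nn_closure (Sigma_LEM n))) \<and>
     (entails (nn_closure (Sigma_DNE n)) (nn_closure (Delta_LEM n)) \<and>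
      \<not> entails (nn_closure (Delta_LEM n)) (nn_closure (Sigma_DNE n))) \<and>
     \<not> entails (nn_closure (Sigma_DNE n)) (nn_closure (Pi_LEM n))"
proof -
  obtain m where n: "n = Suc m" using assms by (cases n) auto
  note e = Sigma_DNE_not_Pi_LEM[of m, folded n] and d = Sigma_DNE_Delta_LEM[OF n]
  \<comment> \<open>The remaining non-entailments follow from (e): otherwise
    \<open>Sigma_DNE\<close> would entail \<open>Pi_LEM\<close>, here through
    \<open>Delta_LEM\<close> and below through \<open>Sigma_LEM\<close>.\<close>
  have "\<not> entails (nn_closure (Delta_LEM n)) (nn_closure (Pi_LEM n))"
    using e entails_trans[OF d] by blast
  moreover have "\<not> entails (nn_closure (Sigma_DNE n)) (nn_closure (Sigma_LEM n))"
    using e entails_trans[OF _ Sigma_LEM_Pi_LEM[of n]] by blast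
  ultimately show ?thesis
    using Sigma_LEM_Pi_LEM Pi_LEM_Delta_LEM Sigma_LEM_Sigma_DNE d e
      Delta_LEM_not_Sigma_DNE[of m, folded n] by blast
qed

end
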